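(* Assume that $H_1'(w)$ has full row rank. Then the input-output data $u(0),\dots,u(T),y(0),\dots,y(T)$ are informative for quadratic stabilization if and only if there exist matrices $D\in\mathbb{R}^{m\times qL}$ and $\Phi\in\mathbb{S}^{qL}$ such that $\Phi>0$ and $$\begin{bmatrix}\Phi&-\begin{bmatrix}J\Phi\\ D\\ 0\end{bmatrix}&\begin{bmatrix}J\Phi\\ D\\ 0\end{bmatrix}\\ -\begin{bmatrix}J\Phi\\ D\\ 0\end{bmatrix}^\top&-\Phi&0\\ \begin{bmatrix}J\Phi\\ D\\ 0\end{bmatrix}^\top&0&\Phi\end{bmatrix}-\begin{bmatrix}\bar N&0\\ 0&0_{qL}\end{bmatrix}>0 .$$ In that case (i.e. for any such $D,\Phi$), the feedback controller with coefficient matrix $C:=-D\Phi^{-1}$ stabilizes all systems $P(\sigma)\boldsymbol{y}=Q(\sigma)\boldsymbol{u}+\boldsymbol{v}$ of the model class that are compatible with the input-output data. Moreover, the QDF $Q_\Psi$ with $\Psi:=\Phi^{-1}$ is a common Lyapunov function for all the closed loop systems.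
   Context: Notation: $\mathbb{S}^n$ is the set of real symmetric $n\times n$ matrices; $>0,\ \geq0,\ <0$ denote (semi)definiteness; $\dagger$ is the Moore-Penrose pseudo-inverse; $\mathbb{Z}_+$ is the set of nonnegative integers; $(\sigma\boldsymbol{f})(t)=\boldsymbol{f}(t+1)$. For a symmetric partitioned $\Pi$ put $\Pi\,|\,\Pi_{22}:=\Pi_{11}-\Pi_{12}\Pi_{22}^\dagger\Pi_{21}$. Systems: fix positive integers $m,p,L,T$ with $T\geq L$, and $q:=p+m$. The model class consists of systems $P(\sigma)\boldsymbol{y}=Q(\sigma)\boldsymbol{u}+\boldsymbol{v}$ with $P(\xi)=I\xi^L+P_{L-1}\xi^{L-1}+\cdots+P_0$, $Q(\xi)=Q_{L-1}\xi^{L-1}+\cdots+Q_0$, $P_i\in\mathbb{R}^{p\times p}$, $Q_i\in\mathbb{R}^{p\times m}$, $\boldsymbol{u}:\mathbb{Z}_+\to\mathbb{R}^m$, $\boldsymbol{y},\boldsymbol{v}:\mathbb{Z}_+\to\mathbb{R}^p$ ($\boldsymbol{v}$ is unknown noise). Put $\boldsymbol{w}=\begin{bmatrix}\boldsymbol{u}\\ \boldsymbol{y}\end{bmatrix}$, $R(\xi)=\begin{bmatrix}-Q(\xi)&P(\xi)\end{bmatrix}$, and let $R=\begin{bmatrix}-Q_0&P_0&-Q_1&P_1&\cdots&-Q_{L-1}&P_{L-1}\end{bmatrix}\in\mathbb{R}^{p\times qL}$ be the coefficient matrix. Controllers: $G(\sigma)\boldsymbol{u}=F(\sigma)\boldsymbol{y}$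 with $G(\xi)=I\xi^L+G_{L-1}\xi^{L-1}+\cdots+G_0$, $F(\xi)=F_{L-1}\xi^{L-1}+\cdots+F_0$, $G_i\in\mathbb{R}^{m\times m}$, $F_i\in\mathbb{R}^{m\times p}$; coefficient matrix $C=\begin{bmatrix}G_0&-F_0&G_1&-F_1&\cdots&G_{L-1}&-F_{L-1}\end{bmatrix}\in\mathbb{R}^{m\times qL}$ and $C(\xi)=\begin{bmatrix}G(\xi)&-F(\xi)\end{bmatrix}$. The closed loop system is $\begin{bmatrix}C(\sigma)\\ R(\sigma)\end{bmatrix}\boldsymbol{w}=\begin{bmatrix}0\\ I_p\end{bmatrix}\boldsymbol{v}$. The controller stabilizes the system if for $\boldsymbol{v}=0$ all solutions $\boldsymbol{w}$ of the closed loop on $\mathbb{Z}_+$ tend to zero as $t\to\infty$. Noise model: $\Pi=\begin{bmatrix}\Pi_{11}&\Pi_{12}\\ \Pi_{21}&\Pi_{22}\end{bmatrix}\in\mathbb{S}^{p+T-L+1}$ is known, with $\Pi_{11}\in\mathbb{S}^p$, $\Pi_{22}\in\mathbb{S}^{T-L+1}$, $\Pi_{22}<0$ and $\Pi\,|\,\Pi_{22}\geq0$. The noise samples $V=\begin{bmatrix}v(0)&\cdots&v(T-L)\end{bmatrix}$ satisfy $\begin{bmatrix}I\\ V^\top\end{bmatrix}^\top\Pi\begin{bmatrix}I\\ V^\top\end{bmatrix}\geq0$. Data: $u(t)\in\mathbb{R}^m$, $y(t)\in\mathbb{R}^p$, $t=0,\dots,T$; $w(t)=\begin{bmatrix}u(t)\\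 y(t)\end{bmatrix}$. $H_1'(w)\in\mathbb{R}^{qL\times(T-L+1)}$ is the block Hankel matrix whose $(i+1)$-th block row is $\begin{bmatrix}w(i)&w(i+1)&\cdots&w(T-L+i)\end{bmatrix}$, $i=0,\dots,L-1$, and $H_2'(w)=\begin{bmatrix}y(L)&\cdots&y(T)\end{bmatrix}$. Define $$N:=\begin{bmatrix}I&H_2'(w)\\ 0&H_1'(w)\end{bmatrix}\Pi\begin{bmatrix}I&H_2'(w)\\ 0&H_1'(w)\end{bmatrix}^\top\in\mathbb{S}^{p+qL}.$$ A system with coefficient matrix $R$ is compatible with the data if and only if $\begin{bmatrix}I\\ R^\top\end{bmatrix}^\top N\begin{bmatrix}I\\ R^\top\end{bmatrix}\geq0$. The data are generated by a true system in the model class, with noise satisfying the noise model, so the set of compatible $R$ is nonempty. Further define $$\bar N:=\begin{bmatrix}\begin{bmatrix}0&0&-I_p\end{bmatrix}&0\\ 0&I_{qL}\end{bmatrix}^\top N\begin{bmatrix}\begin{bmatrix}0&0&-I_p\end{bmatrix}&0\\ 0&I_{qL}\end{bmatrix}\in\mathbb{S}^{2qL},$$ with $\begin{bmatrix}0&0&-I_p\end{bmatrix}\in\mathbb{R}^{p\times qL}$ (column blocks of sizes $q(L-1),m,p$), and $J:=\begin{bmatrix}0_{q(L-1)\times q}&I_{q(L-1)}\end{bmatrix}\in\mathbb{R}^{q(L-1)\times qL}$ (void if $L=1$). Informativity: the data are informative for quadratic stabilization if there exist $C\in\mathbb{R}^{m\times qL}$ and $\Psi\in\mathbb{S}^{qL}$,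 $\Psi\geq0$, such that $$\begin{bmatrix}I_{qL}\\ -C\\ -R\end{bmatrix}^\top\left(\begin{bmatrix}0_q&0\\ 0&\Psi\end{bmatrix}-\begin{bmatrix}\Psi&0\\ 0&0_q\end{bmatrix}\right)\begin{bmatrix}I_{qL}\\ -C\\ -R\end{bmatrix}<0$$ holds for all $R$ compatible with the data. QDFs: for $\Psi\in\mathbb{S}^{qL}$ the quadratic difference form (QDF) is $Q_\Psi(\boldsymbol{w})(t)=\eta(t)^\top\Psi\eta(t)$, where $\eta(t)$ is the stacked vector of $\boldsymbol{w}(t),\dots,\boldsymbol{w}(t+L-1)$, and $Q_{\nabla\Psi}(\boldsymbol{w})(t)=Q_\Psi(\boldsymbol{w})(t+1)-Q_\Psi(\boldsymbol{w})(t)$. $Q_\Psi$ is a Lyapunov function for a closed loop system if, on the set of its solutions $\boldsymbol{w}$ with $\boldsymbol{v}=0$, $Q_\Psi(\boldsymbol{w})(t)\geq0$ and $Q_{\nabla\Psi}(\boldsymbol{w})(t)\leq0$ for all $t$, and $Q_{\nabla\Psi}(\boldsymbol{w})$ is identically zero only if $\boldsymbol{w}=0$. *)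

theory Defs
  imports
    Complex_Main
    "Jordan_Normal_Form.DL_Rank"
    "Jordan_Normal_Form.Gauss_Jordan_Elimination"
begin

section \<open>Symmetric and definite real matrices\<close>

definition sym_mat :: "nat \<Rightarrow> real mat \<Rightarrow> bool" where
  "sym_mat n A \<longleftrightarrow> A \<in> carrier_mat n n \<and> transpose_mat A = A"

definition pos_semidef :: "nat \<Rightarrow> real mat \<Rightarrow> bool" where
  "pos_semidef n A \<longleftrightarrow> sym_mat n A \<and> (\<forall>x \<in> carrier_vec n. 0 \<le> x \<bullet> (A *\<^sub>v x))"

definition pos_def :: "nat \<Rightarrow> real mat \<Rightarrow> bool" where
  "pos_def n A \<longleftrightarrow> sym_mat n A \<and> (\<forall>x \<in> carrier_vec n. x \<noteq> 0\<^sub>v n \<longrightarrow> 0 < x \<bullet> (A *\<^sub>v x))"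

definition neg_def :: "nat \<Rightarrow> real mat \<Rightarrow> bool" where
  "neg_def n A \<longleftrightarrow> sym_mat n A \<and> (\<forall>x \<in> carrier_vec n. x \<noteq> 0\<^sub>v n \<longrightarrow> x \<bullet> (A *\<^sub>v x) < 0)"

text \<open>The four Penrose conditions, over the reals.\<close>

definition is_pinv :: "real mat \<Rightarrow> real mat \<Rightarrow> bool" where
  "is_pinv A X \<longleftrightarrow> X \<in> carrier_mat (dim_col A) (dim_row A) \<and>
     A * X * A = A \<and> X * A * X = X \<and>
     transpose_mat (A * X) = A * X \<and> transpose_mat (X * A) = X * A"

definition pinv :: "real mat \<Rightarrow> real mat" where
  "pinv A = (THE X. is_pinv A X)"

definition gen_schur :: "real mat \<Rightarrow> real mat \<Rightarrow> real mat \<Rightarrow> real mat \<Rightarrow> real mat" where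
  "gen_schur A11 A12 A21 A22 = A11 - A12 * pinv A22 * A21"

text \<open>Library matrix inversion is partial; \<open>mat_inv\<close> is only meaningful on invertible matrices.\<close>

definition mat_inv :: "real mat \<Rightarrow> real mat" where
  "mat_inv A = the (mat_inverse A)"

section \<open>Systems, controllers and closed loops\<close>

text \<open>The part of degree less than \<open>L\<close> of a polynomial shift operator with coefficients \<open>A i\<close>,
  applied to \<open>f\<close>; the leading terms \<open>I \<xi>^L\<close> are added explicitly below.\<close>

definition shift_sum :: "nat \<Rightarrow> nat \<Rightarrow> (nat \<Rightarrow> real mat) \<Rightarrow> (nat \<Rightarrow> real vec) \<Rightarrow> nat \<Rightarrow> real vec" where
  "shift_sum n L A f t = finsum_vec TYPE(real) n (\<lambda>i. A i *\<^sub>v f (t + i)) {..<L}"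

definition ar_system :: "nat \<Rightarrow> nat \<Rightarrow> nat \<Rightarrow> (nat \<Rightarrow> real mat) \<Rightarrow> (nat \<Rightarrow> real mat) \<Rightarrow> bool" where
  "ar_system m p L P Q \<longleftrightarrow> (\<forall>i<L. P i \<in> carrier_mat p p \<and> Q i \<in> carrier_mat p m)"

definition ar_controller :: "nat \<Rightarrow> nat \<Rightarrow> nat \<Rightarrow> (nat \<Rightarrow> real mat) \<Rightarrow> (nat \<Rightarrow> real mat) \<Rightarrow> bool" where
  "ar_controller m p L G F \<longleftrightarrow> (\<forall>i<L. G i \<in> carrier_mat m m \<and> F i \<in> carrier_mat m p)"

text \<open>\<open>P(\<sigma>) y = Q(\<sigma>) u + v\<close> and \<open>G(\<sigma>) u = F(\<sigma>) y\<close> at time \<open>t\<close>.\<close>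

definition system_eq ::
  "nat \<Rightarrow> nat \<Rightarrow> (nat \<Rightarrow> real mat) \<Rightarrow> (nat \<Rightarrow> real mat) \<Rightarrow>
   (nat \<Rightarrow> real vec) \<Rightarrow> (nat \<Rightarrow> real vec) \<Rightarrow> (nat \<Rightarrow> real vec) \<Rightarrow> nat \<Rightarrow> bool" where
  "system_eq p L P Q u y v t \<longleftrightarrow>
     y (t + L) + shift_sum p L P y t = shift_sum p L Q u t + v t"

definition controller_eq ::
  "nat \<Rightarrow> nat \<Rightarrow> (nat \<Rightarrow> real mat) \<Rightarrow> (nat \<Rightarrow> real mat) \<Rightarrow>
   (nat \<Rightarrow> real vec) \<Rightarrow> (nat \<Rightarrow> real vec) \<Rightarrow> nat \<Rightarrow> bool" where
  "controller_eq m L G F u y t \<longleftrightarrow>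
     u (t + L) + shift_sum m L G u t = shift_sum m L F y t"

text \<open>The coefficient matrices \<open>[-Q_0 P_0 -Q_1 P_1 ...]\<close> and \<open>[G_0 -F_0 G_1 -F_1 ...]\<close>:
  column \<open>j\<close> belongs to block \<open>j div (p + m)\<close>, whose first \<open>m\<close> columns multiply the input.\<close>

definition sys_coeff :: "nat \<Rightarrow> nat \<Rightarrow> nat \<Rightarrow> (nat \<Rightarrow> real mat) \<Rightarrow> (nat \<Rightarrow> real mat) \<Rightarrow> real mat" where
  "sys_coeff m p L P Q = mat p ((p + m) * L) (\<lambda>(i, j).
     let k = j div (p + m); r = j mod (p + m)
     in if r < m then - (Q k $$ (i, r)) else P k $$ (i, r - m))"

definition ctrl_coeff :: "nat \<Rightarrow> nat \<Rightarrow> nat \<Rightarrow> (nat \<Rightarrow> real mat) \<Rightarrow> (nat \<Rightarrow> real mat) \<Rightarrow> real mat" where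
  "ctrl_coeff m p L G F = mat m ((p + m) * L) (\<lambda>(i, j).
     let k = j div (p + m); r = j mod (p + m)
     in if r < m then G k $$ (i, r) else - (F k $$ (i, r - m)))"

definition closed_loop ::
  "nat \<Rightarrow> nat \<Rightarrow> nat \<Rightarrow> (nat \<Rightarrow> real mat) \<Rightarrow> (nat \<Rightarrow> real mat) \<Rightarrow> (nat \<Rightarrow> real mat) \<Rightarrow> (nat \<Rightarrow> real mat) \<Rightarrow>
   (nat \<Rightarrow> real vec) \<Rightarrow> (nat \<Rightarrow> real vec) \<Rightarrow> (nat \<Rightarrow> real vec) \<Rightarrow> bool" where
  "closed_loop m p L P Q G F u y v \<longleftrightarrow>
     (\<forall>t. u t \<in> carrier_vec m \<and> y t \<in> carrier_vec p \<and> v t \<in> carrier_vec p) \<and>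
     (\<forall>t. controller_eq m L G F u y t \<and> system_eq p L P Q u y v t)"

definition io_traj :: "(nat \<Rightarrow> real vec) \<Rightarrow> (nat \<Rightarrow> real vec) \<Rightarrow> nat \<Rightarrow> real vec" where
  "io_traj u y t = u t @\<^sub>v y t"

definition stabilizes ::
  "nat \<Rightarrow> nat \<Rightarrow> nat \<Rightarrow> (nat \<Rightarrow> real mat) \<Rightarrow> (nat \<Rightarrow> real mat) \<Rightarrow>
   (nat \<Rightarrow> real mat) \<Rightarrow> (nat \<Rightarrow> real mat) \<Rightarrow> bool" where
  "stabilizes m p L G F P Q \<longleftrightarrow>
     (\<forall>u y. closed_loop m p L P Q G F u y (\<lambda>_. 0\<^sub>v p) \<longrightarrow>
        (\<forall>j < p + m. (\<lambda>t. io_traj u y t $ j) \<longlonglongrightarrow> 0))"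

section \<open>Quadratic difference forms\<close>

text \<open>\<open>stacked q L w t\<close> stacks \<open>w t, ..., w (t + L - 1)\<close>, each of dimension \<open>q\<close>.\<close>

definition stacked :: "nat \<Rightarrow> nat \<Rightarrow> (nat \<Rightarrow> real vec) \<Rightarrow> nat \<Rightarrow> real vec" where
  "stacked q L w t = vec (q * L) (\<lambda>j. w (t + j div q) $ (j mod q))"

definition qdf :: "nat \<Rightarrow> nat \<Rightarrow> real mat \<Rightarrow> (nat \<Rightarrow> real vec) \<Rightarrow> nat \<Rightarrow> real" where
  "qdf q L \<Psi> w t = stacked q L w t \<bullet> (\<Psi> *\<^sub>v stacked q L w t)"

definition qdf_nabla :: "nat \<Rightarrow> nat \<Rightarrow> real mat \<Rightarrow> (nat \<Rightarrow> real vec) \<Rightarrow> nat \<Rightarrow> real" where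
  "qdf_nabla q L \<Psi> w t = qdf q L \<Psi> w (t + 1) - qdf q L \<Psi> w t"

definition lyapunov ::
  "nat \<Rightarrow> nat \<Rightarrow> nat \<Rightarrow> (nat \<Rightarrow> real mat) \<Rightarrow> (nat \<Rightarrow> real mat) \<Rightarrow> (nat \<Rightarrow> real mat) \<Rightarrow> (nat \<Rightarrow> real mat) \<Rightarrow>
   real mat \<Rightarrow> bool" where
  "lyapunov m p L P Q G F \<Psi> \<longleftrightarrow> sym_mat ((p + m) * L) \<Psi> \<and>
     (\<forall>u y. closed_loop m p L P Q G F u y (\<lambda>_. 0\<^sub>v p) \<longrightarrow>
        (\<forall>t. 0 \<le> qdf (p + m) L \<Psi> (io_traj u y) t) \<and>
        (\<forall>t. qdf_nabla (p + m) L \<Psi> (io_traj u y) t \<le> 0) \<and>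
        ((\<forall>t. qdf_nabla (p + m) L \<Psi> (io_traj u y) t = 0) \<longrightarrow>
           (\<forall>t. io_traj u y t = 0\<^sub>v (p + m))))"

section \<open>Noise model, data and informativity\<close>

text \<open>\<open>qmi p M Z\<close> is the inequality \<open>[I; Z^T]^T M [I; Z^T] \<ge> 0\<close>.\<close>

definition qmi :: "nat \<Rightarrow> real mat \<Rightarrow> real mat \<Rightarrow> bool" where
  "qmi p M Z \<longleftrightarrow>
     pos_semidef p (transpose_mat (1\<^sub>m p @\<^sub>r transpose_mat Z) * M * (1\<^sub>m p @\<^sub>r transpose_mat Z))"

text \<open>The finite sequence \<open>v 0, ..., v (T - L)\<close> of noise samples, as columns.\<close>

definition noise_mat :: "nat \<Rightarrow> nat \<Rightarrow> nat \<Rightarrow> (nat \<Rightarrow> real vec) \<Rightarrow> real mat" where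
  "noise_mat p L T v = mat_of_cols p (map v [0..<T - L + 1])"

definition generates ::
  "nat \<Rightarrow> nat \<Rightarrow> nat \<Rightarrow> real mat \<Rightarrow> (nat \<Rightarrow> real vec) \<Rightarrow> (nat \<Rightarrow> real vec) \<Rightarrow>
   (nat \<Rightarrow> real mat) \<Rightarrow> (nat \<Rightarrow> real mat) \<Rightarrow> bool" where
  "generates p L T Pm u y P Q \<longleftrightarrow>
     (\<exists>v. (\<forall>t \<le> T - L. v t \<in> carrier_vec p \<and> system_eq p L P Q u y v t) \<and>
          qmi p Pm (noise_mat p L T v))"

definition hankel1 ::
  "nat \<Rightarrow> nat \<Rightarrow> nat \<Rightarrow> nat \<Rightarrow> (nat \<Rightarrow> real vec) \<Rightarrow> (nat \<Rightarrow> real vec) \<Rightarrow> real mat" where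
  "hankel1 m p L T u y = mat ((p + m) * L) (T - L + 1)
     (\<lambda>(i, j). io_traj u y (j + i div (p + m)) $ (i mod (p + m)))"

definition hankel2 :: "nat \<Rightarrow> nat \<Rightarrow> nat \<Rightarrow> (nat \<Rightarrow> real vec) \<Rightarrow> real mat" where
  "hankel2 p L T y = mat_of_cols p (map y [L..<T + 1])"

definition data_mat ::
  "nat \<Rightarrow> nat \<Rightarrow> nat \<Rightarrow> nat \<Rightarrow> real mat \<Rightarrow> (nat \<Rightarrow> real vec) \<Rightarrow> (nat \<Rightarrow> real vec) \<Rightarrow> real mat" where
  "data_mat m p L T Pm u y =
     (let H = four_block_mat (1\<^sub>m p) (hankel2 p L T y)
                (0\<^sub>m ((p + m) * L) p) (hankel1 m p L T u y)
      in H * Pm * transpose_mat H)"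

definition compatible ::
  "nat \<Rightarrow> nat \<Rightarrow> nat \<Rightarrow> nat \<Rightarrow> real mat \<Rightarrow> (nat \<Rightarrow> real vec) \<Rightarrow> (nat \<Rightarrow> real vec) \<Rightarrow> real mat \<Rightarrow> bool" where
  "compatible m p L T Pm u y R \<longleftrightarrow>
     R \<in> carrier_mat p ((p + m) * L) \<and> qmi p (data_mat m p L T Pm u y) R"

definition informative_quad_stab ::
  "nat \<Rightarrow> nat \<Rightarrow> nat \<Rightarrow> nat \<Rightarrow> real mat \<Rightarrow> (nat \<Rightarrow> real vec) \<Rightarrow> (nat \<Rightarrow> real vec) \<Rightarrow> bool" where
  "informative_quad_stab m p L T Pm u y \<longleftrightarrow>
     (let q = p + m; n = q * L in
      \<exists>C \<Psi>. C \<in> carrier_mat m n \<and> pos_semidef n \<Psi> \<and>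
        (\<forall>R. compatible m p L T Pm u y R \<longrightarrow>
           (let S = 1\<^sub>m n @\<^sub>r (- C) @\<^sub>r (- R) in
            neg_def n (transpose_mat S *
              (four_block_mat (0\<^sub>m q q) (0\<^sub>m q n) (0\<^sub>m n q) \<Psi>
                - four_block_mat \<Psi> (0\<^sub>m n q) (0\<^sub>m q n) (0\<^sub>m q q)) * S))))"

section \<open>The linear matrix inequality\<close>

text \<open>\<open>[0 0 -I_p]\<close>, of size \<open>p \<times> q L\<close>.\<close>

definition last_block :: "nat \<Rightarrow> nat \<Rightarrow> nat \<Rightarrow> real mat" where
  "last_block m p L = mat p ((p + m) * L)
     (\<lambda>(i, j). if j = (p + m) * L - p + i then - 1 else 0)"

definition data_mat_bar ::
  "nat \<Rightarrow> nat \<Rightarrow> nat \<Rightarrow> nat \<Rightarrow> real mat \<Rightarrow> (nat \<Rightarrow> real vec) \<Rightarrow> (nat \<Rightarrow> real vec) \<Rightarrow> real mat" where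
  "data_mat_bar m p L T Pm u y =
     (let n = (p + m) * L;
          E = four_block_mat (last_block m p L) (0\<^sub>m p n) (0\<^sub>m n n) (1\<^sub>m n)
      in transpose_mat E * data_mat m p L T Pm u y * E)"

text \<open>\<open>J = [0 I]\<close>; it has no rows if \<open>L = 1\<close>.\<close>

definition J_mat :: "nat \<Rightarrow> nat \<Rightarrow> real mat" where
  "J_mat q L = mat (q * (L - 1)) (q * L) (\<lambda>(i, j). if j = i + q then 1 else 0)"

definition lmi_mat ::
  "nat \<Rightarrow> nat \<Rightarrow> nat \<Rightarrow> nat \<Rightarrow> real mat \<Rightarrow> (nat \<Rightarrow> real vec) \<Rightarrow> (nat \<Rightarrow> real vec) \<Rightarrow>
   real mat \<Rightarrow> real mat \<Rightarrow> real mat" where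
  "lmi_mat m p L T Pm u y D \<Phi> =
     (let n = (p + m) * L;
          K = (J_mat (p + m) L * \<Phi>) @\<^sub>r D @\<^sub>r (0\<^sub>m p n)
      in four_block_mat
           (four_block_mat \<Phi> (- K) (- transpose_mat K) (- \<Phi>))
           (K @\<^sub>r 0\<^sub>m n n)
           (transpose_mat (K @\<^sub>r 0\<^sub>m n n))
           \<Phi>
         - four_block_mat (data_mat_bar m p L T Pm u y) (0\<^sub>m (2 * n) n) (0\<^sub>m n (2 * n)) (0\<^sub>m n n))"

definition lmi_solution ::
  "nat \<Rightarrow> nat \<Rightarrow> nat \<Rightarrow> nat \<Rightarrow> real mat \<Rightarrow> (nat \<Rightarrow> real vec) \<Rightarrow> (nat \<Rightarrow> real vec) \<Rightarrow>
   real mat \<Rightarrow> real mat \<Rightarrow> bool" where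
  "lmi_solution m p L T Pm u y D \<Phi> \<longleftrightarrow>
     D \<in> carrier_mat m ((p + m) * L) \<and> pos_def ((p + m) * L) \<Phi> \<and>
     pos_def (3 * ((p + m) * L)) (lmi_mat m p L T Pm u y D \<Phi>)"

section \<open>Adequacy of the encoding\<close>

text \<open>Every matrix of the right size is the coefficient matrix of a controller, respectively of a
  system, and the quadratic characterization of \<open>compatible\<close> agrees with the existence of
  admissible noise samples that explain the data.\<close>

lemma sum_blocks:
  fixes f :: "nat \<Rightarrow> nat \<Rightarrow> real"
  assumes "0 < q"
  shows "(\<Sum>j<q * L. f (j div q) (j mod q)) = (\<Sum>k<L. \<Sum>r<q. f k r)"
proof -
  have "(\<Sum>j<q * L. f (j div q) (j mod q)) = (\<Sum>k<L. \<Sum>j = k * q..<k * q + q. f (j div q) (j mod q))"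
    using sum.nat_group[of "\<lambda>j. f (j div q) (j mod q)" q L] by (simp add: mult.commute)
  also have "\<dots> = (\<Sum>k<L. \<Sum>r<q. f k r)"
  proof (rule sum.cong[OF refl])
    fix k
    have "(\<Sum>j = k * q..<k * q + q. f (j div q) (j mod q)) = (\<Sum>r = 0..<q. f ((r + k * q) div q) ((r + k * q) mod q))"
      using sum.shift_bounds_nat_ivl[of "\<lambda>j. f (j div q) (j mod q)" 0 "k * q" q] by (simp add: add.commute)
    also have "\<dots> = (\<Sum>r<q. f k r)"
      by (rule sum.cong) auto
    finally show "(\<Sum>j = k * q..<k * q + q. f (j div q) (j mod q)) = (\<Sum>r<q. f k r)" .
  qed
  finally show ?thesis .
qed

lemma ex_ctrl_coeff:
  assumes C: "C \<in> carrier_mat m ((p + m) * L)"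
  shows "\<exists>G F. ar_controller m p L G F \<and> ctrl_coeff m p L G F = C"
proof (intro exI conjI)
  let ?q = "p + m"
  let ?G = "\<lambda>k. mat m m (\<lambda>(i, r). C $$ (i, k * ?q + r))"
  let ?F = "\<lambda>k. mat m p (\<lambda>(i, r). - C $$ (i, k * ?q + m + r))"
  show "ar_controller m p L ?G ?F" by (simp add: ar_controller_def)
  show "ctrl_coeff m p L ?G ?F = C"
  proof (rule eq_matI)
    fix i j assume "i < dim_row C" "j < dim_col C"
    with C have i: "i < m" and j: "j < ?q * L" by auto
    have "j mod ?q < ?q" using i by (intro mod_less_divisor) simp
    hence "j mod ?q - m < p \<and> j div ?q * ?q + m + (j mod ?q - m) = j" if "\<not> j mod ?q < m"
      using that div_mult_mod_eq[of j ?q] by linarith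
    thus "ctrl_coeff m p L ?G ?F $$ (i, j) = C $$ (i, j)"
      using i j div_mult_mod_eq[of j ?q] by (auto simp: ctrl_coeff_def Let_def)
  qed (use C in \<open>auto simp: ctrl_coeff_def\<close>)
qed

lemma ex_sys_coeff:
  assumes R: "R \<in> carrier_mat p ((p + m) * L)"
  shows "\<exists>P Q. ar_system m p L P Q \<and> sys_coeff m p L P Q = R"
proof (intro exI conjI)
  let ?q = "p + m"
  let ?Q = "\<lambda>k. mat p m (\<lambda>(i, r). - R $$ (i, k * ?q + r))"
  let ?P = "\<lambda>k. mat p p (\<lambda>(i, r). R $$ (i, k * ?q + m + r))"
  show "ar_system m p L ?P ?Q" by (simp add: ar_system_def)
  show "sys_coeff m p L ?P ?Q = R"
  proof (rule eq_matI)
    fix i j assume "i < dim_row R" "j < dim_col R"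
    with R have i: "i < p" and j: "j < ?q * L" by auto
    have "j mod ?q < ?q" using i by (intro mod_less_divisor) simp
    hence "j mod ?q - m < p \<and> j div ?q * ?q + m + (j mod ?q - m) = j" if "\<not> j mod ?q < m"
      using that div_mult_mod_eq[of j ?q] by linarith
    thus "sys_coeff m p L ?P ?Q $$ (i, j) = R $$ (i, j)"
      using i j div_mult_mod_eq[of j ?q] by (auto simp: sys_coeff_def Let_def)
  qed (use R in \<open>auto simp: sys_coeff_def\<close>)
qed

lemma qmi_data_mat:
  assumes R: "R \<in> carrier_mat p ((p + m) * L)"
    and Pm: "Pm \<in> carrier_mat (p + (T - L + 1)) (p + (T - L + 1))" and LT: "L \<le> T"
  shows "qmi p (data_mat m p L T Pm u y) R \<longleftrightarrow>
         qmi p Pm (hankel2 p L T y + R * hankel1 m p L T u y)"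
proof -
  define N where "N = T - L + 1"
  define n where "n = (p + m) * L"
  define H1 where "H1 = hankel1 m p L T u y"
  define H2 where "H2 = hankel2 p L T y"
  define H where "H = four_block_mat (1\<^sub>m p) H2 (0\<^sub>m n p) H1"
  define S where "S = 1\<^sub>m p @\<^sub>r transpose_mat R"
  have H1: "H1 \<in> carrier_mat n N" unfolding H1_def hankel1_def n_def N_def by (rule mat_carrier)
  have "length (map y [L..<T + 1]) = N" using LT by (simp add: N_def)
  hence H2: "H2 \<in> carrier_mat p N"
    unfolding H2_def hankel2_def by (metis mat_of_cols_carrier(1))
  have R': "R \<in> carrier_mat p n" using R by (simp add: n_def)
  have H: "H \<in> carrier_mat (p + n) (p + N)" unfolding H_def using four_block_carrier_mat[OF one_carrier_mat H1] .
  have S: "S \<in> carrier_mat (p + n) p" unfolding S_def using R' by (intro carrier_append_rows) simp_all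
  have Pm': "Pm \<in> carrier_mat (p + N) (p + N)" using Pm by (simp add: N_def)
  have HT: "transpose_mat H = four_block_mat (1\<^sub>m p) (0\<^sub>m p n) (transpose_mat H2) (transpose_mat H1)"
    unfolding H_def using H1 H2 by (subst transpose_four_block_mat[of _ p p _ N _ n]) auto
  have "transpose_mat H * S = 1\<^sub>m p @\<^sub>r transpose_mat (H2 + R * H1)"
    unfolding HT S_def append_rows_def
    using H1 H2 R'
    by (subst mult_four_block_mat[of _ p p _ n _ N _ _ p _ 0])
       (auto simp: transpose_add transpose_mult)
  hence eq: "transpose_mat H * S = 1\<^sub>m p @\<^sub>r transpose_mat (H2 + R * H1)" .
  have ST: "transpose_mat (transpose_mat H * S) = transpose_mat S * H"
    using H S by (subst transpose_mult) auto
  have "transpose_mat S * (H * Pm * transpose_mat H) * S =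
        transpose_mat (transpose_mat H * S) * Pm * (transpose_mat H * S)"
  proof -
    have H': "transpose_mat H \<in> carrier_mat (p + N) (p + n)" using H by simp
    have S': "transpose_mat S \<in> carrier_mat p (p + n)" using S by simp
    have HP: "H * Pm \<in> carrier_mat (p + n) (p + N)" using H Pm' by simp
    have "transpose_mat S * (H * Pm * transpose_mat H) * S
        = transpose_mat S * (H * Pm * transpose_mat H * S)"
      using S' HP H' S by (intro assoc_mult_mat) auto
    also have "H * Pm * transpose_mat H * S = H * Pm * (transpose_mat H * S)"
      using HP H' S by (rule assoc_mult_mat)
    also have "transpose_mat S * (H * Pm * (transpose_mat H * S))
        = transpose_mat S * (H * Pm) * (transpose_mat H * S)"
      using S' HP H' S by (intro assoc_mult_mat[symmetric]) auto
    also have "transpose_mat S * (H * Pm) = transpose_mat S * H * Pm"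
      using S' H Pm' by (rule assoc_mult_mat[symmetric])
    finally show ?thesis by (simp only: ST)
  qed
  thus ?thesis
    unfolding qmi_def data_mat_def Let_def H1_def[symmetric] H2_def[symmetric]
      n_def[symmetric] H_def[symmetric] S_def[symmetric] eq by simp
qed

lemma residual:
  assumes PQ: "ar_system m p L P Q" and p: "0 < p" and LT: "L \<le> T"
    and uy: "\<forall>t \<le> T. u t \<in> carrier_vec m \<and> y t \<in> carrier_vec p"
    and t: "t \<le> T - L" and i: "i < p"
  shows "(hankel2 p L T y + sys_coeff m p L P Q * hankel1 m p L T u y) $$ (i, t) =
    (y (t + L) + shift_sum p L P y t - shift_sum p L Q u t) $ i"
proof -
  let ?q = "p + m"
  have c: "u (t + k) \<in> carrier_vec m" "y (t + k) \<in> carrier_vec p"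
    "P k \<in> carrier_mat p p" "Q k \<in> carrier_mat p m" if "k < L" for k
    using uy that LT t PQ by (auto simp: ar_system_def)
  have fs: "shift_sum p L P y t \<in> carrier_vec p" "shift_sum p L Q u t \<in> carrier_vec p"
    unfolding shift_sum_def using c by (auto intro!: finsum_vec_closed mult_mat_vec_carrier)
  have e: "shift_sum p L P y t $ i = (\<Sum>k<L. \<Sum>r<p. P k $$ (i, r) * y (t + k) $ r)"
    "shift_sum p L Q u t $ i = (\<Sum>k<L. \<Sum>r<m. Q k $$ (i, r) * u (t + k) $ r)"
    unfolding shift_sum_def using c i
    by (subst index_finsum_vec; fastforce simp: scalar_prod_def lessThan_atLeast0 intro!: sum.cong)+
  have "(sys_coeff m p L P Q * hankel1 m p L T u y) $$ (i, t) =
     (\<Sum>j<?q * L. (\<lambda>k r. (if r < m then - (Q k $$ (i, r)) else P k $$ (i, r - m)) * io_traj u y (t + k) $ r)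
         (j div ?q) (j mod ?q))"
    using i t by (simp add: sys_coeff_def hankel1_def scalar_prod_def Let_def lessThan_atLeast0)
  also have "\<dots> = (\<Sum>k<L. \<Sum>r<?q. (if r < m then - (Q k $$ (i, r)) else P k $$ (i, r - m)) * io_traj u y (t + k) $ r)"
    using p by (subst sum_blocks) auto
  also have "\<dots> = (\<Sum>k<L. (\<Sum>r<p. P k $$ (i, r) * y (t + k) $ r) - (\<Sum>r<m. Q k $$ (i, r) * u (t + k) $ r))"
  proof (rule sum.cong[OF refl])
    fix k assume "k \<in> {..<L}" hence k: "k < L" by simp
    let ?f = "\<lambda>r. (if r < m then - (Q k $$ (i, r)) else P k $$ (i, r - m)) * io_traj u y (t + k) $ r"
    have "(\<Sum>r<?q. ?f r) = (\<Sum>r<m. ?f r) + (\<Sum>r = m..<m + p. ?f r)"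
      using sum.atLeastLessThan_concat[of 0 m "m + p" ?f] by (simp only: lessThan_atLeast0 add.commute[of p m])
    also have "(\<Sum>r = m..<m + p. ?f r) = (\<Sum>r<p. ?f (r + m))"
      using sum.shift_bounds_nat_ivl[of ?f 0 m p] by (simp add: lessThan_atLeast0 add.commute)
    also have "\<dots> = (\<Sum>r<p. P k $$ (i, r) * y (t + k) $ r)"
      using c[OF k] by (intro sum.cong) (auto simp: io_traj_def)
    also have "(\<Sum>r<m. ?f r) = - (\<Sum>r<m. Q k $$ (i, r) * u (t + k) $ r)"
      unfolding sum_negf[symmetric]
      using c[OF k] by (intro sum.cong) (auto simp: io_traj_def)
    finally show "(\<Sum>r<?q. ?f r) = (\<Sum>r<p. P k $$ (i, r) * y (t + k) $ r) - (\<Sum>r<m. Q k $$ (i, r) * u (t + k) $ r)"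
      by simp
  qed
  finally have "(sys_coeff m p L P Q * hankel1 m p L T u y) $$ (i, t) =
     shift_sum p L P y t $ i - shift_sum p L Q u t $ i" by (simp add: e sum_subtractf)
  moreover have "hankel2 p L T y $$ (i, t) = y (t + L) $ i"
    using i t LT by (simp add: hankel2_def mat_of_cols_def add.commute del: upt_Suc)
  ultimately show ?thesis using i t fs uy LT
    by (simp add: hankel1_def sys_coeff_def)
qed

lemma compatible_iff_generates:
  assumes PQ: "ar_system m p L P Q" and p: "0 < p" and LT: "L \<le> T"
    and Pm: "Pm \<in> carrier_mat (p + (T - L + 1)) (p + (T - L + 1))"
    and uy: "\<forall>t \<le> T. u t \<in> carrier_vec m \<and> y t \<in> carrier_vec p"
  shows "compatible m p L T Pm u y (sys_coeff m p L P Q) \<longleftrightarrow> generates p L T Pm u y P Q"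
proof -
  let ?V = "hankel2 p L T y + sys_coeff m p L P Q * hankel1 m p L T u y"
  have car: "shift_sum p L P y t \<in> carrier_vec p" "shift_sum p L Q u t \<in> carrier_vec p"
    "y (t + L) \<in> carrier_vec p" if "t \<le> T - L" for t
    unfolding shift_sum_def using uy that LT PQ
    by (auto intro!: finsum_vec_closed mult_mat_vec_carrier simp: ar_system_def)
  have V: "noise_mat p L T v = ?V"
    if v: "\<forall>t \<le> T - L. v t \<in> carrier_vec p \<and> system_eq p L P Q u y v t" for v
  proof (rule eq_matI)
    fix i t assume "i < dim_row ?V" "t < dim_col ?V"
    hence i: "i < p" and t: "t \<le> T - L" by (auto simp: sys_coeff_def hankel1_def)
    have "y (t + L) + shift_sum p L P y t - shift_sum p L Q u t = v t"
      using v t car[OF t] unfolding system_eq_def by (auto intro!: eq_vecI)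
    thus "noise_mat p L T v $$ (i, t) = ?V $$ (i, t)"
      using residual[OF PQ p LT uy t i] i t
      by (simp add: noise_mat_def mat_of_cols_def nth_append less_Suc_eq_le)
  qed (auto simp: noise_mat_def sys_coeff_def hankel1_def)
  define v where "v t = y (t + L) + shift_sum p L P y t - shift_sum p L Q u t" for t
  have v: "\<forall>t \<le> T - L. v t \<in> carrier_vec p \<and> system_eq p L P Q u y v t"
  proof (intro allI impI)
    fix t assume "t \<le> T - L"
    note c = car[OF this]
    show "v t \<in> carrier_vec p \<and> system_eq p L P Q u y v t"
      unfolding system_eq_def v_def using c[THEN carrier_vecD] c by (auto intro!: eq_vecI)
  qed
  have R: "sys_coeff m p L P Q \<in> carrier_mat p ((p + m) * L)" by (simp add: sys_coeff_def)
  show ?thesis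
    unfolding compatible_def generates_def qmi_data_mat[OF R Pm LT] using R V V[OF v] v by metis
qed

end

theory Submission
  imports Defs "HOL-Analysis.Function_Topology" "HOL-Library.Quadratic_Discriminant"
begin

text \<open>
  Write \<open>n = (p + m) L\<close>. With \<open>\<eta>(t)\<close> the stack of \<open>w(t), \<dots>, w(t + L - 1)\<close>, a noise-free closed loop is the
  first order recursion \<open>\<eta>(t + 1) = A\<^sub>R \<eta>(t)\<close>, where \<open>A\<^sub>R\<close> has the block rows \<open>J\<close>, \<open>- C\<close>, \<open>- R\<close>
  (\<open>closed_loop_step\<close>). Informativity says exactly that one \<open>C\<close> and one \<open>\<Psi> \<ge> 0\<close> satisfy the Stein
  inequality \<open>A\<^sub>R\<^sup>T \<Psi> A\<^sub>R < \<Psi>\<close> for all compatible \<open>R\<close> (\<open>quad_stab_iff\<close>); since some \<open>R\<close> is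
  compatible, \<open>\<Psi>\<close> is then positive definite.

  The unknown \<open>R\<close> sits in the rows of \<open>A\<^sub>R\<close>, whereas compatibility is a condition on the
  pairs \<open>(a, R\<^sup>T a)\<close>. Hence one passes to \<open>\<Phi> = \<Psi>\<^sup>-\<^sup>1\<close> and the
  equivalent dual inequality \<open>A\<^sub>R \<Phi> A\<^sub>R\<^sup>T < \<Phi>\<close> (\<open>dual_contraction\<close>, by the
  Cauchy-Schwarz inequality). Put \<open>D = - C \<Phi>\<close>, let \<open>K\<close> have the block rows \<open>J \<Phi>\<close>, \<open>D\<close>, \<open>0\<close> and let
  \<open>e = [0 0 -I]\<close>; then \<open>A\<^sub>R\<^sup>T x = \<Phi>\<^sup>-\<^sup>1 K\<^sup>T x + R\<^sup>T e x\<close> (\<open>closed_loop_mat_transpose\<close>). So the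
  dual inequality demands \<open>M(x, z) > 0\<close> at all \<open>z = R\<^sup>T e x\<close>, \<open>x \<noteq> 0\<close>, for the form
  \<open>M(x, z) = \<Phi>(x) - \<Phi>(\<Phi>\<^sup>-\<^sup>1 K\<^sup>T x + z)\<close>, where \<open>\<Phi>(x) = x\<^sup>T \<Phi> x\<close>. By completing a square, the matrix
  in the linear matrix inequality has the form
  \<open>M(x, z) + \<Phi>(\<Phi>\<^sup>-\<^sup>1 K\<^sup>T x + w) - N(e x, z)\<close> (\<open>lmi_lead_qf_squares\<close>): its third block row only
  linearizes the dependence on \<open>\<Phi>\<close> and \<open>D\<close>.

  If the inequality holds, then \<open>w = - \<Phi>\<^sup>-\<^sup>1 K\<^sup>T x\<close> and \<open>N(e x, R\<^sup>T e x) \<ge> 0\<close> give the dual Stein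
  inequality for every compatible \<open>R\<close> (\<open>lmi_contraction\<close>); the contraction yields the Lyapunov
  function, and by compactness a geometric rate (\<open>contraction_stabilizes_lyapunov\<close>).

  Conversely, let the Stein inequality hold for all compatible \<open>R\<close>. The full row rank of the Hankel
  matrix makes \<open>N\<close> negative definite on the vectors \<open>(0, z)\<close> (\<open>data_mat_neg\<close>), which implies, as
  some \<open>R\<close> is compatible, that every pair \<open>(a, z)\<close> with \<open>a \<noteq> 0\<close> and \<open>N(a, z) \<ge> 0\<close> is
  interpolated by a compatible \<open>R\<close>, i.e.
  \<open>R\<^sup>T a = z\<close> (\<open>qmi_interpolation\<close>). Therefore \<open>N(e x, z) \<ge> 0\<close> forces \<open>M(x, z) > 0\<close>, and a strict
  S-lemma (\<open>strict_S_lemma\<close>) produces \<open>\<alpha> \<ge> 0\<close> with \<open>M - \<alpha> N > 0\<close>. As \<open>M\<close> is negative at \<open>(0, z)\<close>, \<open>z \<noteq> 0\<close>,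
  \<open>\<alpha>\<close> is positive, and \<open>\<Phi> / \<alpha>\<close>, \<open>D / \<alpha>\<close> solve the linear matrix inequality
  (\<open>quad_stab_imp_lmi\<close>).
\<close>

section \<open>Quadratic forms of real matrices\<close>

abbreviation qf :: "real mat \<Rightarrow> real vec \<Rightarrow> real" where
  "qf A x \<equiv> x \<bullet> (A *\<^sub>v x)"

lemma scalar_self_pos:
  fixes v :: "real vec"
  assumes "v \<in> carrier_vec d" "v \<noteq> 0\<^sub>v d"
  shows "0 < v \<bullet> v"
proof -
  have "0 \<le> v \<bullet> v" by (simp add: scalar_prod_def sum_nonneg)
  moreover have "v \<bullet> v \<noteq> 0"
  proof
    assume "v \<bullet> v = 0"
    hence "\<forall>i\<in>{0..<dim_vec v}. v $ i * v $ i = 0"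
      unfolding scalar_prod_def by (subst (asm) sum_nonneg_eq_0_iff) auto
    thus False using assms by (auto intro!: eq_vecI)
  qed
  ultimately show ?thesis by simp
qed

lemma norm_one_nonzero:
  fixes v :: "real vec"
  assumes "v \<bullet> v = 1" shows "v \<noteq> 0\<^sub>v d"
  using assms by auto

lemma zero_mat_mult_vec [simp]:
  fixes x :: "real vec"
  assumes "x \<in> carrier_vec c"
  shows "0\<^sub>m r c *\<^sub>v x = 0\<^sub>v r"
  using assms by (intro eq_vecI) auto

lemma smult_mat_mult_vec:
  fixes A :: "real mat"
  assumes "A \<in> carrier_mat r c" "x \<in> carrier_vec c"
  shows "(k \<cdot>\<^sub>m A) *\<^sub>v x = k \<cdot>\<^sub>v (A *\<^sub>v x)"
  using assms by (intro eq_vecI) auto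

lemma vec_eq_by_scalar_prod:
  fixes a b :: "real vec"
  assumes a: "a \<in> carrier_vec n" and b: "b \<in> carrier_vec n"
    and eq: "\<And>y. y \<in> carrier_vec n \<Longrightarrow> y \<bullet> a = y \<bullet> b"
  shows "a = b"
proof (rule eq_vecI)
  fix i assume "i < dim_vec b"
  hence i: "i < n" using b by simp
  have "unit_vec n i \<bullet> a = unit_vec n i \<bullet> b" by (rule eq) simp
  thus "a $ i = b $ i" using scalar_prod_left_unit[OF a i] scalar_prod_left_unit[OF b i] by simp
qed (use a b in simp)

lemma bilinear_form_sum:
  fixes A :: "real mat"
  assumes "A \<in> carrier_mat r c" "x \<in> carrier_vec r" "y \<in> carrier_vec c"
  shows "x \<bullet> (A *\<^sub>v y) = (\<Sum>i<r. \<Sum>j<c. x $ i * A $$ (i, j) * y $ j)"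
  using assms
  by (simp add: scalar_prod_def lessThan_atLeast0 sum_distrib_left mult.assoc)

lemma scalar_prod_mult_transpose:
  fixes A :: "real mat"
  assumes "A \<in> carrier_mat r c" "x \<in> carrier_vec r" "y \<in> carrier_vec c"
  shows "x \<bullet> (A *\<^sub>v y) = y \<bullet> (transpose_mat A *\<^sub>v x)"
  using transpose_vec_mult_scalar[OF assms(1,3,2)] comm_scalar_prod[of "transpose_mat A *\<^sub>v x" c y] assms
  by simp

lemma sym_mat_swap:
  assumes "sym_mat n A" "x \<in> carrier_vec n" "y \<in> carrier_vec n"
  shows "x \<bullet> (A *\<^sub>v y) = y \<bullet> (A *\<^sub>v x)"
  using scalar_prod_mult_transpose[of A n n x y] assms by (simp add: sym_mat_def)

lemma qf_smult:
  assumes "A \<in> carrier_mat d d" "v \<in> carrier_vec d"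
  shows "qf A (c \<cdot>\<^sub>v v) = c\<^sup>2 * qf A v"
  using assms by (simp add: mult_mat_vec power2_eq_square)

lemma qf_uminus:
  assumes "A \<in> carrier_mat n n" "x \<in> carrier_vec n"
  shows "qf (- A) x = - qf A x"
  using assms by simp

lemma qf_minus_smult:
  assumes "A \<in> carrier_mat d d" "B \<in> carrier_mat d d" "v \<in> carrier_vec d"
  shows "qf (A - a \<cdot>\<^sub>m B) v = qf A v - a * qf B v"
proof -
  have "(a \<cdot>\<^sub>m B) *\<^sub>v v = a \<cdot>\<^sub>v (B *\<^sub>v v)" using assms by (intro eq_vecI) auto
  thus ?thesis using assms
    by (simp add: minus_mult_distrib_mat_vec[of _ d d] scalar_prod_minus_distrib[of _ d])
qed

lemma qf_minus:
  assumes "A \<in> carrier_mat n n" "B \<in> carrier_mat n n" "x \<in> carrier_vec n"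
  shows "qf (A - B) x = qf A x - qf B x"
  using qf_minus_smult[OF assms, of 1] assms by (simp add: minus_mult_distrib_mat_vec[of _ n n] scalar_prod_minus_distrib[of _ n])

lemma qf_add:
  assumes A: "A \<in> carrier_mat d d" and v: "v \<in> carrier_vec d" "w \<in> carrier_vec d"
  shows "qf A (v + s \<cdot>\<^sub>v w) = qf A v + s * (v \<bullet> (A *\<^sub>v w) + w \<bullet> (A *\<^sub>v v)) + s\<^sup>2 * qf A w"
proof -
  have c: "A *\<^sub>v v \<in> carrier_vec d" "A *\<^sub>v w \<in> carrier_vec d" "s \<cdot>\<^sub>v w \<in> carrier_vec d"
    "s \<cdot>\<^sub>v (A *\<^sub>v w) \<in> carrier_vec d"
    using assms by auto
  have "A *\<^sub>v (v + s \<cdot>\<^sub>v w) = A *\<^sub>v v + s \<cdot>\<^sub>v (A *\<^sub>v w)"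
    using assms c by (simp add: mult_add_distrib_mat_vec[OF A] mult_mat_vec[OF A])
  thus ?thesis using v c
    by (simp add: add_scalar_prod_distrib[of _ d] scalar_prod_add_distrib[of _ d]
        power2_eq_square algebra_simps)
qed

lemma qf_add_sym:
  assumes A: "sym_mat n A" and x: "x \<in> carrier_vec n" and y: "y \<in> carrier_vec n"
  shows "qf A (x + y) = qf A x + 2 * (x \<bullet> (A *\<^sub>v y)) + qf A y"
  using qf_add[of A n x y 1] sym_mat_swap[OF assms] assms by (simp add: sym_mat_def)

lemma qf_diff_sym:
  assumes A: "sym_mat n A" and x: "x \<in> carrier_vec n" and y: "y \<in> carrier_vec n"
  shows "qf A (x - y) = qf A x - 2 * (x \<bullet> (A *\<^sub>v y)) + qf A y"
proof -
  have "x - y = x + (-1) \<cdot>\<^sub>v y" using x y by (intro eq_vecI) auto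
  thus ?thesis
    using qf_add[of A n x y "-1"] sym_mat_swap[OF assms] assms by (simp add: sym_mat_def)
qed

lemma qf_congruence:
  fixes M S :: "real mat"
  assumes M: "M \<in> carrier_mat k k" and S: "S \<in> carrier_mat k n" and x: "x \<in> carrier_vec n"
  shows "qf (transpose_mat S * M * S) x = qf M (S *\<^sub>v x)"
proof -
  have "(transpose_mat S * M * S) *\<^sub>v x = transpose_mat S *\<^sub>v (M *\<^sub>v (S *\<^sub>v x))"
    using assms by (simp add: assoc_mult_mat_vec[of _ n k _ n] assoc_mult_mat_vec[of _ n k _ k])
  moreover have "x \<bullet> (transpose_mat S *\<^sub>v (M *\<^sub>v (S *\<^sub>v x))) = (M *\<^sub>v (S *\<^sub>v x)) \<bullet> (S *\<^sub>v x)"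
    using assms scalar_prod_mult_transpose[of "transpose_mat S" n k x "M *\<^sub>v (S *\<^sub>v x)"] by simp
  ultimately show ?thesis using assms by (simp add: comm_scalar_prod[of _ k])
qed

lemma qf_four_block:
  assumes A: "A \<in> carrier_mat p p" and B: "B \<in> carrier_mat n p" and D: "D \<in> carrier_mat n n"
    and a: "a \<in> carrier_vec p" and z: "z \<in> carrier_vec n"
  shows "qf (four_block_mat A (transpose_mat B) B D) (a @\<^sub>v z) = qf A a + 2 * (z \<bullet> (B *\<^sub>v a)) + qf D z"
proof -
  have Bt: "transpose_mat B \<in> carrier_mat p n" using B by simp
  have c: "A *\<^sub>v a \<in> carrier_vec p" "transpose_mat B *\<^sub>v z \<in> carrier_vec p"
    "B *\<^sub>v a \<in> carrier_vec n" "D *\<^sub>v z \<in> carrier_vec n"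
    using A B D a z Bt by auto
  have e: "a \<bullet> (transpose_mat B *\<^sub>v z) = z \<bullet> (B *\<^sub>v a)"
    using scalar_prod_mult_transpose[OF B z a] by simp
  show ?thesis
    unfolding four_block_mat_mult_vec[OF A Bt B D a z]
    using c by (simp add: scalar_prod_append[OF a z, of "A *\<^sub>v a + transpose_mat B *\<^sub>v z" "B *\<^sub>v a + D *\<^sub>v z"]
      scalar_prod_add_distrib[OF a c(1,2)] scalar_prod_add_distrib[OF z c(3,4)] e)
qed

lemma sym_uminus: "sym_mat n A \<Longrightarrow> sym_mat n (- A)"
  by (auto simp: sym_mat_def transpose_uminus)

lemma sym_minus:
  assumes "sym_mat n A" "sym_mat n B" shows "sym_mat n (A - B)"
  using assms transpose_minus[of A n n B] by (auto simp: sym_mat_def)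

lemma sym_congruence:
  fixes M S :: "real mat"
  assumes M: "sym_mat k M" and S: "S \<in> carrier_mat k n"
  shows "sym_mat n (transpose_mat S * M * S)"
proof -
  have c: "M \<in> carrier_mat k k" "transpose_mat S \<in> carrier_mat n k" using assms by (auto simp: sym_mat_def)
  have "transpose_mat (transpose_mat S * M * S) = transpose_mat S * (transpose_mat M * transpose_mat (transpose_mat S))"
    using c S transpose_mult[of "transpose_mat S * M" n k S n] transpose_mult[OF c(2,1)] by simp
  also have "\<dots> = transpose_mat S * M * S" using assms c by (simp add: sym_mat_def)
  finally show ?thesis using c S by (simp add: sym_mat_def)
qed

lemma sym_four_block:
  assumes "sym_mat p A" "B \<in> carrier_mat n p" "sym_mat n D"
  shows "sym_mat (p + n) (four_block_mat A (transpose_mat B) B D)"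
  using assms transpose_four_block_mat[of A p p "transpose_mat B" n B n D]
  by (auto simp: sym_mat_def)

lemma sym_mat_blocks:
  assumes "sym_mat (p + n) N"
  obtains A B D where "sym_mat p A" "B \<in> carrier_mat n p" "sym_mat n D"
    "N = four_block_mat A (transpose_mat B) B D"
proof
  have N: "N \<in> carrier_mat (p + n) (p + n)" and swap: "N $$ (j, i) = N $$ (i, j)" if "i < p + n" "j < p + n" for i j
    using assms that index_transpose_mat(1)[of i N j] by (auto simp: sym_mat_def)
  have N: "N \<in> carrier_mat (p + n) (p + n)" using assms by (simp add: sym_mat_def)
  let ?A = "mat p p (\<lambda>(i, j). N $$ (i, j))"
  let ?B = "mat n p (\<lambda>(i, j). N $$ (p + i, j))"
  let ?D = "mat n n (\<lambda>(i, j). N $$ (p + i, p + j))"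
  show "sym_mat p ?A" "sym_mat n ?D" "?B \<in> carrier_mat n p"
    by (auto simp: sym_mat_def swap intro!: eq_matI)
  show "N = four_block_mat ?A (transpose_mat ?B) ?B ?D"
    using N by (intro eq_matI) (auto simp: swap)
qed

section \<open>Compactness of the unit sphere and a strict S-lemma\<close>

lemma normalize_vec:
  fixes v :: "real vec"
  assumes "v \<in> carrier_vec d" "v \<noteq> 0\<^sub>v d"
  obtains c w where "0 < c" "w \<in> carrier_vec d" "w \<bullet> w = 1" "v = c \<cdot>\<^sub>v w"
proof
  let ?c = "sqrt (v \<bullet> v)"
  have p: "0 < v \<bullet> v" by (rule scalar_self_pos[OF assms])
  thus "0 < ?c" by simp
  show "(1 / ?c) \<cdot>\<^sub>v v \<in> carrier_vec d" using assms by simp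
  show "((1 / ?c) \<cdot>\<^sub>v v) \<bullet> ((1 / ?c) \<cdot>\<^sub>v v) = 1"
    using assms p by (simp add: field_simps)
  show "v = ?c \<cdot>\<^sub>v ((1 / ?c) \<cdot>\<^sub>v v)" using p by (auto simp: smult_smult_assoc)
qed

lemma continuous_qf:
  assumes "A \<in> carrier_mat d d"
  shows "continuous_on UNIV (\<lambda>f. qf A (vec d f))"
proof -
  have c: "continuous_on UNIV (\<lambda>f. f i :: real)" for i :: nat
    by simp
  have "qf A (vec d f) = (\<Sum>i<d. \<Sum>j<d. f i * A $$ (i, j) * f j)" for f
    using bilinear_form_sum[OF assms, of "vec d f" "vec d f"] by simp
  thus ?thesis by (simp only:) (intro continuous_intros c)
qed

text \<open>
  Vectors of dimension \<open>d\<close> carry no topology, so the sphere is pulled back along \<open>vec d\<close> to a closed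
  subset of a product of intervals in \<open>nat \<Rightarrow> real\<close>, with all coordinates from \<open>d\<close> on fixed at 0; this
  product is compact by Tychonoff.
\<close>

lemma sphere_attains_max:
  fixes h :: "real vec \<Rightarrow> real"
  assumes cl: "closed {f. P (vec d f)}"
    and co: "continuous_on {f. P (vec d f)} (\<lambda>f. h (vec d f))"
    and ne: "v1 \<in> carrier_vec d" "v1 \<bullet> v1 = 1" "P v1"
  obtains v0 where "v0 \<in> carrier_vec d" "v0 \<bullet> v0 = 1" "P v0"
    "\<And>v. v \<in> carrier_vec d \<Longrightarrow> v \<bullet> v = 1 \<Longrightarrow> P v \<Longrightarrow> h v \<le> h v0"
proof -
  define K where "K = PiE UNIV (\<lambda>i::nat. if i < d then {-1..1::real} else {0})"
  define S where "S = K \<inter> {f. vec d f \<bullet> vec d f = 1} \<inter> {f. P (vec d f)}"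
  have "compactin (product_topology (\<lambda>i. euclidean) UNIV) K"
    unfolding K_def by (subst compactin_PiE) auto
  hence K: "compact K" by (simp add: euclidean_product_topology)
  have "continuous_on UNIV (\<lambda>f. qf (1\<^sub>m d) (vec d f))" by (rule continuous_qf) simp
  hence "continuous_on UNIV (\<lambda>f. vec d f \<bullet> vec d f :: real)" by simp
  hence "closed {f. vec d f \<bullet> vec d f = (1::real)}"
    by (intro closed_Collect_eq continuous_on_const)
  hence S: "compact S" unfolding S_def using K cl by (intro compact_Int_closed)
  have in_S: "\<exists>f\<in>S. vec d f = v" if v: "v \<in> carrier_vec d" "v \<bullet> v = 1" "P v" for v
  proof
    let ?f = "\<lambda>i. if i < d then v $ i else 0"
    show e: "vec d ?f = v" using v by (auto intro!: eq_vecI)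
    have "\<bar>v $ i\<bar> \<le> 1" if "i < d" for i
    proof -
      have "v $ i * v $ i \<le> (\<Sum>j<d. v $ j * v $ j)"
        using that by (intro member_le_sum) auto
      also have "\<dots> = v \<bullet> v" using v by (simp add: scalar_prod_def lessThan_atLeast0)
      finally show ?thesis using v by (metis abs_square_le_1 power2_eq_square)
    qed
    hence "?f \<in> K" unfolding K_def by (fastforce simp: abs_le_iff)
    thus "?f \<in> S" unfolding S_def using e v by simp
  qed
  have "S \<noteq> {}" using in_S[OF ne] by auto
  moreover have "continuous_on S (\<lambda>f. h (vec d f))"
    using co by (rule continuous_on_subset) (auto simp: S_def)
  ultimately obtain f where f: "f \<in> S" "\<And>g. g \<in> S \<Longrightarrow> h (vec d g) \<le> h (vec d f)"
    using continuous_attains_sup[OF S] by blast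
  show thesis
  proof (rule that[of "vec d f"])
    show "h v \<le> h (vec d f)" if "v \<in> carrier_vec d" "v \<bullet> v = 1" "P v" for v
      using in_S[OF that] f(2) by auto
  qed (use f in \<open>auto simp: S_def\<close>)
qed

text \<open>
  The two-dimensional heart of the S-lemma. On the line \<open>v + s w\<close> the form \<open>B\<close> is a quadratic with
  \<open>B(v) \<ge> 0 \<ge> B(w)\<close>, so in the strict case it has a negative and a positive root \<open>s\<close>. At a root
  \<open>G(v + s w) \<le> s g\<close>, where \<open>g\<close> is the cross term, and one of the two signs makes this nonpositive.
\<close>

lemma isotropic_combination:
  assumes G: "G \<in> carrier_mat d d" and B: "B \<in> carrier_mat d d"
    and v: "v \<in> carrier_vec d" "v \<noteq> 0\<^sub>v d" "0 \<le> qf B v" "qf G v \<le> 0"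
    and w: "w \<in> carrier_vec d" "w \<noteq> 0\<^sub>v d" "qf B w \<le> 0" "qf G w \<le> 0"
  obtains x where "x \<in> carrier_vec d" "x \<noteq> 0\<^sub>v d" "qf B x = 0" "qf G x \<le> 0"
proof (cases "qf B v = 0 \<or> qf B w = 0")
  case True
  thus ?thesis using that v w by blast
next
  case False
  hence b: "0 < qf B v" "qf B w < 0" using v w by auto
  let ?b = "v \<bullet> (B *\<^sub>v w) + w \<bullet> (B *\<^sub>v v)"
  let ?g = "v \<bullet> (G *\<^sub>v w) + w \<bullet> (G *\<^sub>v v)"
  define D where "D = ?b\<^sup>2 - 4 * qf B w * qf B v"
  have D: "?b\<^sup>2 < D" using b unfolding D_def by (simp add: mult_neg_pos)
  have bD: "\<bar>?b\<bar> < sqrt D" using D real_less_rsqrt by (metis power2_abs)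
  define s1 where "s1 = (- ?b + sqrt D) / (2 * qf B w)"
  define s2 where "s2 = (- ?b - sqrt D) / (2 * qf B w)"
  have "0 \<le> D" using D by (smt (verit) zero_le_power2)
  hence roots: "qf B w * s\<^sup>2 + ?b * s + qf B v = 0" if "s = s1 \<or> s = s2" for s
    using that b discriminant_iff[of "qf B w" s ?b "qf B v"]
    unfolding D_def discrim_def s1_def s2_def by auto
  have "s1 < 0" unfolding s1_def using bD b by (auto intro!: divide_pos_neg)
  moreover have "0 < s2" unfolding s2_def using bD b by (auto intro!: divide_neg_neg)
  ultimately obtain s where s: "s = s1 \<or> s = s2" "s * ?g \<le> 0"
    by (metis linear mult_nonneg_nonpos mult_nonpos_nonneg less_imp_le)
  show ?thesis
  proof
    show "v + s \<cdot>\<^sub>v w \<in> carrier_vec d" using v w by simp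
    show "qf B (v + s \<cdot>\<^sub>v w) = 0" using roots[OF s(1)] by (simp add: qf_add[OF B v(1) w(1)] algebra_simps)
    show "qf G (v + s \<cdot>\<^sub>v w) \<le> 0"
      using s(2) v(4) w(4) mult_nonneg_nonpos[of "s\<^sup>2" "qf G w"] by (simp add: qf_add[OF G v(1) w(1)])
    show "v + s \<cdot>\<^sub>v w \<noteq> 0\<^sub>v d"
    proof
      assume z: "v + s \<cdot>\<^sub>v w = 0\<^sub>v d"
      have "v = (-s) \<cdot>\<^sub>v w"
      proof (rule eq_vecI)
        fix i assume "i < dim_vec ((-s) \<cdot>\<^sub>v w)"
        thus "v $ i = ((-s) \<cdot>\<^sub>v w) $ i" using arg_cong[OF z, of "\<lambda>x. x $ i"] v w by simp
      qed (use v w in simp)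
      hence "qf B v = s\<^sup>2 * qf B w" using qf_smult[OF B w(1), of "-s"] by simp
      thus False using b by (simp add: mult_nonneg_nonpos not_le[symmetric])
    qed
  qed
qed

text \<open>
  On the unit sphere, \<open>\<alpha>\<close> has to satisfy \<open>\<alpha> > A(v) / B(v)\<close> where \<open>B(v) < 0\<close> and \<open>A(v) \<le> 0\<close>, and
  \<open>\<alpha> B(v) / A(v) < 1\<close> where \<open>B(v) \<ge> 0\<close>. By compactness the largest ratios \<open>a\<close> and \<open>r\<close> are attained,
  say at \<open>w\<close> and \<open>v\<close>, so an admissible \<open>\<alpha> > a\<close> exists as soon as \<open>a r < 1\<close>. Otherwise \<open>A - a B\<close> would be
  nonpositive at both \<open>v\<close> and \<open>w\<close>, and an isotropic combination of them would contradict the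
  hypothesis. A form \<open>B\<close> without positive values, as noise-free data produce it, is covered.
\<close>

lemma strict_S_lemma:
  assumes A: "A \<in> carrier_mat d d" and B: "B \<in> carrier_mat d d"
    and imp: "\<And>v. v \<in> carrier_vec d \<Longrightarrow> v \<noteq> 0\<^sub>v d \<Longrightarrow> 0 \<le> qf B v \<Longrightarrow> 0 < qf A v"
  obtains \<alpha> where "0 \<le> \<alpha>" "\<And>v. v \<in> carrier_vec d \<Longrightarrow> v \<noteq> 0\<^sub>v d \<Longrightarrow> \<alpha> * qf B v < qf A v"
proof -
  have imp1: "0 < qf A v" if "v \<in> carrier_vec d" "v \<bullet> v = 1" "0 \<le> qf B v" for v
    using imp that norm_one_nonzero by blast
  note cont = continuous_qf[OF A] continuous_qf[OF B]
  note cont' = cont[THEN continuous_on_subset, OF subset_UNIV]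
  note result = that
  have reduce: thesis if \<alpha>: "0 \<le> \<alpha>" "\<And>v. v \<in> carrier_vec d \<Longrightarrow> v \<bullet> v = 1 \<Longrightarrow> \<alpha> * qf B v < qf A v" for \<alpha>
  proof (rule result[OF \<alpha>(1)])
    fix v :: "real vec" assume "v \<in> carrier_vec d" "v \<noteq> 0\<^sub>v d"
    then obtain c w where cw: "0 < c" "w \<in> carrier_vec d" "w \<bullet> w = 1" "v = c \<cdot>\<^sub>v w"
      by (rule normalize_vec)
    have "c\<^sup>2 * (\<alpha> * qf B w) < c\<^sup>2 * qf A w" using \<alpha>(2)[OF cw(2,3)] cw(1) by simp
    thus "\<alpha> * qf B v < qf A v"
      unfolding cw(4) qf_smult[OF A cw(2)] qf_smult[OF B cw(2)] by (simp add: mult.left_commute)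
  qed
  define neg where "neg v \<longleftrightarrow> qf B v \<le> 0 \<and> qf A v \<le> 0" for v
  show thesis
  proof (cases "\<exists>v \<in> carrier_vec d. v \<bullet> v = 1 \<and> neg v")
    case False
    show thesis
      by (rule reduce[of 0]) (use False imp1 in \<open>force simp: neg_def\<close>)+
  next
    case True
    then obtain v1 where v1: "v1 \<in> carrier_vec d" "v1 \<bullet> v1 = 1" "neg v1" by blast
    have neg_lt: "qf B v < 0" if "v \<in> carrier_vec d" "v \<bullet> v = 1" "neg v" for v
      using imp1[OF that(1,2)] that(3) by (force simp: neg_def)
    define neg' where "neg' v \<longleftrightarrow> neg v \<and> v \<bullet> v = 1" for v :: "real vec"
    have cl: "closed {f. neg' (vec d f)}"
      using continuous_qf[of "1\<^sub>m d" d]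
      unfolding neg'_def neg_def by (intro closed_Collect_conj closed_Collect_le closed_Collect_eq cont continuous_on_const) simp_all
    have co: "continuous_on {f. neg' (vec d f)} (\<lambda>f. qf A (vec d f) / qf B (vec d f))"
    proof (intro continuous_on_divide cont' ballI)
      fix f assume "f \<in> {f. neg' (vec d f)}"
      thus "qf B (vec d f) \<noteq> 0" using neg_lt[of "vec d f"] by (simp add: neg'_def)
    qed
    obtain w where w: "w \<in> carrier_vec d" "w \<bullet> w = 1" "neg' w" and
      w_max: "\<And>v. v \<in> carrier_vec d \<Longrightarrow> v \<bullet> v = 1 \<Longrightarrow> neg' v \<Longrightarrow> qf A v / qf B v \<le> qf A w / qf B w"
      using sphere_attains_max[of neg' d, OF cl co v1(1,2)] v1 unfolding neg'_def by blast
    define a where "a = qf A w / qf B w"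
    have Bw: "qf B w < 0" using neg_lt w by (auto simp: neg'_def)
    hence a: "0 \<le> a" "qf A w = a * qf B w"
      using w by (auto simp: a_def neg'_def neg_def zero_le_divide_iff)
    have low: "\<alpha> * qf B v < qf A v" if \<alpha>: "a < \<alpha>" and v: "v \<in> carrier_vec d" "v \<bullet> v = 1" "qf B v \<le> 0" for v \<alpha>
    proof (cases "qf A v \<le> 0")
      case True
      hence n: "neg v" using v by (simp add: neg_def)
      hence "qf B v < 0" using neg_lt v by blast
      moreover have "qf A v / qf B v < \<alpha>" using w_max[OF v(1,2)] n v \<alpha> unfolding a_def neg'_def by linarith
      ultimately show ?thesis by (simp add: neg_divide_less_eq)
    next
      case False
      thus ?thesis using v \<alpha> a mult_nonneg_nonpos[of \<alpha> "qf B v"] by linarith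
    qed
    show thesis
    proof (cases "\<exists>v \<in> carrier_vec d. v \<bullet> v = 1 \<and> 0 \<le> qf B v")
      case False
      show thesis
        by (rule reduce[of "a + 1"]) (use a low[of "a + 1"] False in force)+
    next
      case True
      then obtain v2 where v2: "v2 \<in> carrier_vec d" "v2 \<bullet> v2 = 1" "0 \<le> qf B v2" by blast
      define nonneg where "nonneg v \<longleftrightarrow> 0 \<le> qf B v \<and> v \<bullet> v = 1" for v
      have cl: "closed {f. nonneg (vec d f)}"
        using continuous_qf[of "1\<^sub>m d" d]
        unfolding nonneg_def by (intro closed_Collect_conj closed_Collect_le closed_Collect_eq cont continuous_on_const) simp_all
      have co: "continuous_on {f. nonneg (vec d f)} (\<lambda>f. qf B (vec d f) / qf A (vec d f))"
      proof (intro continuous_on_divide cont' ballI)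
      fix f assume "f \<in> {f. nonneg (vec d f)}"
      thus "qf A (vec d f) \<noteq> 0" using imp1[of "vec d f"] by (simp add: nonneg_def)
    qed
      obtain v where v: "v \<in> carrier_vec d" "v \<bullet> v = 1" "nonneg v" and
        v_max: "\<And>x. x \<in> carrier_vec d \<Longrightarrow> x \<bullet> x = 1 \<Longrightarrow> nonneg x \<Longrightarrow> qf B x / qf A x \<le> qf B v / qf A v"
        using sphere_attains_max[of nonneg d, OF cl co v2(1,2)] v2 unfolding nonneg_def by blast
      define r where "r = qf B v / qf A v"
      have Av: "0 < qf A v" "0 \<le> qf B v" using imp1 v by (auto simp: nonneg_def)
      hence r: "0 \<le> r" "qf B v = r * qf A v" by (auto simp: r_def)
      have ar: "a * r < 1"
      proof (rule ccontr)
        assume "\<not> a * r < 1"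
        hence "(1 - a * r) * qf A v \<le> 0" using Av(1) by (intro mult_nonpos_nonneg) auto
        hence "qf A v - a * qf B v \<le> 0" unfolding r(2) by (simp only: left_diff_distrib mult.assoc mult_1)
        moreover have "qf A w - a * qf B w \<le> 0" using a by simp
        ultimately obtain x where x: "x \<in> carrier_vec d" "x \<noteq> 0\<^sub>v d" "qf B x = 0" "qf (A - a \<cdot>\<^sub>m B) x \<le> 0"
          using isotropic_combination[of "A - a \<cdot>\<^sub>m B" d B v w] minus_carrier_mat[OF smult_carrier_mat[OF B]]
            qf_minus_smult[OF A B v(1)] qf_minus_smult[OF A B w(1)] B v(1) w(1) Av(2) Bw
            norm_one_nonzero[OF v(2)] norm_one_nonzero[OF w(2)]
          by (metis less_imp_le)
        thus False using imp[OF x(1,2)] qf_minus_smult[OF A B x(1), of a] by simp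
      qed
      \<comment> \<open>Above \<open>a\<close>, yet by so little that \<open>\<alpha> r \<le> (1 + a r) / 2 < 1\<close>; adding 1 to \<open>r\<close> covers \<open>r = 0\<close>.\<close>
      define \<alpha> where "\<alpha> = a + (1 - a * r) / (2 * (r + 1))"
      have \<alpha>a: "a < \<alpha>" using ar r by (simp add: \<alpha>_def)
      have "(1 - a * r) * r / (2 * (r + 1)) \<le> (1 - a * r) / 2"
        using ar r by (simp add: field_simps)
      moreover have "\<alpha> * r = a * r + (1 - a * r) * r / (2 * (r + 1))"
        by (simp add: \<alpha>_def distrib_right)
      ultimately have "\<alpha> * r \<le> a * r + (1 - a * r) / 2" by simp
      also have "\<dots> < a * r + (1 - a * r)" using ar by (simp add: field_simps)
      finally have \<alpha>r: "\<alpha> * r < 1" by simp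
      show thesis
      proof (rule reduce[of \<alpha>])
        show "0 \<le> \<alpha>" using \<alpha>a a by simp
        fix x :: "real vec" assume x: "x \<in> carrier_vec d" "x \<bullet> x = 1"
        show "\<alpha> * qf B x < qf A x"
        proof (cases "qf B x \<le> 0")
          case True
          thus ?thesis using low[OF \<alpha>a] x by blast
        next
          case False
          hence Ax: "0 < qf A x" using imp1 x by simp
          have "qf B x \<le> r * qf A x" using v_max[OF x] False x Ax
            unfolding r_def nonneg_def by (simp add: pos_divide_le_eq)
          hence "\<alpha> * qf B x \<le> \<alpha> * (r * qf A x)" using \<alpha>a a by (intro mult_left_mono) auto
          also have "\<dots> < 1 * qf A x" using \<alpha>r Ax unfolding mult.assoc[symmetric] by (intro mult_strict_right_mono)
          finally show ?thesis by simp
        qed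
      qed
    qed
  qed
qed

text \<open>
  By homogeneity, \<open>1 / \<epsilon>\<close> may be any positive upper bound of the ratio \<open>A / B\<close> on the unit sphere.
\<close>

lemma pos_form_dominates:
  assumes A: "A \<in> carrier_mat d d" and B: "B \<in> carrier_mat d d"
    and pos: "\<And>v. v \<in> carrier_vec d \<Longrightarrow> v \<noteq> 0\<^sub>v d \<Longrightarrow> 0 < qf B v"
  obtains \<epsilon> where "0 < \<epsilon>" "\<And>v. v \<in> carrier_vec d \<Longrightarrow> \<epsilon> * qf A v \<le> qf B v"
proof (cases "\<exists>v :: real vec \<in> carrier_vec d. v \<bullet> v = 1")
  case False
  have "qf B v = 0 \<and> qf A v = 0" if v: "v \<in> carrier_vec d" for v :: "real vec"
  proof -
    have "v = 0\<^sub>v d"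
    proof (rule ccontr)
      assume "v \<noteq> 0\<^sub>v d"
      then obtain c w where "w \<in> carrier_vec d" "w \<bullet> w = (1::real)"
        by (rule normalize_vec[OF v])
      thus False using False by blast
    qed
    thus ?thesis using A B by simp
  qed
  thus ?thesis using that[of 1] by simp
next
  case True
  then obtain v1 :: "real vec" where v1: "v1 \<in> carrier_vec d" "v1 \<bullet> v1 = 1" by blast
  define S where "S v \<longleftrightarrow> v \<bullet> v = 1" for v :: "real vec"
  have cl: "closed {f. S (vec d f)}"
    using continuous_qf[of "1\<^sub>m d" d] unfolding S_def
    by (intro closed_Collect_eq continuous_on_const) simp_all
  have co: "continuous_on {f. S (vec d f)} (\<lambda>f. qf A (vec d f) / qf B (vec d f))"
    using pos norm_one_nonzero
    by (intro continuous_on_divide continuous_qf[THEN continuous_on_subset, OF _ subset_UNIV] A B)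
       (metis (mono_tags) S_def less_irrefl mem_Collect_eq vec_carrier)
  obtain w where w: "w \<in> carrier_vec d" "w \<bullet> w = 1"
    "\<And>v. v \<in> carrier_vec d \<Longrightarrow> v \<bullet> v = 1 \<Longrightarrow> qf A v / qf B v \<le> qf A w / qf B w"
    using sphere_attains_max[of S d, OF cl co v1 v1(2)[folded S_def]] unfolding S_def by metis
  define c where "c = \<bar>qf A w / qf B w\<bar> + 1"
  have c: "0 < c" unfolding c_def by linarith
  show ?thesis
  proof (rule that[of "1 / c"])
    show "0 < 1 / c" using c by simp
    fix v :: "real vec" assume v: "v \<in> carrier_vec d"
    show "1 / c * qf A v \<le> qf B v"
    proof (cases "v = 0\<^sub>v d")
      case True thus ?thesis using A B by simp
    next
      case False
      obtain k x where x: "0 < k" "x \<in> carrier_vec d" "x \<bullet> x = 1" "v = k \<cdot>\<^sub>v x"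
        by (rule normalize_vec[OF v False])
      have Bx: "0 < qf B x" using pos x norm_one_nonzero by blast
      have "qf A x / qf B x \<le> c" using w(3)[OF x(2,3)] unfolding c_def by linarith
      hence "1 / c * qf A x \<le> qf B x" using Bx c by (simp add: field_simps)
      hence "k\<^sup>2 * (1 / c * qf A x) \<le> k\<^sup>2 * qf B x" by (intro mult_left_mono) auto
      thus ?thesis unfolding x(4) qf_smult[OF A x(2)] qf_smult[OF B x(2)] by (simp add: mult_ac)
    qed
  qed
qed

section \<open>Positive definite matrices and duality\<close>

lemma pos_def_carrier:
  assumes "pos_def n A" shows "A \<in> carrier_mat n n" "sym_mat n A"
  using assms by (auto simp: pos_def_def sym_mat_def)

lemma pos_def_imp_psd: "pos_def n A \<Longrightarrow> pos_semidef n A"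
  unfolding pos_def_def pos_semidef_def
proof (intro conjI ballI; elim conjE)
  fix x :: "real vec" assume s: "sym_mat n A" and x: "x \<in> carrier_vec n"
    and p: "\<forall>x\<in>carrier_vec n. x \<noteq> 0\<^sub>v n \<longrightarrow> 0 < qf A x"
  show "0 \<le> qf A x"
  proof (cases "x = 0\<^sub>v n")
    case True
    have "A *\<^sub>v x \<in> carrier_vec n" using s x by (auto simp: sym_mat_def)
    thus ?thesis using True by simp
  next
    case False thus ?thesis using p x less_imp_le by blast
  qed
qed

text \<open>
  The usual discriminant argument, which has to treat \<open>A(y) = 0\<close> separately since \<open>A\<close> may be singular.
\<close>

lemma psd_Cauchy_Schwarz:
  assumes A: "pos_semidef n A" and x: "x \<in> carrier_vec n" and y: "y \<in> carrier_vec n"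
  shows "(x \<bullet> (A *\<^sub>v y))\<^sup>2 \<le> qf A x * qf A y"
proof -
  have sym: "sym_mat n A" and Ac: "A \<in> carrier_mat n n" using A by (auto simp: pos_semidef_def sym_mat_def)
  define b where "b = x \<bullet> (A *\<^sub>v y)"
  have q: "0 \<le> qf A x + s * (2 * b) + s\<^sup>2 * qf A y" for s
    using A x y qf_add[OF Ac x y, of s] sym_mat_swap[OF sym x y]
    unfolding pos_semidef_def b_def by (metis add_carrier_vec mult_2 smult_carrier_vec)
  have "0 \<le> qf A y" using A y by (simp add: pos_semidef_def)
  then consider "qf A y = 0" | "0 < qf A y" by linarith
  hence "b\<^sup>2 \<le> qf A x * qf A y"
  proof cases
    case 1
    have "b = 0"
    proof (rule ccontr)
      assume "b \<noteq> 0"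
      \<comment> \<open>The form is affine along \<open>y\<close>; this is the point where it takes the value \<open>- 1\<close>.\<close>
      thus False using q[of "- (qf A x + 1) / (2 * b)"] 1 by simp
    qed
    thus ?thesis using 1 by simp
  next
    case 2
    have "0 \<le> qf A x - b\<^sup>2 / qf A y"
      using q[of "- b / qf A y"] 2 by (simp add: power2_eq_square field_simps)
    thus ?thesis using 2 by (simp add: field_simps)
  qed
  thus ?thesis by (simp add: b_def)
qed

lemma mat_inv_pos_def:
  assumes P: "pos_def n A"
  shows "mat_inv A \<in> carrier_mat n n" "A * mat_inv A = 1\<^sub>m n" "mat_inv A * A = 1\<^sub>m n"
    "pos_def n (mat_inv A)"
proof -
  note Ac = pos_def_carrier(1)[OF P]
  have "A *\<^sub>v v \<noteq> 0\<^sub>v n" if "v \<in> carrier_vec n" "v \<noteq> 0\<^sub>v n" for v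
  proof
    assume "A *\<^sub>v v = 0\<^sub>v n"
    hence "qf A v = 0" using that by simp
    thus False using P that unfolding pos_def_def by force
  qed
  hence "det A \<noteq> 0" using det_0_iff_vec_prod_zero_field[OF Ac] by blast
  hence "mat_inverse A \<noteq> None" using det_non_zero_imp_unit[OF Ac] mat_inverse(1)[OF Ac] by metis
  hence "mat_inverse A = Some (mat_inv A)" by (auto simp: mat_inv_def)
  note inv = mat_inverse(2)[OF Ac this]
  show c: "mat_inv A \<in> carrier_mat n n" and l: "A * mat_inv A = 1\<^sub>m n" and r: "mat_inv A * A = 1\<^sub>m n"
    using inv by auto
  let ?B = "mat_inv A"
  have At: "transpose_mat A = A" using P by (simp add: pos_def_def sym_mat_def)
  have "transpose_mat ?B = transpose_mat ?B * (A * ?B)" using c l by simp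
  also have "\<dots> = (transpose_mat ?B * transpose_mat A) * ?B"
    unfolding At using c Ac by (simp add: assoc_mult_mat[of _ n n _ n _ n])
  also have "transpose_mat ?B * transpose_mat A = 1\<^sub>m n"
    using l c Ac by (simp add: transpose_mult[symmetric, of _ n n _ n])
  finally have sym: "sym_mat n ?B" using c by (simp add: sym_mat_def)
  have "0 < qf ?B x" if x: "x \<in> carrier_vec n" "x \<noteq> 0\<^sub>v n" for x
  proof -
    define y where "y = ?B *\<^sub>v x"
    have y: "y \<in> carrier_vec n" using c x by (simp add: y_def)
    have Ay: "A *\<^sub>v y = x" unfolding y_def using c Ac x l by (simp add: assoc_mult_mat_vec[symmetric, of _ n n _ n])
    have "y \<noteq> 0\<^sub>v n" using Ay x Ac by auto
    hence "0 < qf A y" using P y by (simp add: pos_def_def)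
    thus ?thesis unfolding Ay using x y by (simp add: y_def[symmetric] comm_scalar_prod[of x n y])
  qed
  thus "pos_def n ?B" using sym by (simp add: pos_def_def)
qed

lemma mat_inv_apply:
  assumes P: "pos_def n A" and x: "x \<in> carrier_vec n"
  shows "A *\<^sub>v (mat_inv A *\<^sub>v x) = x" "mat_inv A *\<^sub>v (A *\<^sub>v x) = x"
  using mat_inv_pos_def[OF P] pos_def_carrier[OF P] x
  by (simp_all add: assoc_mult_mat_vec[symmetric, of _ n n _ n])

lemma inverse_unique:
  fixes A B C :: "real mat"
  assumes "A \<in> carrier_mat n n" "B \<in> carrier_mat n n" "C \<in> carrier_mat n n"
    "B * A = 1\<^sub>m n" "A * C = 1\<^sub>m n"
  shows "B = C"
proof -
  have "B = B * (A * C)" using assms by simp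
  also have "\<dots> = (B * A) * C" using assms(2,1,3) by (rule assoc_mult_mat[symmetric])
  finally show ?thesis using assms by simp
qed

lemma mat_inv_mat_inv:
  assumes "pos_def n A" shows "mat_inv (mat_inv A) = A"
  using inverse_unique[of "mat_inv A" n "mat_inv (mat_inv A)" A]
    mat_inv_pos_def[OF assms] mat_inv_pos_def[OF mat_inv_pos_def(4)[OF assms]] pos_def_carrier[OF assms]
  by simp

text \<open>
  This is the Cauchy-Schwarz inequality of the inner product given by \<open>A\<close>, applied to \<open>x\<close> and
  \<open>A\<^sup>-\<^sup>1 w\<close>.
\<close>

lemma dual_Cauchy_Schwarz:
  assumes P: "pos_def n A" and x: "x \<in> carrier_vec n" and w: "w \<in> carrier_vec n"
  shows "(x \<bullet> w)\<^sup>2 \<le> qf A x * qf (mat_inv A) w"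
proof -
  let ?B = "mat_inv A"
  note c = mat_inv_pos_def[OF P] pos_def_carrier[OF P]
  have Ax: "A *\<^sub>v x \<in> carrier_vec n" using c x by simp
  have "x \<bullet> w = x \<bullet> (A *\<^sub>v (?B *\<^sub>v w))" using mat_inv_apply[OF P w] by simp
  hence "(x \<bullet> w)\<^sup>2 \<le> qf A x * qf A (?B *\<^sub>v w)"
    using psd_Cauchy_Schwarz[OF pos_def_imp_psd[OF P] x, of "?B *\<^sub>v w"] c w by simp
  also have "qf A (?B *\<^sub>v w) = qf ?B w"
    using mat_inv_apply[OF P w] c w comm_scalar_prod[of "?B *\<^sub>v w" n w] by simp
  finally show ?thesis .
qed

text \<open>
  For \<open>\<Psi>\<close> and its inverse \<open>\<Phi>\<close>, put \<open>y = A\<^sup>T x\<close> and \<open>z = \<Phi> y\<close>. Then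
  \<open>\<Phi>(y)\<^sup>2 = (x \<bullet> A z)\<^sup>2 \<le> \<Phi>(x) \<Psi>(A z) < \<Phi>(x) \<Psi>(z) = \<Phi>(x) \<Phi>(y)\<close>, and dividing by \<open>\<Phi>(y)\<close> gives the
  claim. Applied to \<open>\<Phi>\<close> and \<open>A\<^sup>T\<close>, the same statement is the converse.
\<close>

lemma dual_contraction:
  assumes P: "pos_def n \<Psi>" and A: "A \<in> carrier_mat n n"
    and contr: "\<And>x. x \<in> carrier_vec n \<Longrightarrow> x \<noteq> 0\<^sub>v n \<Longrightarrow> qf \<Psi> (A *\<^sub>v x) < qf \<Psi> x"
    and x: "x \<in> carrier_vec n" "x \<noteq> 0\<^sub>v n"
  shows "qf (mat_inv \<Psi>) (transpose_mat A *\<^sub>v x) < qf (mat_inv \<Psi>) x"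
proof -
  let ?F = "mat_inv \<Psi>"
  define y where "y = transpose_mat A *\<^sub>v x"
  define z where "z = ?F *\<^sub>v y"
  note c = mat_inv_pos_def[OF P] pos_def_carrier[OF P]
  have y: "y \<in> carrier_vec n" and z: "z \<in> carrier_vec n" and Az: "A *\<^sub>v z \<in> carrier_vec n"
    using A c x by (auto simp: y_def z_def)
  have Fx: "0 < qf ?F x" using c(4) x by (simp add: pos_def_def)
  show ?thesis
  proof (cases "y = 0\<^sub>v n")
    case True
    thus ?thesis using Fx c by (simp add: y_def[symmetric])
  next
    case False
    have \<Psi>z: "\<Psi> *\<^sub>v z = y" unfolding z_def by (rule mat_inv_apply(1)[OF P y])
    hence "z \<noteq> 0\<^sub>v n" using False c by auto
    hence lt: "qf \<Psi> (A *\<^sub>v z) < qf \<Psi> z" using contr z by blast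
    have Fy: "qf ?F y = qf \<Psi> z" unfolding \<Psi>z using z y comm_scalar_prod[of y n z] by (simp add: z_def)
    have "x \<bullet> (A *\<^sub>v z) = z \<bullet> y" unfolding y_def by (rule scalar_prod_mult_transpose[OF A x(1) z])
    also have "\<dots> = qf ?F y" using \<Psi>z Fy by simp
    finally have "(qf ?F y)\<^sup>2 = ((A *\<^sub>v z) \<bullet> x)\<^sup>2" using comm_scalar_prod[OF x(1) Az] by simp
    also have "\<dots> \<le> qf \<Psi> (A *\<^sub>v z) * qf ?F x" by (rule dual_Cauchy_Schwarz[OF P Az x(1)])
    also have "\<dots> < qf ?F y * qf ?F x" using lt Fx Fy by simp
    finally have "qf ?F y * qf ?F y < qf ?F y * qf ?F x" by (simp add: power2_eq_square)
    moreover have "0 < qf ?F y" using c(4) y False by (simp add: pos_def_def)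
    ultimately show ?thesis unfolding y_def by simp
  qed
qed

section \<open>Quadratic matrix inequalities\<close>

text \<open>
  In the blocks \<open>A\<close>, \<open>B\<close>, \<open>D\<close> of \<open>N\<close> one has \<open>W = - D\<close>, \<open>Z = W\<^sup>-\<^sup>1 B\<close>, and \<open>Q = A + B\<^sup>T W\<^sup>-\<^sup>1 B\<close> is
  the Schur complement of \<open>D\<close> in \<open>N\<close>.
\<close>

lemma complete_square:
  assumes N: "sym_mat (p + n) N"
    and neg: "\<And>z. z \<in> carrier_vec n \<Longrightarrow> z \<noteq> 0\<^sub>v n \<Longrightarrow> qf N (0\<^sub>v p @\<^sub>v z) < 0"
  obtains Q W Z where "sym_mat p Q" "pos_def n W" "Z \<in> carrier_mat n p"
    "\<And>a z. a \<in> carrier_vec p \<Longrightarrow> z \<in> carrier_vec n \<Longrightarrow>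
       qf N (a @\<^sub>v z) = qf Q a - qf W (z - Z *\<^sub>v a)"
proof -
  obtain A B D where blocks: "sym_mat p A" "B \<in> carrier_mat n p" "sym_mat n D"
    "N = four_block_mat A (transpose_mat B) B D"
    by (rule sym_mat_blocks[OF N])
  hence A: "A \<in> carrier_mat p p" and B: "B \<in> carrier_mat n p" and D: "D \<in> carrier_mat n n"
    by (auto simp: sym_mat_def)
  note q = qf_four_block[OF A B D, folded blocks(4)]
  have W: "pos_def n (- D)"
    unfolding pos_def_def
  proof (intro conjI ballI impI sym_uminus blocks(3))
    fix z :: "real vec" assume z: "z \<in> carrier_vec n" "z \<noteq> 0\<^sub>v n"
    have "A *\<^sub>v 0\<^sub>v p = 0\<^sub>v p" "B *\<^sub>v 0\<^sub>v p = 0\<^sub>v n" using A B by auto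
    hence "qf N (0\<^sub>v p @\<^sub>v z) = qf D z" using q[of "0\<^sub>v p" z] z by simp
    thus "0 < qf (- D) z" using neg[OF z] qf_uminus[OF D z(1)] by simp
  qed
  define V where "V = mat_inv (- D)"
  note V = mat_inv_pos_def[OF W, folded V_def]
  let ?Q = "A + transpose_mat B * V * B"
  show thesis
  proof
    have s: "sym_mat p (transpose_mat B * V * B)"
      using sym_congruence[OF pos_def_carrier(2)[OF V(4)] B] .
    thus "sym_mat p ?Q"
      using blocks(1) transpose_add[of A p p "transpose_mat B * V * B"] by (auto simp: sym_mat_def)
    show "pos_def n (- D)" by (rule W)
    show Z: "V * B \<in> carrier_mat n p" using V B by simp
    fix a z :: "real vec" assume a: "a \<in> carrier_vec p" and z: "z \<in> carrier_vec n"
    have Ba: "B *\<^sub>v a \<in> carrier_vec n" and VBa: "V *\<^sub>v (B *\<^sub>v a) \<in> carrier_vec n" using B V a by auto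
    have Za: "V * B *\<^sub>v a = V *\<^sub>v (B *\<^sub>v a)" using V B a by simp
    have inv: "- D *\<^sub>v (V *\<^sub>v (B *\<^sub>v a)) = B *\<^sub>v a"
      unfolding V_def by (rule mat_inv_apply(1)[OF W Ba])
    have "qf ?Q a = qf A a + qf V (B *\<^sub>v a)"
    proof -
      have c: "transpose_mat B * V * B \<in> carrier_mat p p" using s by (simp add: sym_mat_def)
      have "A *\<^sub>v a \<in> carrier_vec p" "transpose_mat B * V * B *\<^sub>v a \<in> carrier_vec p"
        using mult_mat_vec_carrier[OF A a] mult_mat_vec_carrier[OF c a] by auto
      thus ?thesis
        unfolding add_mult_distrib_mat_vec[OF A c a] qf_congruence[OF V(1) B a, symmetric]
        by (rule scalar_prod_add_distrib[OF a])
    qed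
    moreover have "qf (- D) (z - V *\<^sub>v (B *\<^sub>v a)) = - qf D z - 2 * (z \<bullet> (B *\<^sub>v a)) + qf V (B *\<^sub>v a)"
      unfolding qf_diff_sym[OF pos_def_carrier(2)[OF W] z VBa] inv qf_uminus[OF D z]
      using comm_scalar_prod[OF VBa Ba] by simp
    ultimately show "qf N (a @\<^sub>v z) = qf ?Q a - qf (- D) (z - V * B *\<^sub>v a)"
      unfolding Za q[OF a z] by simp
  qed
qed

lemma qmi_iff:
  assumes N: "sym_mat (p + n) N" and R: "R \<in> carrier_mat p n"
  shows "qmi p N R \<longleftrightarrow> (\<forall>a \<in> carrier_vec p. 0 \<le> qf N (a @\<^sub>v (transpose_mat R *\<^sub>v a)))"
proof -
  let ?S = "1\<^sub>m p @\<^sub>r transpose_mat R"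
  have Rt: "transpose_mat R \<in> carrier_mat n p" using R by simp
  have S: "?S \<in> carrier_mat (p + n) p" using Rt by (intro carrier_append_rows) simp_all
  have Nc: "N \<in> carrier_mat (p + n) (p + n)" using N by (simp add: sym_mat_def)
  have "?S *\<^sub>v a = a @\<^sub>v (transpose_mat R *\<^sub>v a)" if "a \<in> carrier_vec p" for a
    using mat_mult_append[OF one_carrier_mat Rt that] that by simp
  thus ?thesis
    unfolding qmi_def pos_semidef_def
    using sym_congruence[OF N S] qf_congruence[OF Nc S] by simp
qed

text \<open>
  By \<open>complete_square\<close>, \<open>R\<close> solves the inequality iff \<open>W((R\<^sup>T - Z) b) \<le> Q(b)\<close> for all \<open>b\<close>; a
  solution \<open>R0\<close> shows \<open>Q \<ge> 0\<close>. The witness is a rank one change of the center,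
  \<open>R\<^sup>T = Z + \<xi> \<eta>\<^sup>T\<close> with \<open>\<xi> = z - Z a\<close> and \<open>\<eta> = Q a / Q(a)\<close>: then \<open>R\<^sup>T a = z\<close>, and
  \<open>(\<eta> \<bullet> b)\<^sup>2 W(\<xi>) \<le> Q(b)\<close> follows from \<open>W(\<xi>) \<le> Q(a)\<close> and the Cauchy-Schwarz inequality of \<open>Q\<close>.
\<close>

lemma qmi_interpolation:
  assumes N: "sym_mat (p + n) N"
    and neg: "\<And>z. z \<in> carrier_vec n \<Longrightarrow> z \<noteq> 0\<^sub>v n \<Longrightarrow> qf N (0\<^sub>v p @\<^sub>v z) < 0"
    and R0: "R0 \<in> carrier_mat p n" "qmi p N R0"
    and a: "a \<in> carrier_vec p" "a \<noteq> 0\<^sub>v p" and z: "z \<in> carrier_vec n"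
    and nonneg: "0 \<le> qf N (a @\<^sub>v z)"
  obtains R where "R \<in> carrier_mat p n" "qmi p N R" "transpose_mat R *\<^sub>v a = z"
proof -
  obtain Q W Z where Q: "sym_mat p Q" and W: "pos_def n W" and Z: "Z \<in> carrier_mat n p"
    and square: "\<And>a z. a \<in> carrier_vec p \<Longrightarrow> z \<in> carrier_vec n \<Longrightarrow>
       qf N (a @\<^sub>v z) = qf Q a - qf W (z - Z *\<^sub>v a)"
    using complete_square[OF N neg] by metis
  have Wc: "W \<in> carrier_mat n n" and Qc: "Q \<in> carrier_mat p p"
    using pos_def_carrier[OF W] Q by (auto simp: sym_mat_def)
  have W0: "0 \<le> qf W x" if "x \<in> carrier_vec n" for x
    using pos_def_imp_psd[OF W] that by (simp add: pos_semidef_def)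
  have Q0: "pos_semidef p Q"
    unfolding pos_semidef_def
  proof (intro conjI ballI Q)
    fix b :: "real vec" assume b: "b \<in> carrier_vec p"
    have c: "transpose_mat R0 *\<^sub>v b \<in> carrier_vec n" "Z *\<^sub>v b \<in> carrier_vec n" using R0 Z b by auto
    have "0 \<le> qf N (b @\<^sub>v (transpose_mat R0 *\<^sub>v b))" using R0 b qmi_iff[OF N R0(1)] by blast
    thus "0 \<le> qf Q b" using square[OF b c(1)] W0[of "transpose_mat R0 *\<^sub>v b - Z *\<^sub>v b"] c by simp
  qed
  define \<xi> where "\<xi> = z - Z *\<^sub>v a"
  have Za: "Z *\<^sub>v a \<in> carrier_vec n" using Z a by auto
  have \<xi>: "\<xi> \<in> carrier_vec n" using z Za by (simp add: \<xi>_def)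
  have W\<xi>: "qf W \<xi> \<le> qf Q a" using nonneg square[OF a(1) z] by (simp add: \<xi>_def)
  \<comment> \<open>If \<open>Q(a) = 0\<close>, then \<open>\<xi> = 0\<close>, the center itself interpolates, and \<open>\<eta> = 0\<close> will do.\<close>
  obtain \<eta> where \<eta>: "\<eta> \<in> carrier_vec p" "(\<eta> \<bullet> a) \<cdot>\<^sub>v \<xi> = \<xi>"
    "\<And>b. b \<in> carrier_vec p \<Longrightarrow> (\<eta> \<bullet> b)\<^sup>2 * qf W \<xi> \<le> qf Q b"
  proof (cases "qf Q a = 0")
    case True
    hence "\<not> 0 < qf W \<xi>" using W\<xi> by simp
    hence "\<xi> = 0\<^sub>v n" using W \<xi> unfolding pos_def_def by blast
    moreover have "W *\<^sub>v 0\<^sub>v n = 0\<^sub>v n" using Wc by auto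
    ultimately show thesis
      using Q0 by (intro that[of "0\<^sub>v p"]) (auto simp: pos_semidef_def)
  next
    case False
    hence Qa: "0 < qf Q a" using Q0 a by (simp add: pos_semidef_def order_less_le)
    have Qac: "Q *\<^sub>v a \<in> carrier_vec p" using Qc a by auto
    let ?\<eta> = "(1 / qf Q a) \<cdot>\<^sub>v (Q *\<^sub>v a)"
    have \<eta>b: "?\<eta> \<bullet> b = (b \<bullet> (Q *\<^sub>v a)) / qf Q a" if "b \<in> carrier_vec p" for b
      using that Qac by (simp add: comm_scalar_prod[of b p])
    show thesis
    proof (rule that[of ?\<eta>])
      show "?\<eta> \<in> carrier_vec p" using Qac by simp
      show "(?\<eta> \<bullet> a) \<cdot>\<^sub>v \<xi> = \<xi>" using \<eta>b[OF a(1)] Qa by simp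
      fix b :: "real vec" assume b: "b \<in> carrier_vec p"
      have "(b \<bullet> (Q *\<^sub>v a))\<^sup>2 * qf W \<xi> \<le> (qf Q b * qf Q a) * qf Q a"
        using psd_Cauchy_Schwarz[OF Q0 b a(1)] W\<xi> W0[OF \<xi>] Qa Q0 b
        by (intro mult_mono) (auto simp: pos_semidef_def)
      thus "(?\<eta> \<bullet> b)\<^sup>2 * qf W \<xi> \<le> qf Q b"
        unfolding \<eta>b[OF b] using Qa by (simp add: power_divide power2_eq_square divide_simps mult_ac)
    qed
  qed
  define R where "R = mat p n (\<lambda>(i, j). Z $$ (j, i) + \<eta> $ i * \<xi> $ j)"
  have R: "R \<in> carrier_mat p n" by (simp add: R_def)
  have Rb: "transpose_mat R *\<^sub>v b = Z *\<^sub>v b + (\<eta> \<bullet> b) \<cdot>\<^sub>v \<xi>" if b: "b \<in> carrier_vec p" for b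
  proof (rule eq_vecI)
    fix j assume "j < dim_vec (Z *\<^sub>v b + (\<eta> \<bullet> b) \<cdot>\<^sub>v \<xi>)"
    hence j: "j < n" using \<xi> by simp
    have "(transpose_mat R *\<^sub>v b) $ j = (\<Sum>i<p. (Z $$ (j, i) + \<eta> $ i * \<xi> $ j) * b $ i)"
      using j b R by (simp add: scalar_prod_def lessThan_atLeast0 R_def)
    also have "\<dots> = (\<Sum>i<p. Z $$ (j, i) * b $ i) + (\<Sum>i<p. \<eta> $ i * b $ i) * \<xi> $ j"
      by (simp add: sum.distrib algebra_simps sum_distrib_right sum_distrib_left)
    also have "\<dots> = (Z *\<^sub>v b + (\<eta> \<bullet> b) \<cdot>\<^sub>v \<xi>) $ j"
      using j b Z \<xi> by (simp add: scalar_prod_def lessThan_atLeast0)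
    finally show "(transpose_mat R *\<^sub>v b) $ j = (Z *\<^sub>v b + (\<eta> \<bullet> b) \<cdot>\<^sub>v \<xi>) $ j" .
  qed (use R \<xi> in simp)
  show thesis
  proof (rule that[OF R])
    show "transpose_mat R *\<^sub>v a = z"
      unfolding Rb[OF a(1)] \<eta>(2) using z Z by (intro eq_vecI) (auto simp: \<xi>_def)
    show "qmi p N R"
      unfolding qmi_iff[OF N R]
    proof
      fix b :: "real vec" assume b: "b \<in> carrier_vec p"
      have c: "transpose_mat R *\<^sub>v b \<in> carrier_vec n" "Z *\<^sub>v b \<in> carrier_vec n" using R Z b by auto
      have "transpose_mat R *\<^sub>v b - Z *\<^sub>v b = (\<eta> \<bullet> b) \<cdot>\<^sub>v \<xi>"
        unfolding Rb[OF b] using Z \<xi> by (intro eq_vecI) auto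
      thus "0 \<le> qf N (b @\<^sub>v (transpose_mat R *\<^sub>v b))"
        unfolding square[OF b c(1)] using \<eta>(3)[OF b] qf_smult[OF Wc \<xi>, of "\<eta> \<bullet> b"] by simp
    qed
  qed
qed

section \<open>The data matrix\<close>

text \<open>
  A basis chosen from the columns spans the whole space, so a vector orthogonal to all columns is
  orthogonal to itself.
\<close>

lemma full_row_rank_orthogonal:
  fixes A :: "real mat"
  assumes A: "A \<in> carrier_mat n nc" and r: "vec_space.rank n A = n"
    and z: "z \<in> carrier_vec n" "transpose_mat A *\<^sub>v z = 0\<^sub>v nc"
  shows "z = 0\<^sub>v n"
proof -
  interpret V: vec_space "TYPE(real)" n .
  let ?C = "set (cols A)"
  have C: "?C \<subseteq> carrier_vec n" using cols_dim A by blast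
  define ind where "ind = (\<lambda>S. S \<subseteq> ?C \<and> V.lin_indpt S)"
  have "finite S \<and> card S \<le> card ?C" if "ind S" for S
    using that by (auto simp: ind_def card_mono finite_subset[of _ ?C])
  moreover have "ind {}" by (auto simp: ind_def V.lin_dep_def)
  ultimately obtain S where S: "maximal S ind" using maximal_exists[of ind "card ?C" "{}"] by blast
  hence cS: "card S = n" using V.rank_card_indpt[OF A S[unfolded ind_def]] r by simp
  have SC: "S \<subseteq> ?C" "V.lin_indpt S" using S by (auto simp: maximal_def ind_def)
  have "V.basis S" using V.dim_li_is_basis[of S] SC C cS V.dim_is_n by (auto intro: finite_subset)
  hence "carrier_vec n = V.span S" by (simp add: V.basis_def)
  hence zS: "z \<in> V.span ?C" using V.span_is_monotone[OF SC(1)] z by blast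
  have "z \<in> V.orthogonal_complement ?C"
    unfolding V.orthogonal_complement_def
  proof (intro CollectI conjI ballI z)
    fix c assume "c \<in> ?C"
    then obtain j where j: "j < nc" "c = col A j" using A by (auto simp: cols_def)
    have "z \<bullet> c = col A j \<bullet> z" using j A z(1) by (simp add: comm_scalar_prod[of _ n])
    also have "\<dots> = (transpose_mat A *\<^sub>v z) $ j" using j A by simp
    finally show "z \<bullet> c = 0" using z j by simp
  qed
  hence "z \<in> V.orthogonal_complement (V.span ?C)" using V.in_orthogonal_complement_span[OF C] by simp
  hence "z \<bullet> z = 0" using zS by (simp add: V.orthogonal_complement_def)
  thus ?thesis using scalar_self_pos[OF z(1)] by force
qed

lemma hankel1_carrier: "hankel1 m p L T u y \<in> carrier_mat ((p + m) * L) (T - L + 1)"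
  by (simp add: hankel1_def)

lemma hankel2_carrier: "L \<le> T \<Longrightarrow> hankel2 p L T y \<in> carrier_mat p (T - L + 1)"
  unfolding hankel2_def by (rule carrier_matI) (simp_all add: Suc_diff_le)

lemma data_mat_sym:
  assumes "L \<le> T" and Pm: "sym_mat (p + (T - L + 1)) Pm"
  shows "sym_mat (p + (p + m) * L) (data_mat m p L T Pm u y)"
proof -
  let ?H = "four_block_mat (1\<^sub>m p) (hankel2 p L T y) (0\<^sub>m ((p + m) * L) p) (hankel1 m p L T u y)"
  have "transpose_mat ?H \<in> carrier_mat (p + (T - L + 1)) (p + (p + m) * L)"
    using four_block_carrier_mat[OF one_carrier_mat hankel1_carrier] by simp
  from sym_congruence[OF Pm this] show ?thesis by (simp add: data_mat_def Let_def)
qed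

text \<open>
  At \<open>(0, z)\<close> the form of the data matrix equals that of \<open>Pi22\<close> at \<open>H\<^sup>T z\<close>, where
  \<open>H\<close> is the Hankel matrix of the trajectory, and full row rank makes \<open>H\<^sup>T z\<close> nonzero.
\<close>

lemma data_mat_neg:
  assumes LT: "L \<le> T" and Pm: "Pm = four_block_mat Pi11 Pi12 Pi21 Pi22"
    "sym_mat (p + (T - L + 1)) Pm" "sym_mat p Pi11" "Pi12 \<in> carrier_mat p (T - L + 1)"
    "Pi21 \<in> carrier_mat (T - L + 1) p" and neg: "neg_def (T - L + 1) Pi22"
    and rank: "vec_space.rank ((p + m) * L) (hankel1 m p L T u y) = (p + m) * L"
    and z: "z \<in> carrier_vec ((p + m) * L)" "z \<noteq> 0\<^sub>v ((p + m) * L)"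
  shows "qf (data_mat m p L T Pm u y) (0\<^sub>v p @\<^sub>v z) < 0"
proof -
  define n N where "n = (p + m) * L" and "N = T - L + 1"
  define H1 H2 where "H1 = hankel1 m p L T u y" and "H2 = hankel2 p L T y"
  define H where "H = four_block_mat (1\<^sub>m p) H2 (0\<^sub>m n p) H1"
  have H1: "H1 \<in> carrier_mat n N" and H2: "H2 \<in> carrier_mat p N"
    using hankel1_carrier hankel2_carrier[OF LT] by (auto simp: n_def N_def H1_def H2_def)
  have Pi: "Pi11 \<in> carrier_mat p p" "Pi22 \<in> carrier_mat N N" "Pi12 \<in> carrier_mat p N" "Pi21 \<in> carrier_mat N p"
    "Pm \<in> carrier_mat (p + N) (p + N)"
    using Pm neg by (auto simp: sym_mat_def neg_def_def N_def)
  have H: "transpose_mat H \<in> carrier_mat (p + N) (p + n)"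
    using four_block_carrier_mat[OF one_carrier_mat H1] by (simp add: H_def)
  have HT: "transpose_mat H = four_block_mat (1\<^sub>m p) (0\<^sub>m p n) (transpose_mat H2) (transpose_mat H1)"
    unfolding H_def using H1 H2 by (subst transpose_four_block_mat[of _ p p _ N _ n]) auto
  have zn: "z \<in> carrier_vec n" using z by (simp add: n_def)
  define w where "w = transpose_mat H1 *\<^sub>v z"
  have w: "w \<in> carrier_vec N" using H1 zn by (auto simp: w_def)
  have w0: "w \<noteq> 0\<^sub>v N"
    using full_row_rank_orthogonal[OF H1 _ zn] rank z by (auto simp: w_def H1_def n_def)
  have "transpose_mat H2 *\<^sub>v 0\<^sub>v p = 0\<^sub>v N" using H2 by auto
  hence Hz: "transpose_mat H *\<^sub>v (0\<^sub>v p @\<^sub>v z) = 0\<^sub>v p @\<^sub>v w"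
    unfolding HT using four_block_mat_mult_vec[of "1\<^sub>m p" p p "0\<^sub>m p n" n "transpose_mat H2" N "transpose_mat H1" "0\<^sub>v p" z]
      H1 H2 zn w by (simp add: w_def)
  have c: "Pi11 *\<^sub>v 0\<^sub>v p = 0\<^sub>v p" "Pi21 *\<^sub>v 0\<^sub>v p = 0\<^sub>v N" "Pi12 *\<^sub>v w \<in> carrier_vec p" "Pi22 *\<^sub>v w \<in> carrier_vec N"
    using Pi w by auto
  have "qf (data_mat m p L T Pm u y) (0\<^sub>v p @\<^sub>v z) = qf Pm (transpose_mat H *\<^sub>v (0\<^sub>v p @\<^sub>v z))"
    using qf_congruence[OF Pi(5) H, of "0\<^sub>v p @\<^sub>v z"] zn
    by (simp add: data_mat_def Let_def H_def n_def H1_def H2_def)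
  also have "\<dots> = qf Pi22 w"
    unfolding Hz Pm(1) four_block_mat_mult_vec[OF Pi(1,3,4,2) zero_carrier_vec w]
    using c scalar_prod_append[OF zero_carrier_vec[of p] w c(3,4)] by simp
  also have "\<dots> < 0" using neg w w0 by (auto simp: neg_def_def N_def)
  finally show ?thesis .
qed

section \<open>The closed loop as a first order system\<close>

lemma stack_three_carrier:
  fixes A B C :: "real mat"
  assumes "A \<in> carrier_mat a n" "B \<in> carrier_mat b n" "C \<in> carrier_mat c n"
  shows "A @\<^sub>r B @\<^sub>r C \<in> carrier_mat (a + (b + c)) n"
  by (intro carrier_append_rows assms)

lemma stack_three_mult:
  fixes A B C :: "real mat"
  assumes "A \<in> carrier_mat a n" "B \<in> carrier_mat b n" "C \<in> carrier_mat c n" "x \<in> carrier_vec n"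
  shows "(A @\<^sub>r B @\<^sub>r C) *\<^sub>v x = (A *\<^sub>v x) @\<^sub>v (B *\<^sub>v x) @\<^sub>v (C *\<^sub>v x)"
  using mat_mult_append[OF assms(1) carrier_append_rows[OF assms(2,3)] assms(4)] mat_mult_append[OF assms(2-4)]
  by simp

lemma block_dim:
  fixes p m L :: nat
  assumes "0 < L" shows "(p + m) * (L - 1) + (m + p) = (p + m) * L"
  using assms by (cases L) auto

lemma J_mat_carrier: "J_mat q L \<in> carrier_mat (q * (L - 1)) (q * L)"
  by (simp add: J_mat_def)

lemma J_mat_index:
  assumes x: "x \<in> carrier_vec (q * L)" and i: "i < q * (L - 1)"
  shows "(J_mat q L *\<^sub>v x) $ i = x $ (i + q)"
proof -
  have "i + q < q * L" using i by (cases L) auto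
  hence "(\<Sum>j = 0..<q * L. (if j = i + q then 1 else 0) * x $ j) = x $ (i + q)"
    by (simp add: if_distrib[of "\<lambda>a. a * _"] cong: if_cong)
  thus ?thesis using assms by (simp add: J_mat_def scalar_prod_def)
qed

definition closed_loop_mat :: "nat \<Rightarrow> nat \<Rightarrow> nat \<Rightarrow> real mat \<Rightarrow> real mat \<Rightarrow> real mat" where
  "closed_loop_mat m p L C R = J_mat (p + m) L @\<^sub>r (- C) @\<^sub>r (- R)"

lemma closed_loop_mat_carrier:
  assumes "0 < L" "C \<in> carrier_mat m ((p + m) * L)" "R \<in> carrier_mat p ((p + m) * L)"
  shows "closed_loop_mat m p L C R \<in> carrier_mat ((p + m) * L) ((p + m) * L)"
  using stack_three_carrier[OF J_mat_carrier[of "p + m" L], of "- C" m "- R" p] assms block_dim[OF assms(1)]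
  by (simp add: closed_loop_mat_def)

lemma closed_loop_mat_mult:
  assumes "C \<in> carrier_mat m ((p + m) * L)" "R \<in> carrier_mat p ((p + m) * L)" "x \<in> carrier_vec ((p + m) * L)"
  shows "closed_loop_mat m p L C R *\<^sub>v x = (J_mat (p + m) L *\<^sub>v x) @\<^sub>v (- (C *\<^sub>v x)) @\<^sub>v (- (R *\<^sub>v x))"
  unfolding closed_loop_mat_def
  using stack_three_mult[OF J_mat_carrier[of "p + m" L] _ _ assms(3), of "- C" m "- R" p] assms
  by simp

text \<open>
  Both sides are forms in the stack of \<open>x\<close>, \<open>- C x\<close>, \<open>- R x\<close>: its first \<open>n\<close> entries are \<open>x\<close> and its
  last \<open>n\<close> entries are \<open>A\<^sub>R x\<close>, because \<open>J\<close> drops the first \<open>q\<close> entries of \<open>x\<close>.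
\<close>

lemma quad_stab_iff:
  fixes m p L :: nat
  defines "q \<equiv> p + m" and "n \<equiv> (p + m) * L"
  assumes L: "0 < L" and C: "C \<in> carrier_mat m n" and R: "R \<in> carrier_mat p n" and \<Psi>: "sym_mat n \<Psi>"
  shows "(let S = 1\<^sub>m n @\<^sub>r (- C) @\<^sub>r (- R) in
            neg_def n (transpose_mat S *
              (four_block_mat (0\<^sub>m q q) (0\<^sub>m q n) (0\<^sub>m n q) \<Psi>
                - four_block_mat \<Psi> (0\<^sub>m n q) (0\<^sub>m q n) (0\<^sub>m q q)) * S)) \<longleftrightarrow>
         (\<forall>x \<in> carrier_vec n. x \<noteq> 0\<^sub>v n \<longrightarrow> qf \<Psi> (closed_loop_mat m p L C R *\<^sub>v x) < qf \<Psi> x)"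
proof -
  let ?S = "1\<^sub>m n @\<^sub>r (- C) @\<^sub>r (- R)"
  let ?X = "four_block_mat (0\<^sub>m q q) (0\<^sub>m q n) (0\<^sub>m n q) \<Psi>"
  let ?Y = "four_block_mat \<Psi> (0\<^sub>m n q) (0\<^sub>m q n) (0\<^sub>m q q)"
  let ?A = "closed_loop_mat m p L C R"
  have \<Psi>c: "\<Psi> \<in> carrier_mat n n" using \<Psi> by (simp add: sym_mat_def)
  have z: "sym_mat k (0\<^sub>m k k)" for k by (simp add: sym_mat_def)
  have S: "?S \<in> carrier_mat (n + q) n"
    using stack_three_carrier[of "1\<^sub>m n" n n "- C" m "- R" p] C R by (simp add: q_def add.commute)
  have X: "sym_mat (n + q) ?X" using sym_four_block[OF z[of q] zero_carrier_mat[of n q] \<Psi>] by (simp add: add.commute)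
  have Y: "sym_mat (n + q) ?Y" using sym_four_block[OF \<Psi> zero_carrier_mat[of q n] z[of q]] by simp
  have XY: "sym_mat (n + q) (?X - ?Y)" by (rule sym_minus[OF X Y])
  have val: "qf (transpose_mat ?S * (?X - ?Y) * ?S) x = qf \<Psi> (?A *\<^sub>v x) - qf \<Psi> x" if x: "x \<in> carrier_vec n" for x
  proof -
    have Cx: "C *\<^sub>v x \<in> carrier_vec m" "R *\<^sub>v x \<in> carrier_vec p" using C R x by auto
    have Sx: "?S *\<^sub>v x = x @\<^sub>v (- (C *\<^sub>v x)) @\<^sub>v (- (R *\<^sub>v x))"
      using stack_three_mult[of "1\<^sub>m n" n n "- C" m "- R" p x] C R x by simp
    have Ax: "?A *\<^sub>v x = (J_mat q L *\<^sub>v x) @\<^sub>v (- (C *\<^sub>v x)) @\<^sub>v (- (R *\<^sub>v x))"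
      using closed_loop_mat_mult[of C m p L R x] C R x by (simp add: q_def n_def)
    have A: "?A *\<^sub>v x \<in> carrier_vec n"
      using closed_loop_mat_carrier[OF L, of C m p R] C R x by (auto simp: n_def)
    let ?h = "vec q (\<lambda>i. x $ i)"
    have nq: "n = q + q * (L - 1)" using L unfolding n_def q_def by (cases L) auto
    have split: "x @\<^sub>v (- (C *\<^sub>v x)) @\<^sub>v (- (R *\<^sub>v x)) = ?h @\<^sub>v (?A *\<^sub>v x)"
      unfolding Ax
    proof (rule eq_vecI)
      fix i assume "i < dim_vec (?h @\<^sub>v (J_mat q L *\<^sub>v x) @\<^sub>v (- (C *\<^sub>v x)) @\<^sub>v (- (R *\<^sub>v x)))"
      thus "(x @\<^sub>v (- (C *\<^sub>v x)) @\<^sub>v (- (R *\<^sub>v x))) $ i =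
        (?h @\<^sub>v (J_mat q L *\<^sub>v x) @\<^sub>v (- (C *\<^sub>v x)) @\<^sub>v (- (R *\<^sub>v x))) $ i"
        using x C R nq J_mat_index[of x q L "i - q"] J_mat_carrier[of q L]
        by (auto simp: n_def q_def)
    qed (use x C R nq J_mat_carrier[of q L] in \<open>auto simp: n_def q_def\<close>)
    have y: "- (C *\<^sub>v x) @\<^sub>v - (R *\<^sub>v x) \<in> carrier_vec q"
      using Cx append_carrier_vec[of "- (C *\<^sub>v x)" m "- (R *\<^sub>v x)" p] by (simp add: q_def add.commute)
    have Sc: "?S *\<^sub>v x \<in> carrier_vec (n + q)" using S x by auto
    have "qf ?X (?S *\<^sub>v x) = qf \<Psi> (?A *\<^sub>v x)"
      unfolding Sx split
      using qf_four_block[OF zero_carrier_mat[of q q] zero_carrier_mat[of n q] \<Psi>c, of ?h "?A *\<^sub>v x"] A by simp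
    moreover have "qf ?Y (?S *\<^sub>v x) = qf \<Psi> x"
      unfolding Sx
      using qf_four_block[OF \<Psi>c zero_carrier_mat[of q n] zero_carrier_mat[of q q] x y] x y by simp
    moreover have "qf (transpose_mat ?S * (?X - ?Y) * ?S) x = qf ?X (?S *\<^sub>v x) - qf ?Y (?S *\<^sub>v x)"
      using qf_congruence[OF _ S x, of "?X - ?Y"] qf_minus[OF _ _ Sc, of ?X ?Y] X Y XY by (simp add: sym_mat_def)
    ultimately show ?thesis by simp
  qed
  show ?thesis
    unfolding Let_def neg_def_def using sym_congruence[OF XY S] val by simp
qed

section \<open>The linear matrix inequality as a quadratic form\<close>

lemma last_block_carrier: "last_block m p L \<in> carrier_mat p ((p + m) * L)"
  by (simp add: last_block_def)

lemma last_block_transpose_mult: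
  assumes L: "0 < L" and w: "w \<in> carrier_vec p"
  shows "transpose_mat (last_block m p L) *\<^sub>v w = 0\<^sub>v ((p + m) * (L - 1)) @\<^sub>v 0\<^sub>v m @\<^sub>v (- w)"
proof (rule eq_vecI)
  let ?k = "(p + m) * (L - 1) + m"
  have n: "(p + m) * L = ?k + p" using block_dim[OF L, of p m] by simp
  fix j assume "j < dim_vec (0\<^sub>v ((p + m) * (L - 1)) @\<^sub>v 0\<^sub>v m @\<^sub>v (- w))"
  hence j: "j < ?k + p" using w by simp
  have "(transpose_mat (last_block m p L) *\<^sub>v w) $ j = (\<Sum>i = 0..<p. (if j = ?k + i then - 1 else 0) * w $ i)"
    using j w by (simp add: last_block_def scalar_prod_def n)
  also have "\<dots> = (\<Sum>i = 0..<p. if i = j - ?k then (if ?k \<le> j then - w $ i else 0) else 0)"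
    by (rule sum.cong) auto
  also have "\<dots> = (if ?k \<le> j then - w $ (j - ?k) else 0)" using j by auto
  also have "\<dots> = (0\<^sub>v ((p + m) * (L - 1)) @\<^sub>v 0\<^sub>v m @\<^sub>v (- w)) $ j" using j w by auto
  finally show "(transpose_mat (last_block m p L) *\<^sub>v w) $ j = (0\<^sub>v ((p + m) * (L - 1)) @\<^sub>v 0\<^sub>v m @\<^sub>v (- w)) $ j" .
qed (use w block_dim[OF L, of p m] in \<open>simp add: last_block_def\<close>)

definition lmi_K :: "nat \<Rightarrow> nat \<Rightarrow> nat \<Rightarrow> real mat \<Rightarrow> real mat \<Rightarrow> real mat" where
  "lmi_K m p L D \<Phi> = (J_mat (p + m) L * \<Phi>) @\<^sub>r D @\<^sub>r (0\<^sub>m p ((p + m) * L))"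

lemma lmi_K_carrier:
  assumes L: "0 < L" and D: "D \<in> carrier_mat m ((p + m) * L)"
    and \<Phi>: "\<Phi> \<in> carrier_mat ((p + m) * L) ((p + m) * L)"
  shows "lmi_K m p L D \<Phi> \<in> carrier_mat ((p + m) * L) ((p + m) * L)"
proof -
  have "J_mat (p + m) L * \<Phi> \<in> carrier_mat ((p + m) * (L - 1)) ((p + m) * L)"
    using J_mat_carrier \<Phi> by (rule mult_carrier_mat)
  from stack_three_carrier[OF this D zero_carrier_mat[of p "(p + m) * L"]] show ?thesis
    using block_dim[OF L] by (simp add: lmi_K_def)
qed

lemma lmi_K_mult:
  assumes D: "D \<in> carrier_mat m ((p + m) * L)" and \<Phi>: "\<Phi> \<in> carrier_mat ((p + m) * L) ((p + m) * L)"
    and x: "x \<in> carrier_vec ((p + m) * L)"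
  shows "lmi_K m p L D \<Phi> *\<^sub>v x = (J_mat (p + m) L *\<^sub>v (\<Phi> *\<^sub>v x)) @\<^sub>v (D *\<^sub>v x) @\<^sub>v 0\<^sub>v p"
proof -
  have J: "J_mat (p + m) L * \<Phi> \<in> carrier_mat ((p + m) * (L - 1)) ((p + m) * L)"
    using J_mat_carrier \<Phi> by (rule mult_carrier_mat)
  show ?thesis
    unfolding lmi_K_def stack_three_mult[OF J D zero_carrier_mat x] assoc_mult_mat_vec[OF J_mat_carrier \<Phi> x]
    using x by simp
qed

text \<open>
  The transpose of \<open>A\<^sub>R = K \<Phi>\<^sup>-\<^sup>1 + e\<^sup>T R\<close>, in which \<open>D \<Phi>\<^sup>-\<^sup>1\<close> contributes the row \<open>- C\<close>.
\<close>

lemma closed_loop_mat_transpose: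
  fixes m p L :: nat
  defines "n \<equiv> (p + m) * L"
  assumes L: "0 < L" and D: "D \<in> carrier_mat m n" and R: "R \<in> carrier_mat p n" and \<Phi>: "pos_def n \<Phi>"
    and x: "x \<in> carrier_vec n"
  shows "transpose_mat (closed_loop_mat m p L (- D * mat_inv \<Phi>) R) *\<^sub>v x =
    mat_inv \<Phi> *\<^sub>v (transpose_mat (lmi_K m p L D \<Phi>) *\<^sub>v x) + transpose_mat R *\<^sub>v (last_block m p L *\<^sub>v x)"
proof -
  let ?V = "mat_inv \<Phi>" and ?K = "lmi_K m p L D \<Phi>" and ?e = "last_block m p L"
  let ?C = "- D * ?V"
  let ?A = "closed_loop_mat m p L ?C R"
  note \<Phi>c = pos_def_carrier[OF \<Phi>]
  note V = mat_inv_pos_def[OF \<Phi>]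
  have C: "?C \<in> carrier_mat m n" using D V by simp
  have A: "?A \<in> carrier_mat n n" using closed_loop_mat_carrier[OF L, of ?C m p R] C R by (simp add: n_def)
  have K: "?K \<in> carrier_mat n n" using lmi_K_carrier[OF L, of D m p \<Phi>] D \<Phi>c by (simp add: n_def)
  have e: "?e \<in> carrier_mat p n" using last_block_carrier by (simp add: n_def)
  have Kx: "transpose_mat ?K *\<^sub>v x \<in> carrier_vec n" and ex: "?e *\<^sub>v x \<in> carrier_vec p"
    using K e x by auto
  have r: "?V *\<^sub>v (transpose_mat ?K *\<^sub>v x) \<in> carrier_vec n" "transpose_mat R *\<^sub>v (?e *\<^sub>v x) \<in> carrier_vec n"
    using V Kx R ex by auto
  show ?thesis
  proof (rule vec_eq_by_scalar_prod[of _ n])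
    show "transpose_mat ?A *\<^sub>v x \<in> carrier_vec n" using A x by auto
    show "?V *\<^sub>v (transpose_mat ?K *\<^sub>v x) + transpose_mat R *\<^sub>v (?e *\<^sub>v x) \<in> carrier_vec n" using r by simp
    fix b :: "real vec" assume b: "b \<in> carrier_vec n"
    have Vb: "?V *\<^sub>v b \<in> carrier_vec n" and Rb: "R *\<^sub>v b \<in> carrier_vec p" using V R b by auto
    have KV: "?K *\<^sub>v (?V *\<^sub>v b) = (J_mat (p + m) L *\<^sub>v b) @\<^sub>v (D *\<^sub>v (?V *\<^sub>v b)) @\<^sub>v 0\<^sub>v p"
      using lmi_K_mult[of D m p L \<Phi> "?V *\<^sub>v b"] D \<Phi>c Vb mat_inv_apply(1)[OF \<Phi> b] by (simp add: n_def)
    have "?C *\<^sub>v b = - (D *\<^sub>v (?V *\<^sub>v b))"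
      using D V b Vb by (simp add: assoc_mult_mat_vec[of _ m n _ n])
    hence "- (?C *\<^sub>v b) = D *\<^sub>v (?V *\<^sub>v b)" by simp
    hence "?A *\<^sub>v b = (J_mat (p + m) L *\<^sub>v b) @\<^sub>v (D *\<^sub>v (?V *\<^sub>v b)) @\<^sub>v (- (R *\<^sub>v b))"
      using closed_loop_mat_mult[of ?C m p L R b] C R b by (simp add: n_def)
    also have "\<dots> = ?K *\<^sub>v (?V *\<^sub>v b) + transpose_mat ?e *\<^sub>v (R *\<^sub>v b)"
      unfolding KV last_block_transpose_mult[OF L Rb]
      using D R J_mat_carrier[of "p + m" L] by (intro eq_vecI) auto
    finally have Ab: "?A *\<^sub>v b = ?K *\<^sub>v (?V *\<^sub>v b) + transpose_mat ?e *\<^sub>v (R *\<^sub>v b)" .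
    have c: "?K *\<^sub>v (?V *\<^sub>v b) \<in> carrier_vec n" "transpose_mat ?e *\<^sub>v (R *\<^sub>v b) \<in> carrier_vec n"
      using K Vb e Rb by auto
    have "b \<bullet> (transpose_mat ?A *\<^sub>v x) = x \<bullet> (?A *\<^sub>v b)"
      using scalar_prod_mult_transpose[OF A x b] by simp
    also have "\<dots> = x \<bullet> (?K *\<^sub>v (?V *\<^sub>v b)) + x \<bullet> (transpose_mat ?e *\<^sub>v (R *\<^sub>v b))"
      unfolding Ab by (rule scalar_prod_add_distrib[OF x c])
    also have "x \<bullet> (?K *\<^sub>v (?V *\<^sub>v b)) = b \<bullet> (?V *\<^sub>v (transpose_mat ?K *\<^sub>v x))"
      using scalar_prod_mult_transpose[OF K x Vb] comm_scalar_prod[OF Vb Kx]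
        sym_mat_swap[OF pos_def_carrier(2)[OF V(4)] Kx b] by simp
    also have "x \<bullet> (transpose_mat ?e *\<^sub>v (R *\<^sub>v b)) = b \<bullet> (transpose_mat R *\<^sub>v (?e *\<^sub>v x))"
      using scalar_prod_mult_transpose[of "transpose_mat ?e" n p x "R *\<^sub>v b"] e x Rb
        comm_scalar_prod[OF Rb ex] scalar_prod_mult_transpose[OF R ex b] by simp
    finally show "b \<bullet> (transpose_mat ?A *\<^sub>v x) = b \<bullet> (?V *\<^sub>v (transpose_mat ?K *\<^sub>v x) + transpose_mat R *\<^sub>v (?e *\<^sub>v x))"
      by (simp add: scalar_prod_add_distrib[OF b r])
  qed
qed

text \<open>
  The linear matrix inequality is split into the part that depends on the unknowns and the part
  given by the data, in order to apply the S-lemma to the two.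
\<close>

definition lmi_lead :: "nat \<Rightarrow> nat \<Rightarrow> nat \<Rightarrow> real mat \<Rightarrow> real mat \<Rightarrow> real mat" where
  "lmi_lead m p L D \<Phi> = (let n = (p + m) * L; K = lmi_K m p L D \<Phi> in
     four_block_mat (four_block_mat \<Phi> (- K) (- transpose_mat K) (- \<Phi>))
       (K @\<^sub>r 0\<^sub>m n n) (transpose_mat (K @\<^sub>r 0\<^sub>m n n)) \<Phi>)"

definition lmi_data :: "nat \<Rightarrow> nat \<Rightarrow> nat \<Rightarrow> nat \<Rightarrow> real mat \<Rightarrow> (nat \<Rightarrow> real vec) \<Rightarrow> (nat \<Rightarrow> real vec) \<Rightarrow> real mat" where
  "lmi_data m p L T Pm u y = (let n = (p + m) * L in
     four_block_mat (data_mat_bar m p L T Pm u y) (0\<^sub>m (2 * n) n) (0\<^sub>m n (2 * n)) (0\<^sub>m n n))"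

lemma lmi_mat_split: "lmi_mat m p L T Pm u y D \<Phi> = lmi_lead m p L D \<Phi> - lmi_data m p L T Pm u y"
  by (simp add: lmi_mat_def lmi_lead_def lmi_data_def lmi_K_def Let_def)

lemma lmi_lead_sym:
  fixes m p L :: nat
  defines "n \<equiv> (p + m) * L"
  assumes L: "0 < L" and D: "D \<in> carrier_mat m n" and \<Phi>: "sym_mat n \<Phi>"
  shows "sym_mat (n + n + n) (lmi_lead m p L D \<Phi>)"
proof -
  let ?K = "lmi_K m p L D \<Phi>"
  have K: "?K \<in> carrier_mat n n" using lmi_K_carrier[OF L, of D m p \<Phi>] D \<Phi> by (simp add: n_def sym_mat_def)
  have "sym_mat (n + n) (four_block_mat \<Phi> (- ?K) (- transpose_mat ?K) (- \<Phi>))"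
    using sym_four_block[OF \<Phi> _ sym_uminus[OF \<Phi>], of "- transpose_mat ?K"] K by (simp add: transpose_uminus)
  moreover have "transpose_mat (?K @\<^sub>r 0\<^sub>m n n) \<in> carrier_mat n (n + n)"
    using carrier_append_rows[OF K zero_carrier_mat[of n n]] by simp
  ultimately show ?thesis
    using sym_four_block[OF _ _ \<Phi>, of "n + n" _ "transpose_mat (?K @\<^sub>r 0\<^sub>m n n)"]
    by (simp add: lmi_lead_def Let_def n_def)
qed

lemma lmi_lead_qf:
  fixes m p L :: nat
  defines "n \<equiv> (p + m) * L"
  assumes L: "0 < L" and D: "D \<in> carrier_mat m n" and \<Phi>: "sym_mat n \<Phi>"
    and v: "x \<in> carrier_vec n" "z \<in> carrier_vec n" "w \<in> carrier_vec n"
  defines "K \<equiv> lmi_K m p L D \<Phi>"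
  shows "qf (lmi_lead m p L D \<Phi>) ((x @\<^sub>v z) @\<^sub>v w) =
    qf \<Phi> x - qf \<Phi> z + qf \<Phi> w - 2 * (x \<bullet> (K *\<^sub>v z)) + 2 * (x \<bullet> (K *\<^sub>v w))"
proof -
  have \<Phi>c: "\<Phi> \<in> carrier_mat n n" using \<Phi> by (simp add: sym_mat_def)
  have K: "K \<in> carrier_mat n n" using lmi_K_carrier[OF L, of D m p \<Phi>] D \<Phi>c by (simp add: n_def K_def)
  let ?A = "four_block_mat \<Phi> (- K) (- transpose_mat K) (- \<Phi>)"
  let ?B = "K @\<^sub>r 0\<^sub>m n n"
  have B: "?B \<in> carrier_mat (n + n) n" using carrier_append_rows[OF K zero_carrier_mat[of n n]] .
  have xz: "x @\<^sub>v z \<in> carrier_vec (n + n)" using v by simp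
  have A: "?A \<in> carrier_mat (n + n) (n + n)" using \<Phi>c by (intro four_block_carrier_mat) auto
  have Kt: "- transpose_mat K \<in> carrier_mat n n" using K by simp
  have Kx: "transpose_mat K *\<^sub>v x \<in> carrier_vec n" using K v by auto
  have "qf ?A (x @\<^sub>v z) = qf \<Phi> x + 2 * (z \<bullet> (- transpose_mat K *\<^sub>v x)) + qf (- \<Phi>) z"
    using qf_four_block[OF \<Phi>c Kt _ v(1,2), of "- \<Phi>"] \<Phi>c by (simp add: transpose_uminus)
  also have "\<dots> = qf \<Phi> x - 2 * (x \<bullet> (K *\<^sub>v z)) - qf \<Phi> z"
    using scalar_prod_mult_transpose[OF K v(1,2)] Kx v K qf_uminus[OF \<Phi>c v(2)] by simp
  finally have qA: "qf ?A (x @\<^sub>v z) = qf \<Phi> x - 2 * (x \<bullet> (K *\<^sub>v z)) - qf \<Phi> z" .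
  have Kw: "K *\<^sub>v w \<in> carrier_vec n" using K v by auto
  have "w \<bullet> (transpose_mat ?B *\<^sub>v (x @\<^sub>v z)) = (x @\<^sub>v z) \<bullet> (?B *\<^sub>v w)"
    using scalar_prod_mult_transpose[OF B xz v(3)] by simp
  also have "\<dots> = x \<bullet> (K *\<^sub>v w)"
    unfolding mat_mult_append[OF K zero_carrier_mat v(3)]
    using scalar_prod_append[OF v(1,2) Kw zero_carrier_vec] v by simp
  finally have qB: "w \<bullet> (transpose_mat ?B *\<^sub>v (x @\<^sub>v z)) = x \<bullet> (K *\<^sub>v w)" .
  have "qf (lmi_lead m p L D \<Phi>) ((x @\<^sub>v z) @\<^sub>v w) = qf ?A (x @\<^sub>v z) + 2 * (x \<bullet> (K *\<^sub>v w)) + qf \<Phi> w"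
    unfolding qB[symmetric]
    using qf_four_block[OF A _ \<Phi>c xz v(3), of "transpose_mat ?B"] B
    by (simp add: lmi_lead_def Let_def n_def K_def)
  thus ?thesis using qA by simp
qed

text \<open>
  The cross terms \<open>x \<bullet> K z\<close> and \<open>x \<bullet> K w\<close> equal \<open>k \<bullet> \<Phi> z\<close> and \<open>k \<bullet> \<Phi> w\<close>, so they are absorbed by two
  squares whose common remainder \<open>\<Phi>(k)\<close> cancels.
\<close>

lemma lmi_lead_qf_squares:
  fixes m p L :: nat
  defines "n \<equiv> (p + m) * L"
  assumes L: "0 < L" and D: "D \<in> carrier_mat m n" and \<Phi>: "pos_def n \<Phi>"
    and v: "x \<in> carrier_vec n" "z \<in> carrier_vec n" "w \<in> carrier_vec n"
  defines "k \<equiv> mat_inv \<Phi> *\<^sub>v (transpose_mat (lmi_K m p L D \<Phi>) *\<^sub>v x)"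
  shows "qf (lmi_lead m p L D \<Phi>) ((x @\<^sub>v z) @\<^sub>v w) = qf \<Phi> x - qf \<Phi> (k + z) + qf \<Phi> (k + w)"
proof -
  let ?K = "lmi_K m p L D \<Phi>"
  note \<Phi>c = pos_def_carrier[OF \<Phi>]
  have K: "?K \<in> carrier_mat n n" using lmi_K_carrier[OF L, of D m p \<Phi>] D \<Phi>c by (simp add: n_def)
  have Kx: "transpose_mat ?K *\<^sub>v x \<in> carrier_vec n" using K v by auto
  have k: "k \<in> carrier_vec n" using mat_inv_pos_def(1)[OF \<Phi>] Kx by (auto simp: k_def)
  have cross: "k \<bullet> (\<Phi> *\<^sub>v b) = x \<bullet> (?K *\<^sub>v b)" if b: "b \<in> carrier_vec n" for b
    using sym_mat_swap[OF \<Phi>c(2) k b] mat_inv_apply(1)[OF \<Phi> Kx] scalar_prod_mult_transpose[OF K v(1) b]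
    by (simp add: k_def)
  show ?thesis
    using lmi_lead_qf[OF L, of D m p \<Phi> x z w] D \<Phi>c v qf_add_sym[OF \<Phi>c(2) k v(2)] qf_add_sym[OF \<Phi>c(2) k v(3)]
      cross[OF v(2)] cross[OF v(3)]
    by (simp add: n_def)
qed

lemma lmi_lead_qf_scale:
  fixes m p L :: nat
  defines "n \<equiv> (p + m) * L"
  assumes L: "0 < L" and D: "D \<in> carrier_mat m n" and \<Phi>: "sym_mat n \<Phi>"
    and v: "x \<in> carrier_vec n" "z \<in> carrier_vec n" "w \<in> carrier_vec n"
  shows "qf (lmi_lead m p L (c \<cdot>\<^sub>m D) (c \<cdot>\<^sub>m \<Phi>)) ((x @\<^sub>v z) @\<^sub>v w) = c * qf (lmi_lead m p L D \<Phi>) ((x @\<^sub>v z) @\<^sub>v w)"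
proof -
  have \<Phi>c: "\<Phi> \<in> carrier_mat n n" using \<Phi> by (simp add: sym_mat_def)
  have c\<Phi>: "sym_mat n (c \<cdot>\<^sub>m \<Phi>)" proof -
    have "transpose_mat (c \<cdot>\<^sub>m \<Phi>) = c \<cdot>\<^sub>m transpose_mat \<Phi>" by (intro eq_matI) auto
    thus ?thesis using \<Phi> by (simp add: sym_mat_def)
  qed
  have cD: "c \<cdot>\<^sub>m D \<in> carrier_mat m n" using D by simp
  have K: "lmi_K m p L (c \<cdot>\<^sub>m D) (c \<cdot>\<^sub>m \<Phi>) *\<^sub>v b = c \<cdot>\<^sub>v (lmi_K m p L D \<Phi> *\<^sub>v b)" if b: "b \<in> carrier_vec n" for b
  proof -
    have \<Phi>b: "\<Phi> *\<^sub>v b \<in> carrier_vec n" using \<Phi>c b by auto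
    have J: "J_mat (p + m) L *\<^sub>v (c \<cdot>\<^sub>v (\<Phi> *\<^sub>v b)) = c \<cdot>\<^sub>v (J_mat (p + m) L *\<^sub>v (\<Phi> *\<^sub>v b))"
      using mult_mat_vec[OF J_mat_carrier[of "p + m" L]] \<Phi>b by (simp add: n_def)
    have "lmi_K m p L (c \<cdot>\<^sub>m D) (c \<cdot>\<^sub>m \<Phi>) *\<^sub>v b =
      (c \<cdot>\<^sub>v (J_mat (p + m) L *\<^sub>v (\<Phi> *\<^sub>v b))) @\<^sub>v (c \<cdot>\<^sub>v (D *\<^sub>v b)) @\<^sub>v 0\<^sub>v p"
      using lmi_K_mult[of "c \<cdot>\<^sub>m D" m p L "c \<cdot>\<^sub>m \<Phi>" b] D \<Phi>c b J
      by (simp add: n_def smult_mat_mult_vec[OF D[unfolded n_def]] smult_mat_mult_vec[OF \<Phi>c[unfolded n_def]])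
    also have "\<dots> = c \<cdot>\<^sub>v (lmi_K m p L D \<Phi> *\<^sub>v b)"
      using lmi_K_mult[of D m p L \<Phi> b] D \<Phi>c b by (intro eq_vecI) (auto simp: n_def)
    finally show ?thesis .
  qed
  have Kc: "lmi_K m p L D \<Phi> \<in> carrier_mat n n" using lmi_K_carrier[OF L, of D m p \<Phi>] D \<Phi>c by (simp add: n_def)
  have Kz: "lmi_K m p L D \<Phi> *\<^sub>v z \<in> carrier_vec n" "lmi_K m p L D \<Phi> *\<^sub>v w \<in> carrier_vec n" using Kc v by auto
  have c\<Phi>': "qf (c \<cdot>\<^sub>m \<Phi>) b = c * qf \<Phi> b" if "b \<in> carrier_vec n" for b
    using smult_mat_mult_vec[OF \<Phi>c that] \<Phi>c that by simp
  show ?thesis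
    unfolding lmi_lead_qf[of L _ m p, folded n_def, OF L cD c\<Phi> v] lmi_lead_qf[of L _ m p, folded n_def, OF L D \<Phi> v]
      K[OF v(2)] K[OF v(3)] c\<Phi>'[OF v(1)] c\<Phi>'[OF v(2)] c\<Phi>'[OF v(3)]
    using v Kz by (simp add: algebra_simps)
qed

lemma lmi_data_sym_qf:
  fixes m p L T :: nat
  defines "n \<equiv> (p + m) * L"
  assumes "sym_mat (p + n) (data_mat m p L T Pm u y)"
  shows "sym_mat (n + n + n) (lmi_data m p L T Pm u y)"
    and "x \<in> carrier_vec n \<Longrightarrow> z \<in> carrier_vec n \<Longrightarrow> w \<in> carrier_vec n \<Longrightarrow>
      qf (lmi_data m p L T Pm u y) ((x @\<^sub>v z) @\<^sub>v w) =
      qf (data_mat m p L T Pm u y) ((last_block m p L *\<^sub>v x) @\<^sub>v z)"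
proof -
  let ?N = "data_mat m p L T Pm u y" and ?e = "last_block m p L"
  let ?E = "four_block_mat ?e (0\<^sub>m p n) (0\<^sub>m n n) (1\<^sub>m n)"
  have e: "?e \<in> carrier_mat p n" using last_block_carrier by (simp add: n_def)
  have E: "?E \<in> carrier_mat (p + n) (n + n)" by (rule four_block_carrier_mat[OF e one_carrier_mat])
  have Nc: "?N \<in> carrier_mat (p + n) (p + n)" using assms(2) by (simp add: sym_mat_def)
  have bar: "data_mat_bar m p L T Pm u y = transpose_mat ?E * ?N * ?E"
    by (simp add: data_mat_bar_def Let_def n_def)
  have bar_sym: "sym_mat (n + n) (data_mat_bar m p L T Pm u y)"
    unfolding bar by (rule sym_congruence[OF assms(2) E])
  have z0: "sym_mat n (0\<^sub>m n n)" by (simp add: sym_mat_def)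
  have eq: "lmi_data m p L T Pm u y = four_block_mat (data_mat_bar m p L T Pm u y)
     (transpose_mat (0\<^sub>m n (n + n))) (0\<^sub>m n (n + n)) (0\<^sub>m n n)"
    by (simp add: lmi_data_def Let_def n_def mult_2)
  show "sym_mat (n + n + n) (lmi_data m p L T Pm u y)"
    unfolding eq by (rule sym_four_block[OF bar_sym _ z0]) simp
  assume v: "x \<in> carrier_vec n" "z \<in> carrier_vec n" "w \<in> carrier_vec n"
  have xz: "x @\<^sub>v z \<in> carrier_vec (n + n)" using v by simp
  have barc: "data_mat_bar m p L T Pm u y \<in> carrier_mat (n + n) (n + n)" using bar_sym by (simp add: sym_mat_def)
  have "?e *\<^sub>v x \<in> carrier_vec p" using e v by auto
  hence "?E *\<^sub>v (x @\<^sub>v z) = (?e *\<^sub>v x) @\<^sub>v z"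
    using four_block_mat_mult_vec[OF e zero_carrier_mat[of p n] zero_carrier_mat[of n n] one_carrier_mat v(1,2)] v by simp
  hence "qf (data_mat_bar m p L T Pm u y) (x @\<^sub>v z) = qf ?N ((?e *\<^sub>v x) @\<^sub>v z)"
    unfolding bar using qf_congruence[OF Nc E xz] by simp
  thus "qf (lmi_data m p L T Pm u y) ((x @\<^sub>v z) @\<^sub>v w) = qf ?N ((?e *\<^sub>v x) @\<^sub>v z)"
    unfolding eq using qf_four_block[OF barc zero_carrier_mat[of n "n + n"] zero_carrier_mat[of n n] xz v(3)] v xz
    by simp
qed

section \<open>Quadratic stabilization and the linear matrix inequality\<close>

text \<open>
  The form of the linear matrix inequality is evaluated at \<open>z = R\<^sup>T e x\<close> and at the minimizing
  \<open>w = - \<Phi>\<^sup>-\<^sup>1 K\<^sup>T x\<close>.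
\<close>

lemma lmi_contraction:
  fixes m p L T :: nat
  defines "n \<equiv> (p + m) * L"
  assumes L: "0 < L" and N: "sym_mat (p + n) (data_mat m p L T Pm u y)"
    and lmi: "lmi_solution m p L T Pm u y D \<Phi>" and comp: "compatible m p L T Pm u y R"
    and x: "x \<in> carrier_vec n" "x \<noteq> 0\<^sub>v n"
  shows "qf (mat_inv \<Phi>) (closed_loop_mat m p L (- D * mat_inv \<Phi>) R *\<^sub>v x) < qf (mat_inv \<Phi>) x"
proof -
  let ?N = "data_mat m p L T Pm u y" and ?e = "last_block m p L"
  have D: "D \<in> carrier_mat m n" and \<Phi>: "pos_def n \<Phi>" and M: "pos_def (3 * n) (lmi_mat m p L T Pm u y D \<Phi>)"
    using lmi by (auto simp: lmi_solution_def n_def)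
  have R: "R \<in> carrier_mat p n" and qmi: "qmi p ?N R" using comp by (auto simp: compatible_def n_def)
  note \<Phi>c = pos_def_carrier[OF \<Phi>] and V = mat_inv_pos_def[OF \<Phi>]
  have C: "- D * mat_inv \<Phi> \<in> carrier_mat m n" using D V by simp
  let ?A = "closed_loop_mat m p L (- D * mat_inv \<Phi>) R"
  have A: "?A \<in> carrier_mat n n" using closed_loop_mat_carrier[OF L, of _ m p R] C R by (simp add: n_def)
  have K: "lmi_K m p L D \<Phi> \<in> carrier_mat n n" using lmi_K_carrier[OF L, of D m p \<Phi>] D \<Phi>c by (simp add: n_def)
  have n3: "3 * n = n + n + n" by simp
  have lead: "lmi_lead m p L D \<Phi> \<in> carrier_mat (n + n + n) (n + n + n)"
    using lmi_lead_sym[of L D m p \<Phi>, folded n_def, OF L D \<Phi>c(2)] by (simp add: sym_mat_def)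
  have data: "lmi_data m p L T Pm u y \<in> carrier_mat (n + n + n) (n + n + n)"
    using lmi_data_sym_qf(1)[of p m L T Pm u y, folded n_def, OF N] by (simp add: sym_mat_def)
  have dual: "qf \<Phi> (transpose_mat ?A *\<^sub>v x) < qf \<Phi> x" if x: "x \<in> carrier_vec n" "x \<noteq> 0\<^sub>v n" for x
  proof -
    have ex: "?e *\<^sub>v x \<in> carrier_vec p" using last_block_carrier[of m p L] x by (auto simp: n_def)
    define k where "k = mat_inv \<Phi> *\<^sub>v (transpose_mat (lmi_K m p L D \<Phi>) *\<^sub>v x)"
    define z where "z = transpose_mat R *\<^sub>v (?e *\<^sub>v x)"
    have Kx: "transpose_mat (lmi_K m p L D \<Phi>) *\<^sub>v x \<in> carrier_vec n" using K x by auto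
    have k: "k \<in> carrier_vec n" using V Kx by (auto simp: k_def)
    have z: "z \<in> carrier_vec n" using R ex by (auto simp: z_def)
    let ?v = "(x @\<^sub>v z) @\<^sub>v (- k)"
    have v: "?v \<in> carrier_vec (n + n + n)" using x z k by simp
    have "?v \<noteq> 0\<^sub>v (n + n + n)"
    proof
      assume v0: "?v = 0\<^sub>v (n + n + n)"
      have "x $ i = 0" if "i < n" for i
        using arg_cong[OF v0, of "\<lambda>v. v $ i"] that x z k by simp
      thus False using x by (auto intro!: eq_vecI)
    qed
    hence "0 < qf (lmi_mat m p L T Pm u y D \<Phi>) ?v" using M v unfolding pos_def_def n3 by blast
    also have "\<dots> = qf (lmi_lead m p L D \<Phi>) ?v - qf (lmi_data m p L T Pm u y) ?v"
      unfolding lmi_mat_split by (rule qf_minus[OF lead data v])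
    also have "\<dots> = qf \<Phi> x - qf \<Phi> (k + z) + qf \<Phi> (k + - k) - qf ?N ((?e *\<^sub>v x) @\<^sub>v z)"
      using lmi_lead_qf_squares[of L D m p \<Phi> x z "- k", folded n_def, OF L D \<Phi> x(1) z]
        lmi_data_sym_qf(2)[of p m L T Pm u y x z "- k", folded n_def, OF N x(1) z] k
      by (simp add: k_def)
    also have "k + - k = 0\<^sub>v n" using k by simp
    also have "qf \<Phi> (0\<^sub>v n) = 0" using mult_mat_vec_carrier[OF \<Phi>c(1) zero_carrier_vec] by simp
    finally have "qf ?N ((?e *\<^sub>v x) @\<^sub>v z) < qf \<Phi> x - qf \<Phi> (k + z)" by simp
    moreover have "0 \<le> qf ?N ((?e *\<^sub>v x) @\<^sub>v z)" using qmi qmi_iff[OF N R] ex unfolding z_def by blast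
    moreover have "transpose_mat ?A *\<^sub>v x = k + z"
      unfolding k_def z_def by (rule closed_loop_mat_transpose[of L D m p R \<Phi> x, folded n_def, OF L D R \<Phi> x(1)])
    ultimately show ?thesis by simp
  qed
  show ?thesis
    using dual_contraction[OF \<Phi> transpose_carrier_mat[THEN iffD2, OF A] dual x] by simp
qed

text \<open>
  The hypothesis of the S-lemma is checked on the whole \<open>3 n\<close>-dimensional matrices: where the data form
  \<open>N(e x, z)\<close> is nonnegative, either \<open>e x \<noteq> 0\<close> and a compatible \<open>R\<close> interpolates \<open>(e x, z)\<close>, or
  \<open>e x = 0\<close>, which forces \<open>z = 0 = R\<^sup>T e x\<close> for every compatible \<open>R\<close>.
\<close>

lemma quad_stab_imp_lmi:
  fixes m p L T :: nat
  defines "n \<equiv> (p + m) * L"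
  assumes L: "0 < L" and p: "0 < p" and N: "sym_mat (p + n) (data_mat m p L T Pm u y)"
    and neg: "\<And>z. z \<in> carrier_vec n \<Longrightarrow> z \<noteq> 0\<^sub>v n \<Longrightarrow> qf (data_mat m p L T Pm u y) (0\<^sub>v p @\<^sub>v z) < 0"
    and R0: "compatible m p L T Pm u y R0"
    and C: "C \<in> carrier_mat m n" and \<Psi>: "pos_semidef n \<Psi>"
    and contr: "\<And>R x. compatible m p L T Pm u y R \<Longrightarrow> x \<in> carrier_vec n \<Longrightarrow> x \<noteq> 0\<^sub>v n \<Longrightarrow>
      qf \<Psi> (closed_loop_mat m p L C R *\<^sub>v x) < qf \<Psi> x"
  shows "\<exists>D \<Phi>. lmi_solution m p L T Pm u y D \<Phi>"
proof -
  let ?N = "data_mat m p L T Pm u y" and ?e = "last_block m p L"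
  have comp: "compatible m p L T Pm u y R \<longleftrightarrow> R \<in> carrier_mat p n \<and> qmi p ?N R" for R
    by (simp add: compatible_def n_def)
  have A: "closed_loop_mat m p L C R \<in> carrier_mat n n" if "compatible m p L T Pm u y R" for R
    using closed_loop_mat_carrier[OF L, of C m p R] C that comp by (simp add: n_def)
  have \<Psi>pd: "pos_def n \<Psi>"
    unfolding pos_def_def
  proof (intro conjI ballI impI)
    show "sym_mat n \<Psi>" using \<Psi> by (simp add: pos_semidef_def)
    fix x :: "real vec" assume x: "x \<in> carrier_vec n" "x \<noteq> 0\<^sub>v n"
    have "0 \<le> qf \<Psi> (closed_loop_mat m p L C R0 *\<^sub>v x)"
      using \<Psi> mult_mat_vec_carrier[OF A[OF R0] x(1)] by (simp add: pos_semidef_def)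
    thus "0 < qf \<Psi> x" using contr[OF R0 x] by simp
  qed
  define \<Phi> where "\<Phi> = mat_inv \<Psi>"
  note V = mat_inv_pos_def[OF \<Psi>pd, folded \<Phi>_def]
  have inv\<Phi>: "mat_inv \<Phi> = \<Psi>" unfolding \<Phi>_def by (rule mat_inv_mat_inv[OF \<Psi>pd])
  note \<Phi> = V(4) and \<Phi>c = pos_def_carrier[OF V(4)] and \<Psi>c = pos_def_carrier[OF \<Psi>pd]
  define D where "D = - (C * \<Phi>)"
  have D: "D \<in> carrier_mat m n" using C V by (simp add: D_def)
  have "- D * mat_inv \<Phi> = C * (\<Phi> * \<Psi>)" unfolding inv\<Phi> D_def using C V(1) \<Psi>c by simp
  hence DC: "- D * mat_inv \<Phi> = C" using V C by simp
  define k where "k x = mat_inv \<Phi> *\<^sub>v (transpose_mat (lmi_K m p L D \<Phi>) *\<^sub>v x)" for x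
  have K: "lmi_K m p L D \<Phi> \<in> carrier_mat n n" using lmi_K_carrier[OF L, of D m p \<Phi>] D \<Phi>c by (simp add: n_def)
  have k: "k x \<in> carrier_vec n" if "x \<in> carrier_vec n" for x
  proof -
    have "transpose_mat (lmi_K m p L D \<Phi>) *\<^sub>v x \<in> carrier_vec n" using K that by auto
    thus ?thesis unfolding k_def inv\<Phi> using \<Psi>c by auto
  qed
  have dual: "qf \<Phi> (k x + transpose_mat R *\<^sub>v (?e *\<^sub>v x)) < qf \<Phi> x"
    if R: "compatible m p L T Pm u y R" and x: "x \<in> carrier_vec n" "x \<noteq> 0\<^sub>v n" for R x
  proof -
    have "transpose_mat (closed_loop_mat m p L C R) *\<^sub>v x = k x + transpose_mat R *\<^sub>v (?e *\<^sub>v x)"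
      using closed_loop_mat_transpose[of L D m p R \<Phi> x, folded n_def, OF L D _ \<Phi> x(1)] R comp
      unfolding DC k_def by blast
    thus ?thesis using dual_contraction[OF \<Psi>pd A[OF R] contr[OF R] x] by (simp add: \<Phi>_def)
  qed
  have ex: "?e *\<^sub>v x \<in> carrier_vec p" if "x \<in> carrier_vec n" for x
    using last_block_carrier[of m p L] that by (auto simp: n_def)
  have main: "0 < qf \<Phi> x - qf \<Phi> (k x + z)"
    if x: "x \<in> carrier_vec n" and z: "z \<in> carrier_vec n" and nz: "x \<noteq> 0\<^sub>v n \<or> z \<noteq> 0\<^sub>v n"
      and nonneg: "0 \<le> qf ?N ((?e *\<^sub>v x) @\<^sub>v z)" for x z
  proof (cases "?e *\<^sub>v x = 0\<^sub>v p")
    case True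
    hence z0: "z = 0\<^sub>v n" using neg[OF z] nonneg by force
    have "R0 \<in> carrier_mat p n" using R0 comp by simp
    hence "transpose_mat R0 *\<^sub>v (?e *\<^sub>v x) = z" unfolding True z0 by auto
    thus ?thesis using dual[OF R0 x] nz z0 by auto
  next
    case False
    have "x \<noteq> 0\<^sub>v n"
    proof
      assume "x = 0\<^sub>v n"
      hence "?e *\<^sub>v x = 0\<^sub>v p" using last_block_carrier[of m p L] by (auto simp: n_def)
      thus False using False by simp
    qed
    moreover obtain R where "R \<in> carrier_mat p n" "qmi p ?N R" "transpose_mat R *\<^sub>v (?e *\<^sub>v x) = z"
      using qmi_interpolation[OF N neg _ _ ex[OF x] False z nonneg] R0 comp by blast
    ultimately show ?thesis using dual[of R x] x comp by auto
  qed
  have lead: "lmi_lead m p L D \<Phi> \<in> carrier_mat (n + n + n) (n + n + n)"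
    using lmi_lead_sym[of L D m p \<Phi>, folded n_def, OF L D \<Phi>c(2)] by (simp add: sym_mat_def)
  note data_sym = lmi_data_sym_qf(1)[of p m L T Pm u y, folded n_def, OF N]
  note data_qf = lmi_data_sym_qf(2)[of p m L T Pm u y, folded n_def, OF N]
  note lead_qf = lmi_lead_qf_squares[of L D m p \<Phi>, folded n_def, OF L D \<Phi>, folded k_def]
  have data: "lmi_data m p L T Pm u y \<in> carrier_mat (n + n + n) (n + n + n)"
    using data_sym by (simp add: sym_mat_def)
  have split: "\<exists>x z w. x \<in> carrier_vec n \<and> z \<in> carrier_vec n \<and> w \<in> carrier_vec n \<and> v = (x @\<^sub>v z) @\<^sub>v w"
    if "v \<in> carrier_vec (n + n + n)" for v :: "real vec"
  proof -
    have "v = vec_first v (n + n) @\<^sub>v vec_last v n" using vec_first_last_append[OF that] by simp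
    moreover have "vec_first v (n + n) = vec_first (vec_first v (n + n)) n @\<^sub>v vec_last (vec_first v (n + n)) n"
      using vec_first_last_append[of "vec_first v (n + n)" n n] by simp
    ultimately show ?thesis using vec_first_carrier vec_last_carrier by metis
  qed
  have \<Phi>0: "0 \<le> qf \<Phi> x" if "x \<in> carrier_vec n" for x
    using pos_def_imp_psd[OF \<Phi>] that by (simp add: pos_semidef_def)
  have zero3: "(0\<^sub>v n @\<^sub>v 0\<^sub>v n) @\<^sub>v 0\<^sub>v n = (0\<^sub>v (n + n + n) :: real vec)" by (intro eq_vecI) auto
  have \<Phi>zero: "qf \<Phi> (0\<^sub>v n) = 0" using mult_mat_vec_carrier[OF \<Phi>c(1) zero_carrier_vec] by simp
  have k0: "k (0\<^sub>v n) = 0\<^sub>v n"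
  proof -
    have "transpose_mat (lmi_K m p L D \<Phi>) *\<^sub>v 0\<^sub>v n = 0\<^sub>v n" "\<Psi> *\<^sub>v 0\<^sub>v n = 0\<^sub>v n" using K \<Psi>c by auto
    thus ?thesis by (simp add: k_def inv\<Phi>)
  qed
  have "0 < qf (lmi_lead m p L D \<Phi>) v"
    if v: "v \<in> carrier_vec (n + n + n)" "v \<noteq> 0\<^sub>v (n + n + n)" and nonneg: "0 \<le> qf (lmi_data m p L T Pm u y) v" for v
  proof -
    obtain x z w where xzw: "x \<in> carrier_vec n" "z \<in> carrier_vec n" "w \<in> carrier_vec n" and v_eq: "v = (x @\<^sub>v z) @\<^sub>v w"
      using split[OF v(1)] by blast
    have e: "qf (lmi_lead m p L D \<Phi>) v = qf \<Phi> x - qf \<Phi> (k x + z) + qf \<Phi> (k x + w)"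
      unfolding v_eq by (rule lead_qf[OF xzw])
    have Nn: "0 \<le> qf ?N ((?e *\<^sub>v x) @\<^sub>v z)" using nonneg data_qf[OF xzw] by (simp add: v_eq)
    show ?thesis
    proof (cases "x = 0\<^sub>v n \<and> z = 0\<^sub>v n")
      case True
      hence "w \<noteq> 0\<^sub>v n" using v(2) zero3 by (auto simp: v_eq)
      hence "0 < qf \<Phi> w" using \<Phi> xzw by (simp add: pos_def_def)
      thus ?thesis unfolding e using True k0 xzw \<Phi>zero by simp
    next
      case False
      hence "0 < qf \<Phi> x - qf \<Phi> (k x + z)" using main[OF xzw(1,2) _ Nn] by blast
      thus ?thesis unfolding e using \<Phi>0[of "k x + w"] k[OF xzw(1)] xzw by simp
    qed
  qed
  then obtain \<alpha> where \<alpha>: "0 \<le> \<alpha>" and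
    S: "\<And>v. v \<in> carrier_vec (n + n + n) \<Longrightarrow> v \<noteq> 0\<^sub>v (n + n + n) \<Longrightarrow>
      \<alpha> * qf (lmi_data m p L T Pm u y) v < qf (lmi_lead m p L D \<Phi>) v"
    using strict_S_lemma[OF lead data] by metis
  \<comment> \<open>At \<open>(0, z, 0)\<close> the leading form is \<open>- \<Phi>(z) < 0\<close>, which a vanishing multiplier could not repair.\<close>
  have "\<alpha> \<noteq> 0"
  proof
    assume \<alpha>0: "\<alpha> = 0"
    have n: "0 < n" using L p by (simp add: n_def)
    let ?z = "unit_vec n 0 :: real vec"
    have z: "?z \<in> carrier_vec n" by simp
    have z_nz: "?z \<noteq> 0\<^sub>v n" using n by (metis index_unit_vec(1) index_zero_vec(1) zero_neq_one)
    let ?v = "(0\<^sub>v n @\<^sub>v ?z) @\<^sub>v 0\<^sub>v n :: real vec"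
    have "?v $ n = 1" using n by simp
    moreover have "(0\<^sub>v (n + n + n) :: real vec) $ n = 0" using n by simp
    ultimately have v: "?v \<noteq> 0\<^sub>v (n + n + n)" by (metis zero_neq_one)
    have "0 < qf (lmi_lead m p L D \<Phi>) ?v" using S[of ?v] v \<alpha>0 by simp
    also have "\<dots> = - qf \<Phi> ?z"
      using lead_qf[OF zero_carrier_vec z zero_carrier_vec] k0 \<Phi>zero by simp
    finally show False using \<Phi>0[OF z] by simp
  qed
  hence \<alpha>: "0 < \<alpha>" using \<alpha> by simp
  let ?c = "1 / \<alpha>"
  let ?\<Phi> = "?c \<cdot>\<^sub>m \<Phi>" and ?D = "?c \<cdot>\<^sub>m D"
  have D': "?D \<in> carrier_mat m n" using D by simp
  have \<Phi>': "pos_def n ?\<Phi>"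
    unfolding pos_def_def
  proof (intro conjI ballI impI)
    have "transpose_mat ?\<Phi> = ?c \<cdot>\<^sub>m transpose_mat \<Phi>" by (intro eq_matI) auto
    thus "sym_mat n ?\<Phi>" using \<Phi>c by (simp add: sym_mat_def)
    fix x :: "real vec" assume x: "x \<in> carrier_vec n" "x \<noteq> 0\<^sub>v n"
    have "qf ?\<Phi> x = ?c * qf \<Phi> x"
      using smult_mat_mult_vec[OF \<Phi>c(1) x(1)] mult_mat_vec_carrier[OF \<Phi>c(1) x(1)] x by simp
    thus "0 < qf ?\<Phi> x" using \<Phi> x \<alpha> by (simp add: pos_def_def)
  qed
  have lead': "sym_mat (n + n + n) (lmi_lead m p L ?D ?\<Phi>)"
    by (rule lmi_lead_sym[of L ?D m p ?\<Phi>, folded n_def, OF L D' pos_def_carrier(2)[OF \<Phi>']])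
  have "pos_def (n + n + n) (lmi_mat m p L T Pm u y ?D ?\<Phi>)"
    unfolding pos_def_def lmi_mat_split
  proof (intro conjI ballI impI sym_minus lead' data_sym)
    fix v :: "real vec" assume v: "v \<in> carrier_vec (n + n + n)" "v \<noteq> 0\<^sub>v (n + n + n)"
    obtain x z w where xzw: "x \<in> carrier_vec n" "z \<in> carrier_vec n" "w \<in> carrier_vec n" and v_eq: "v = (x @\<^sub>v z) @\<^sub>v w"
      using split[OF v(1)] by blast
    have "qf (lmi_lead m p L ?D ?\<Phi>) v = ?c * qf (lmi_lead m p L D \<Phi>) v"
      unfolding v_eq by (rule lmi_lead_qf_scale[of L D m p \<Phi>, folded n_def, OF L D \<Phi>c(2) xzw])
    moreover have "qf (lmi_data m p L T Pm u y) v < ?c * qf (lmi_lead m p L D \<Phi>) v"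
      using S[OF v] \<alpha> by (simp add: pos_less_divide_eq mult.commute)
    ultimately show "0 < qf (lmi_lead m p L ?D ?\<Phi> - lmi_data m p L T Pm u y) v"
      using qf_minus[OF _ data v(1), of "lmi_lead m p L ?D ?\<Phi>"] lead' by (simp add: sym_mat_def)
  qed
  moreover have n3: "n + n + n = 3 * n" by simp
  ultimately have "lmi_solution m p L T Pm u y ?D ?\<Phi>"
    using D' \<Phi>' n3 unfolding lmi_solution_def n_def by metis
  thus ?thesis by blast
qed

section \<open>Trajectories of the closed loop\<close>

lemma shift_sum_carrier:
  assumes A: "\<And>k. k < L \<Longrightarrow> A k \<in> carrier_mat r c" and f: "\<And>t. f t \<in> carrier_vec c"
  shows "shift_sum r L A f t \<in> carrier_vec r"
  unfolding shift_sum_def using mult_mat_vec_carrier[OF A f] by (intro finsum_vec_closed) auto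

lemma shift_sum_index:
  assumes A: "\<And>k. k < L \<Longrightarrow> A k \<in> carrier_mat r c" and f: "\<And>t. f t \<in> carrier_vec c" and i: "i < r"
  shows "shift_sum r L A f t $ i = (\<Sum>k<L. \<Sum>s<c. A k $$ (i, s) * f (t + k) $ s)"
proof -
  have Af: "A k *\<^sub>v f (t + k) \<in> carrier_vec r" if "k < L" for k
    using mult_mat_vec_carrier[OF A[OF that] f] .
  have "shift_sum r L A f t $ i = (\<Sum>k<L. (A k *\<^sub>v f (t + k)) $ i)"
    unfolding shift_sum_def using Af i by (subst index_finsum_vec) auto
  also have "\<dots> = (\<Sum>k<L. \<Sum>s<c. A k $$ (i, s) * f (t + k) $ s)"
  proof (rule sum.cong[OF refl])
    fix k assume "k \<in> {..<L}"
    hence "A k \<in> carrier_mat r c" using A by simp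
    thus "(A k *\<^sub>v f (t + k)) $ i = (\<Sum>s<c. A k $$ (i, s) * f (t + k) $ s)"
      using f[of "t + k"] i by (simp add: scalar_prod_def lessThan_atLeast0)
  qed
  finally show ?thesis .
qed

lemma shift_sum_uminus_index:
  assumes A: "\<And>k. k < L \<Longrightarrow> A k \<in> carrier_mat r c" and f: "\<And>t. f t \<in> carrier_vec c" and i: "i < r"
  shows "shift_sum r L (\<lambda>k. - A k) f t $ i = - shift_sum r L A f t $ i"
proof -
  have A': "- A k \<in> carrier_mat r c" if "k < L" for k using A[OF that] by simp
  have "(\<Sum>k<L. \<Sum>s<c. (- A k) $$ (i, s) * f (t + k) $ s) = (\<Sum>k<L. - (\<Sum>s<c. A k $$ (i, s) * f (t + k) $ s))"
    unfolding sum_negf[symmetric]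
  proof (intro sum.cong refl)
    fix k s assume "k \<in> {..<L}" "s \<in> {..<c}"
    thus "(- A k) $$ (i, s) * f (t + k) $ s = - (A k $$ (i, s) * f (t + k) $ s)" using A[of k] i by simp
  qed
  thus ?thesis by (simp add: shift_sum_index[OF A' f i] shift_sum_index[OF A f i] sum_negf)
qed

lemma stacked_carrier: "stacked q L w t \<in> carrier_vec (q * L)"
  by (simp add: stacked_def)

lemma io_traj_stacked:
  assumes "0 < L" "j < q"
  shows "io_traj u y t $ j = stacked q L (io_traj u y) t $ j"
proof -
  have "j < q * L" using assms by (cases L) auto
  thus ?thesis using assms by (simp add: stacked_def)
qed

text \<open>
  Systems and controllers have coefficient matrices of the same shape, up to signs: each block holds
  the coefficients of the input followed by those of the output.
\<close>

lemma block_coeff_mult_stacked: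
  fixes r m p L :: nat
  assumes q: "0 < p + m" and A: "\<And>k. k < L \<Longrightarrow> A k \<in> carrier_mat r m" and B: "\<And>k. k < L \<Longrightarrow> B k \<in> carrier_mat r p"
    and u: "\<And>t. u t \<in> carrier_vec m" and y: "\<And>t. y t \<in> carrier_vec p" and i: "i < r"
  shows "(mat r ((p + m) * L) (\<lambda>(i, j). let k = j div (p + m); s = j mod (p + m)
      in if s < m then A k $$ (i, s) else B k $$ (i, s - m)) *\<^sub>v stacked (p + m) L (io_traj u y) t) $ i =
    shift_sum r L A u t $ i + shift_sum r L B y t $ i"
proof -
  let ?q = "p + m"
  let ?g = "\<lambda>k s. (if s < m then A k $$ (i, s) else B k $$ (i, s - m)) * io_traj u y (t + k) $ s"
  have "(mat r (?q * L) (\<lambda>(i, j). let k = j div ?q; s = j mod ?q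
      in if s < m then A k $$ (i, s) else B k $$ (i, s - m)) *\<^sub>v stacked ?q L (io_traj u y) t) $ i =
      (\<Sum>j<?q * L. ?g (j div ?q) (j mod ?q))"
    using i by (simp add: scalar_prod_def stacked_def Let_def lessThan_atLeast0)
  also have "\<dots> = (\<Sum>k<L. \<Sum>s<?q. ?g k s)" by (rule sum_blocks[OF q])
  also have "\<dots> = (\<Sum>k<L. (\<Sum>s<m. A k $$ (i, s) * u (t + k) $ s) + (\<Sum>s<p. B k $$ (i, s) * y (t + k) $ s))"
  proof (rule sum.cong[OF refl])
    fix k
    have "(\<Sum>s<?q. ?g k s) = (\<Sum>s<m. ?g k s) + (\<Sum>s = m..<m + p. ?g k s)"
      using sum.atLeastLessThan_concat[of 0 m "m + p" "?g k"] by (simp only: lessThan_atLeast0 add.commute[of p m])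
    also have "(\<Sum>s = m..<m + p. ?g k s) = (\<Sum>s<p. ?g k (s + m))"
      using sum.shift_bounds_nat_ivl[of "?g k" 0 m p] by (simp add: lessThan_atLeast0 add.commute)
    also have "\<dots> = (\<Sum>s<p. B k $$ (i, s) * y (t + k) $ s)"
      using u[of "t + k"] y[of "t + k"] by (intro sum.cong) (auto simp: io_traj_def)
    also have "(\<Sum>s<m. ?g k s) = (\<Sum>s<m. A k $$ (i, s) * u (t + k) $ s)"
      using u[of "t + k"] y[of "t + k"] by (intro sum.cong) (auto simp: io_traj_def)
    finally show "(\<Sum>s<?q. ?g k s) = (\<Sum>s<m. A k $$ (i, s) * u (t + k) $ s) + (\<Sum>s<p. B k $$ (i, s) * y (t + k) $ s)" .
  qed
  also have "\<dots> = shift_sum r L A u t $ i + shift_sum r L B y t $ i"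
    by (simp add: sum.distrib shift_sum_index[OF A u i] shift_sum_index[OF B y i])
  finally show ?thesis .
qed

lemma sys_coeff_mult_stacked:
  assumes q: "0 < p + m" and PQ: "ar_system m p L P Q"
    and u: "\<And>t. u t \<in> carrier_vec m" and y: "\<And>t. y t \<in> carrier_vec p" and i: "i < p"
  shows "(sys_coeff m p L P Q *\<^sub>v stacked (p + m) L (io_traj u y) t) $ i =
    shift_sum p L P y t $ i - shift_sum p L Q u t $ i"
proof -
  have P: "P k \<in> carrier_mat p p" and Q: "Q k \<in> carrier_mat p m" if "k < L" for k
    using PQ that by (auto simp: ar_system_def)
  have Q': "- Q k \<in> carrier_mat p m" if "k < L" for k using Q[OF that] by simp
  have "sys_coeff m p L P Q = mat p ((p + m) * L) (\<lambda>(i, j). let k = j div (p + m); s = j mod (p + m)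
      in if s < m then (- Q k) $$ (i, s) else P k $$ (i, s - m))"
    unfolding sys_coeff_def
  proof (rule eq_matI)
    fix a b
    let ?l = "mat p ((p + m) * L) (\<lambda>(i, j). let k = j div (p + m); s = j mod (p + m)
      in if s < m then (- Q k) $$ (i, s) else P k $$ (i, s - m))"
    assume "a < dim_row ?l" "b < dim_col ?l"
    hence a: "a < p" and b: "b < (p + m) * L" by auto
    hence "b div (p + m) < L" by (simp add: less_mult_imp_div_less mult.commute)
    thus "mat p ((p + m) * L) (\<lambda>(i, j). let k = j div (p + m); r = j mod (p + m)
       in if r < m then - (Q k $$ (i, r)) else P k $$ (i, r - m)) $$ (a, b) = ?l $$ (a, b)"
      using Q[of "b div (p + m)"] a b by (simp add: Let_def)
  qed auto
  hence "(sys_coeff m p L P Q *\<^sub>v stacked (p + m) L (io_traj u y) t) $ i =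
    shift_sum p L (\<lambda>k. - Q k) u t $ i + shift_sum p L P y t $ i"
    by (simp only: block_coeff_mult_stacked[of p m L "\<lambda>k. - Q k" p P u y i t, OF q Q' P u y i])
  moreover have "shift_sum p L (\<lambda>k. - Q k) u t $ i = - shift_sum p L Q u t $ i"
    by (rule shift_sum_uminus_index[OF Q u i])
  ultimately show ?thesis by simp
qed

lemma ctrl_coeff_mult_stacked:
  assumes q: "0 < p + m" and GF: "ar_controller m p L G F"
    and u: "\<And>t. u t \<in> carrier_vec m" and y: "\<And>t. y t \<in> carrier_vec p" and i: "i < m"
  shows "(ctrl_coeff m p L G F *\<^sub>v stacked (p + m) L (io_traj u y) t) $ i =
    shift_sum m L G u t $ i - shift_sum m L F y t $ i"
proof -
  have G: "G k \<in> carrier_mat m m" and F: "F k \<in> carrier_mat m p" if "k < L" for k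
    using GF that by (auto simp: ar_controller_def)
  have F': "- F k \<in> carrier_mat m p" if "k < L" for k using F[OF that] by simp
  have "ctrl_coeff m p L G F = mat m ((p + m) * L) (\<lambda>(i, j). let k = j div (p + m); s = j mod (p + m)
      in if s < m then G k $$ (i, s) else (- F k) $$ (i, s - m))"
    unfolding ctrl_coeff_def
  proof (rule eq_matI)
    fix a b
    let ?l = "mat m ((p + m) * L) (\<lambda>(i, j). let k = j div (p + m); s = j mod (p + m)
      in if s < m then G k $$ (i, s) else (- F k) $$ (i, s - m))"
    assume "a < dim_row ?l" "b < dim_col ?l"
    hence a: "a < m" and b: "b < (p + m) * L" by auto
    hence "b div (p + m) < L" by (simp add: less_mult_imp_div_less mult.commute)
    moreover have "b mod (p + m) - m < p" if "\<not> b mod (p + m) < m"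
      using mod_less_divisor[OF q, of b] that by linarith
    ultimately show "mat m ((p + m) * L) (\<lambda>(i, j). let k = j div (p + m); r = j mod (p + m)
       in if r < m then G k $$ (i, r) else - (F k $$ (i, r - m))) $$ (a, b) = ?l $$ (a, b)"
      using F[of "b div (p + m)"] a b by (auto simp add: Let_def)
  qed auto
  hence "(ctrl_coeff m p L G F *\<^sub>v stacked (p + m) L (io_traj u y) t) $ i =
    shift_sum m L G u t $ i + shift_sum m L (\<lambda>k. - F k) y t $ i"
    by (simp only: block_coeff_mult_stacked[of p m L G m "\<lambda>k. - F k" u y i t, OF q G F' u y i])
  moreover have "shift_sum m L (\<lambda>k. - F k) y t $ i = - shift_sum m L F y t $ i"
    by (rule shift_sum_uminus_index[OF F y i])
  ultimately show ?thesis by simp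
qed

lemma closed_loop_step:
  assumes p: "0 < p" and L: "0 < L" and PQ: "ar_system m p L P Q" and GF: "ar_controller m p L G F"
    and cl: "closed_loop m p L P Q G F u y (\<lambda>_. 0\<^sub>v p)"
  shows "stacked (p + m) L (io_traj u y) (Suc t) =
    closed_loop_mat m p L (ctrl_coeff m p L G F) (sys_coeff m p L P Q) *\<^sub>v stacked (p + m) L (io_traj u y) t"
proof -
  let ?q = "p + m" and ?C = "ctrl_coeff m p L G F" and ?R = "sys_coeff m p L P Q"
  let ?\<eta> = "stacked ?q L (io_traj u y)"
  have q: "0 < ?q" using p by simp
  have u: "\<And>t. u t \<in> carrier_vec m" and y: "\<And>t. y t \<in> carrier_vec p" using cl by (auto simp: closed_loop_def)
  have C: "?C \<in> carrier_mat m (?q * L)" and R: "?R \<in> carrier_mat p (?q * L)"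
    by (simp_all add: ctrl_coeff_def sys_coeff_def)
  have G: "G k \<in> carrier_mat m m" and F: "F k \<in> carrier_mat m p" if "k < L" for k
    using GF that by (auto simp: ar_controller_def)
  have P: "P k \<in> carrier_mat p p" and Q: "Q k \<in> carrier_mat p m" if "k < L" for k
    using PQ that by (auto simp: ar_system_def)
  have sc: "shift_sum m L G u t \<in> carrier_vec m" "shift_sum m L F y t \<in> carrier_vec m"
    "shift_sum p L P y t \<in> carrier_vec p" "shift_sum p L Q u t \<in> carrier_vec p"
    using shift_sum_carrier[of L G m m u t, OF G u] shift_sum_carrier[of L F m p y t, OF F y]
      shift_sum_carrier[of L P p p y t, OF P y] shift_sum_carrier[of L Q p m u t, OF Q u] by simp_all
  have u_next: "u (t + L) $ i = - (?C *\<^sub>v ?\<eta> t) $ i" if i: "i < m" for i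
  proof -
    have "u (t + L) + shift_sum m L G u t = shift_sum m L F y t"
      using cl by (simp add: closed_loop_def controller_eq_def)
    from arg_cong[OF this, of "\<lambda>v. v $ i"] show ?thesis
      unfolding ctrl_coeff_mult_stacked[OF q GF u y i] using i sc by simp
  qed
  have y_next: "y (t + L) $ i = - (?R *\<^sub>v ?\<eta> t) $ i" if i: "i < p" for i
  proof -
    have "y (t + L) + shift_sum p L P y t = shift_sum p L Q u t + 0\<^sub>v p"
      using cl by (simp add: closed_loop_def system_eq_def)
    from arg_cong[OF this, of "\<lambda>v. v $ i"] show ?thesis
      unfolding sys_coeff_mult_stacked[OF q PQ u y i] using i sc by simp
  qed
  have n: "?q * L = ?q * (L - 1) + ?q" using L by (cases L) auto
  show ?thesis
    unfolding closed_loop_mat_mult[OF C R stacked_carrier]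
  proof (rule eq_vecI)
    let ?r = "(J_mat ?q L *\<^sub>v ?\<eta> t) @\<^sub>v (- (?C *\<^sub>v ?\<eta> t)) @\<^sub>v (- (?R *\<^sub>v ?\<eta> t))"
    have dims: "dim_vec (J_mat ?q L *\<^sub>v ?\<eta> t) = ?q * (L - 1)" "dim_vec (?C *\<^sub>v ?\<eta> t) = m" "dim_vec (?R *\<^sub>v ?\<eta> t) = p"
      using C R by (auto simp: J_mat_def)
    show "dim_vec (?\<eta> (Suc t)) = dim_vec ?r" using dims n by (simp add: stacked_def)
    fix j assume "j < dim_vec ?r"
    hence j: "j < ?q * (L - 1) + ?q" using dims by simp
    have lhs: "?\<eta> (Suc t) $ j = io_traj u y (Suc t + j div ?q) $ (j mod ?q)" using j n by (simp add: stacked_def)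
    show "?\<eta> (Suc t) $ j = ?r $ j"
    proof (cases "j < ?q * (L - 1)")
      case True
      have "?r $ j = ?\<eta> t $ (j + ?q)" using True dims J_mat_index[OF stacked_carrier True] by simp
      also have "\<dots> = io_traj u y (Suc t + j div ?q) $ (j mod ?q)"
        using True n q by (simp add: stacked_def)
      finally show ?thesis using lhs by simp
    next
      case False
      define s where "s = j - ?q * (L - 1)"
      have s: "j = s + ?q * (L - 1)" "s < ?q" using False j by (auto simp: s_def)
      have "(s + ?q * l) div ?q = l" for l using s(2) q by (simp only: div_mult_self2) simp
      moreover have "(s + ?q * l) mod ?q = s" for l using s(2) by (simp only: mod_mult_self2) simp
      ultimately have "j div ?q = L - 1" "j mod ?q = s" unfolding s(1) by blast+
      hence l: "?\<eta> (Suc t) $ j = (if s < m then u (t + L) $ s else y (t + L) $ (s - m))"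
        using lhs L s(2) u[of "t + L"] y[of "t + L"] by (simp add: io_traj_def)
      show ?thesis
      proof (cases "s < m")
        case True
        have "?r $ j = - (?C *\<^sub>v ?\<eta> t) $ s" using s dims True C by simp
        thus ?thesis using l u_next True by simp
      next
        case False
        have "?r $ j = - (?R *\<^sub>v ?\<eta> t) $ (s - m)" using s dims False R by simp
        thus ?thesis using l y_next[of "s - m"] False s by simp
      qed
    qed
  qed
qed

text \<open>
  The decrease \<open>\<Psi>(x) - \<Psi>(A x)\<close> dominates a multiple \<open>\<epsilon> \<Psi>(x)\<close>, so \<open>\<Psi>(\<eta> t)\<close> decays geometrically.
  Taking \<open>max 0 (1 - \<epsilon>)\<close> as the rate spares the proof of \<open>\<epsilon> \<le> 1\<close>.
\<close>

lemma contraction_tendsto_zero: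
  assumes \<Psi>: "pos_def n \<Psi>" and A: "A \<in> carrier_mat n n"
    and contr: "\<And>x. x \<in> carrier_vec n \<Longrightarrow> x \<noteq> 0\<^sub>v n \<Longrightarrow> qf \<Psi> (A *\<^sub>v x) < qf \<Psi> x"
    and \<eta>: "\<And>t. \<eta> t \<in> carrier_vec n" and step: "\<And>t. \<eta> (Suc t) = A *\<^sub>v \<eta> t"
    and j: "j < n"
  shows "(\<lambda>t. \<eta> t $ j) \<longlonglongrightarrow> 0"
proof -
  note \<Psi>c = pos_def_carrier[OF \<Psi>]
  let ?A = "transpose_mat A * \<Psi> * A"
  have Ac: "?A \<in> carrier_mat n n" using A \<Psi>c by simp
  have dec: "qf (\<Psi> - ?A) x = qf \<Psi> x - qf \<Psi> (A *\<^sub>v x)" if "x \<in> carrier_vec n" for x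
    using qf_minus[OF \<Psi>c(1) Ac that] qf_congruence[OF \<Psi>c(1) A that] by simp
  have "0 < qf (\<Psi> - ?A) x" if "x \<in> carrier_vec n" "x \<noteq> 0\<^sub>v n" for x
    using dec contr that by simp
  then obtain \<epsilon> where \<epsilon>: "0 < \<epsilon>" "\<And>x. x \<in> carrier_vec n \<Longrightarrow> \<epsilon> * qf \<Psi> x \<le> qf (\<Psi> - ?A) x"
    using pos_form_dominates[OF \<Psi>c(1) minus_carrier_mat[OF Ac]] by metis
  have \<Psi>0: "0 \<le> qf \<Psi> x" if "x \<in> carrier_vec n" for x
    using pos_def_imp_psd[OF \<Psi>] that by (simp add: pos_semidef_def)
  have "0 < qf \<Psi> x" if "x \<in> carrier_vec n" "x \<noteq> 0\<^sub>v n" for x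
    using \<Psi> that by (simp add: pos_def_def)
  then obtain \<delta> where \<delta>: "0 < \<delta>" "\<And>x. x \<in> carrier_vec n \<Longrightarrow> \<delta> * qf (1\<^sub>m n) x \<le> qf \<Psi> x"
    using pos_form_dominates[OF one_carrier_mat \<Psi>c(1)] by metis
  define \<rho> where "\<rho> = max 0 (1 - \<epsilon>)"
  have \<rho>: "0 \<le> \<rho>" "\<rho> < 1" using \<epsilon>(1) by (auto simp: \<rho>_def)
  have decay: "qf \<Psi> (\<eta> t) \<le> \<rho> ^ t * qf \<Psi> (\<eta> 0)" for t
  proof (induction t)
    case (Suc t)
    have "qf \<Psi> (\<eta> (Suc t)) \<le> (1 - \<epsilon>) * qf \<Psi> (\<eta> t)"
      using \<epsilon>(2)[OF \<eta>[of t]] dec[OF \<eta>[of t]] by (simp add: step algebra_simps)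
    also have "\<dots> \<le> \<rho> * qf \<Psi> (\<eta> t)" using \<Psi>0[OF \<eta>] by (intro mult_right_mono) (auto simp: \<rho>_def)
    also have "\<dots> \<le> \<rho> * (\<rho> ^ t * qf \<Psi> (\<eta> 0))" using Suc \<rho> by (intro mult_left_mono) auto
    finally show ?case by (simp add: mult.assoc)
  qed simp
  have bound: "(\<eta> t $ j)\<^sup>2 \<le> \<rho> ^ t * (qf \<Psi> (\<eta> 0) / \<delta>)" for t
  proof -
    have "(\<eta> t $ j)\<^sup>2 \<le> (\<Sum>i = 0..<n. \<eta> t $ i * \<eta> t $ i)"
      unfolding power2_eq_square using j by (intro member_le_sum) auto
    also have "\<dots> = qf (1\<^sub>m n) (\<eta> t)" using \<eta>[of t] by (simp add: scalar_prod_def)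
    also have "\<dots> \<le> qf \<Psi> (\<eta> t) / \<delta>" using \<delta>(1) \<delta>(2)[OF \<eta>[of t]] by (simp add: pos_le_divide_eq mult.commute)
    also have "\<dots> \<le> \<rho> ^ t * qf \<Psi> (\<eta> 0) / \<delta>" using decay[of t] \<delta>(1) by (intro divide_right_mono) auto
    finally show ?thesis by simp
  qed
  have "(\<lambda>t. \<rho> ^ t * (qf \<Psi> (\<eta> 0) / \<delta>)) \<longlonglongrightarrow> 0"
    using \<rho> by (intro tendsto_mult_left_zero LIMSEQ_power_zero) simp
  hence "(\<lambda>t. (\<eta> t $ j)\<^sup>2) \<longlonglongrightarrow> 0"
    using bound by (intro tendsto_sandwich[of "\<lambda>_. 0" "\<lambda>t. (\<eta> t $ j)\<^sup>2"]) auto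
  thus ?thesis by simp
qed

lemma contraction_stabilizes_lyapunov:
  fixes m p L :: nat
  defines "n \<equiv> (p + m) * L"
  assumes p: "0 < p" and L: "0 < L" and PQ: "ar_system m p L P Q" and GF: "ar_controller m p L G F"
    and \<Psi>: "pos_def n \<Psi>"
    and contr: "\<And>x. x \<in> carrier_vec n \<Longrightarrow> x \<noteq> 0\<^sub>v n \<Longrightarrow>
      qf \<Psi> (closed_loop_mat m p L (ctrl_coeff m p L G F) (sys_coeff m p L P Q) *\<^sub>v x) < qf \<Psi> x"
  shows "stabilizes m p L G F P Q" "lyapunov m p L P Q G F \<Psi>"
proof -
  let ?A = "closed_loop_mat m p L (ctrl_coeff m p L G F) (sys_coeff m p L P Q)"
  let ?\<eta> = "\<lambda>u y. stacked (p + m) L (io_traj u y)"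
  have A: "?A \<in> carrier_mat n n"
    using closed_loop_mat_carrier[OF L] by (simp add: n_def ctrl_coeff_def sys_coeff_def)
  have \<eta>: "?\<eta> u y t \<in> carrier_vec n" for u y t using stacked_carrier by (simp add: n_def)
  have \<Psi>0: "0 \<le> qf \<Psi> x" if "x \<in> carrier_vec n" for x
    using pos_def_imp_psd[OF \<Psi>] that by (simp add: pos_semidef_def)
  have qn: "j < n" if "j < p + m" for j using that L unfolding n_def by (cases L) auto
  show "stabilizes m p L G F P Q"
    unfolding stabilizes_def
  proof (intro allI impI)
    fix u y j assume cl: "closed_loop m p L P Q G F u y (\<lambda>_. 0\<^sub>v p)" and j: "j < p + m"
    have "(\<lambda>t. ?\<eta> u y t $ j) \<longlonglongrightarrow> 0"
      using contraction_tendsto_zero[of n \<Psi> ?A "?\<eta> u y" j, OF \<Psi> A contr \<eta> closed_loop_step[OF p L PQ GF cl] qn[OF j]] by simp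
    thus "(\<lambda>t. io_traj u y t $ j) \<longlonglongrightarrow> 0" by (simp add: io_traj_stacked[OF L j])
  qed
  show "lyapunov m p L P Q G F \<Psi>"
    unfolding lyapunov_def n_def[symmetric]
  proof (intro conjI allI impI)
    show "sym_mat n \<Psi>" by (rule pos_def_carrier[OF \<Psi>])
    fix u y assume cl: "closed_loop m p L P Q G F u y (\<lambda>_. 0\<^sub>v p)"
    have nabla: "qdf_nabla (p + m) L \<Psi> (io_traj u y) t = qf \<Psi> (?A *\<^sub>v ?\<eta> u y t) - qf \<Psi> (?\<eta> u y t)" for t
      by (simp add: qdf_nabla_def qdf_def closed_loop_step[OF p L PQ GF cl])
    have neg: "qdf_nabla (p + m) L \<Psi> (io_traj u y) t < 0" if "?\<eta> u y t \<noteq> 0\<^sub>v n" for t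
      unfolding nabla using contr[OF \<eta> that] by simp
    fix t
    show "0 \<le> qdf (p + m) L \<Psi> (io_traj u y) t" unfolding qdf_def by (rule \<Psi>0[OF \<eta>])
    show "qdf_nabla (p + m) L \<Psi> (io_traj u y) t \<le> 0"
    proof (cases "?\<eta> u y t = 0\<^sub>v n")
      case True
      have "?A *\<^sub>v 0\<^sub>v n = 0\<^sub>v n" using A by auto
      thus ?thesis unfolding nabla True by simp
    next
      case False
      thus ?thesis using neg[OF False] by simp
    qed
    assume "\<forall>t. qdf_nabla (p + m) L \<Psi> (io_traj u y) t = 0"
    hence z: "?\<eta> u y t = 0\<^sub>v n" using neg[of t] by force
    have "u t \<in> carrier_vec m" "y t \<in> carrier_vec p" using cl by (auto simp: closed_loop_def)
    hence dim: "dim_vec (io_traj u y t) = p + m" by (simp add: io_traj_def)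
    show "io_traj u y t = 0\<^sub>v (p + m)"
      using z qn dim by (intro eq_vecI) (simp_all add: io_traj_stacked[OF L])
  qed
qed

section \<open>Data-driven quadratic stabilization\<close>

theorem theorem22:
  fixes m p L T :: nat
    and Pm Pi11 Pi12 Pi21 Pi22 :: "real mat"
    and u y :: "nat \<Rightarrow> real vec"
  assumes "0 < m" and "0 < p" and "0 < L" and "L \<le> T"
    and "sym_mat p Pi11"
    and "Pi12 \<in> carrier_mat p (T - L + 1)"
    and "Pi21 \<in> carrier_mat (T - L + 1) p"
    and "sym_mat (T - L + 1) Pi22"
    and "Pm = four_block_mat Pi11 Pi12 Pi21 Pi22"
    and "sym_mat (p + (T - L + 1)) Pm"
    and "neg_def (T - L + 1) Pi22"
    and "pos_semidef p (gen_schur Pi11 Pi12 Pi21 Pi22)"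
    and "\<forall>t \<le> T. u t \<in> carrier_vec m \<and> y t \<in> carrier_vec p"
    and "\<exists>P Q. ar_system m p L P Q \<and> generates p L T Pm u y P Q"
    and "vec_space.rank ((p + m) * L) (hankel1 m p L T u y) = (p + m) * L"
  shows "(informative_quad_stab m p L T Pm u y \<longleftrightarrow>
            (\<exists>D \<Phi>. lmi_solution m p L T Pm u y D \<Phi>)) \<and>
         (\<forall>D \<Phi>. lmi_solution m p L T Pm u y D \<Phi> \<longrightarrow>
            (\<forall>G F. ar_controller m p L G F \<and> ctrl_coeff m p L G F = - D * mat_inv \<Phi> \<longrightarrow>
               (\<forall>P Q. ar_system m p L P Q \<and> compatible m p L T Pm u y (sys_coeff m p L P Q) \<longrightarrow>
                  stabilizes m p L G F P Q \<and>
                  lyapunov m p L P Q G F (mat_inv \<Phi>))))"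
proof -
  let ?n = "(p + m) * L"
  have L: "0 < L" and p: "0 < p" using assms by simp_all
  have N: "sym_mat (p + ?n) (data_mat m p L T Pm u y)" by (rule data_mat_sym[OF assms(4,10)])
  have neg: "qf (data_mat m p L T Pm u y) (0\<^sub>v p @\<^sub>v z) < 0" if "z \<in> carrier_vec ?n" "z \<noteq> 0\<^sub>v ?n" for z
    by (rule data_mat_neg[OF assms(4,9,10,5,6,7,11,15) that])
  have Pm: "Pm \<in> carrier_mat (p + (T - L + 1)) (p + (T - L + 1))" using assms(10) by (simp add: sym_mat_def)
  obtain R0 where R0: "compatible m p L T Pm u y R0"
    using assms(14) compatible_iff_generates[OF _ p assms(4) Pm assms(13)] by blast
  have carrier: "R \<in> carrier_mat p ?n" if "compatible m p L T Pm u y R" for R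
    using that by (simp add: compatible_def)
  have inf: "informative_quad_stab m p L T Pm u y \<longleftrightarrow> (\<exists>C \<Psi>. C \<in> carrier_mat m ?n \<and> pos_semidef ?n \<Psi> \<and>
      (\<forall>R. compatible m p L T Pm u y R \<longrightarrow>
        (\<forall>x \<in> carrier_vec ?n. x \<noteq> 0\<^sub>v ?n \<longrightarrow> qf \<Psi> (closed_loop_mat m p L C R *\<^sub>v x) < qf \<Psi> x)))"
    unfolding informative_quad_stab_def Let_def[of "p + m"] Let_def[of "?n"]
    by (intro ex_cong1 conj_cong all_cong1 imp_cong refl quad_stab_iff[OF L _ carrier])
       (simp_all add: pos_semidef_def)
  show ?thesis
  proof (intro conjI iffI allI impI; (elim conjE)?)
    assume "informative_quad_stab m p L T Pm u y"
    then obtain C \<Psi> where C: "C \<in> carrier_mat m ?n" "pos_semidef ?n \<Psi>"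
      "\<And>R x. compatible m p L T Pm u y R \<Longrightarrow> x \<in> carrier_vec ?n \<Longrightarrow> x \<noteq> 0\<^sub>v ?n \<Longrightarrow>
        qf \<Psi> (closed_loop_mat m p L C R *\<^sub>v x) < qf \<Psi> x"
      unfolding inf by blast
    show "\<exists>D \<Phi>. lmi_solution m p L T Pm u y D \<Phi>"
      by (rule quad_stab_imp_lmi[OF L p N neg R0 C])
  next
    assume "\<exists>D \<Phi>. lmi_solution m p L T Pm u y D \<Phi>"
    then obtain D \<Phi> where lmi: "lmi_solution m p L T Pm u y D \<Phi>" by blast
    hence D: "D \<in> carrier_mat m ?n" and \<Phi>: "pos_def ?n \<Phi>" by (auto simp: lmi_solution_def)
    have "- D * mat_inv \<Phi> \<in> carrier_mat m ?n" using D mat_inv_pos_def[OF \<Phi>] by simp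
    thus "informative_quad_stab m p L T Pm u y"
      unfolding inf using pos_def_imp_psd[OF mat_inv_pos_def(4)[OF \<Phi>]] lmi_contraction[OF L N lmi] by blast
  next
    fix D \<Phi> G F P Q
    assume lmi: "lmi_solution m p L T Pm u y D \<Phi>" and GF: "ar_controller m p L G F"
      and C: "ctrl_coeff m p L G F = - D * mat_inv \<Phi>" and PQ: "ar_system m p L P Q"
      and comp: "compatible m p L T Pm u y (sys_coeff m p L P Q)"
    have \<Psi>: "pos_def ?n (mat_inv \<Phi>)" using lmi mat_inv_pos_def(4) by (auto simp: lmi_solution_def)
    note contr = lmi_contraction[OF L N lmi comp, folded C]
    show "stabilizes m p L G F P Q" "lyapunov m p L P Q G F (mat_inv \<Phi>)"
      using contraction_stabilizes_lyapunov[OF p L PQ GF \<Psi> contr] by blast+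
  qed
qed

end
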